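(* Let $\mathbb{C}$ be a finitely cocomplete Barr-exact unital category, and $\mathsf{Ab}(\mathbb{C})$ its abelian core. Then normal extensions with respect to the induced Galois structure $\Gamma_{\mathrm{Ab}}$ are reflective amongst regular epimorphisms: the full subcategory of the category of arrows of $\mathbb{C}$ determined by the normal extensions is reflective in the full subcategory determined by the regular epimorphisms.
   Context: A pointed finitely complete category $\mathbb{C}$ is unital when, for every pair of objects $A,B$, the morphisms $\langle 1_A,0\rangle\colon A\to A\times B$ and $\langle 0,1_B\rangle\colon B\to A\times B$ are jointly strongly epimorphic. An object of a unital category is abelian when it carries an internal abelian group structure (necessarily unique). $\mathsf{Ab}(\mathbb{C})$ is the full subcategory of abelian objects, called the abelian core. For $\mathbb{C}$ finitely cocomplete, regular and unital, $\mathsf{Ab}(\mathbb{C})$ is a reflective subcategory of $\mathbb{C}$, with reflector $\mathrm{ab}$ and unit $\eta^{\mathrm{ab}}$; this adjunction together with the classes of regular epimorphisms in $\mathbb{C}$ and in $\mathsf{Ab}(\mathbb{C})$ is the Galois structure $\Gamma_{\mathrm{Ab}}$. A trivial extension (with respect to $\Gamma_{\mathrm{Ab}}$) is a regular epimorphism $f\colon A\to B$ in $\mathbb{C}$ such that the naturality square $\mathrm{ab}(f)\circ\eta^{\mathrm{ab}}_A=\eta^{\mathrm{ab}}_B\circ f$ is a pullback. A normal extension is a regular epimorphism in $\mathbb{C}$ whose kernel pair projections are trivial extensions. *)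

theory Defs
  imports Main
begin

section \<open>Categories, functors, adjunctions\<close>

record ('o, 'm) category =
  Obj :: "'o set"
  Mor :: "'m set"
  Dom :: "'m \<Rightarrow> 'o"
  Cod :: "'m \<Rightarrow> 'o"
  Idm :: "'o \<Rightarrow> 'm"
  Comp :: "'m \<Rightarrow> 'm \<Rightarrow> 'm" (infixl "\<cdot>\<index>" 70)

text \<open>\<open>Comp\<close> is in applicative order: first the right-hand argument, then the left-hand one.
  The record fields are only meaningful on \<open>Obj\<close>, \<open>Mor\<close> and composable pairs.\<close>

definition hom :: "('o, 'm) category \<Rightarrow> 'o \<Rightarrow> 'o \<Rightarrow> 'm set" where
  "hom C A B = {f \<in> Mor C. Dom C f = A \<and> Cod C f = B}"

locale category =
  fixes C :: "('o, 'm) category" (structure)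
  assumes dom_obj: "f \<in> Mor C \<Longrightarrow> Dom C f \<in> Obj C"
    and cod_obj: "f \<in> Mor C \<Longrightarrow> Cod C f \<in> Obj C"
    and id_hom: "A \<in> Obj C \<Longrightarrow> Idm C A \<in> hom C A A"
    and comp_hom: "f \<in> hom C X Y \<Longrightarrow> g \<in> hom C Y Z \<Longrightarrow> g \<cdot> f \<in> hom C X Z"
    and comp_id_right: "f \<in> hom C X Y \<Longrightarrow> f \<cdot> Idm C X = f"
    and comp_id_left: "f \<in> hom C X Y \<Longrightarrow> Idm C Y \<cdot> f = f"
    and comp_assoc: "f \<in> hom C W X \<Longrightarrow> g \<in> hom C X Y \<Longrightarrow> h \<in> hom C Y Z \<Longrightarrow>
      (h \<cdot> g) \<cdot> f = h \<cdot> (g \<cdot> f)"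

definition op_category :: "('o, 'm) category \<Rightarrow> ('o, 'm) category" where
  "op_category C = \<lparr>Obj = Obj C, Mor = Mor C, Dom = Cod C, Cod = Dom C, Idm = Idm C,
     Comp = (\<lambda>g f. f \<cdot>\<^bsub>C\<^esub> g)\<rparr>"

definition full_subcategory :: "('o, 'm) category \<Rightarrow> 'o set \<Rightarrow> ('o, 'm) category" where
  "full_subcategory C S = C\<lparr>Obj := Obj C \<inter> S,
     Mor := {f \<in> Mor C. Dom C f \<in> S \<and> Cod C f \<in> S}\<rparr>"

text \<open>A morphism from \<open>f\<close> to \<open>g\<close> in the category of arrows is a commutative square
  \<open>v \<cdot> f = g \<cdot> u\<close>; it is encoded as \<open>(f, g, u, v)\<close>, so that it determines its domain and
  codomain.\<close>

definition arrow_category :: "('o, 'm) category \<Rightarrow> ('m, 'm \<times> 'm \<times> 'm \<times> 'm) category" where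
  "arrow_category C = \<lparr>
     Obj = Mor C,
     Mor = {(f, g, u, v). f \<in> Mor C \<and> g \<in> Mor C \<and>
              u \<in> hom C (Dom C f) (Dom C g) \<and> v \<in> hom C (Cod C f) (Cod C g) \<and>
              v \<cdot>\<^bsub>C\<^esub> f = g \<cdot>\<^bsub>C\<^esub> u},
     Dom = (\<lambda>(f, g, u, v). f),
     Cod = (\<lambda>(f, g, u, v). g),
     Idm = (\<lambda>f. (f, f, Idm C (Dom C f), Idm C (Cod C f))),
     Comp = (\<lambda>(g, h, u', v') (f, g', u, v). (f, h, u' \<cdot>\<^bsub>C\<^esub> u, v' \<cdot>\<^bsub>C\<^esub> v))\<rparr>"

record ('o1, 'm1, 'o2, 'm2) functor_data =
  on_obj :: "'o1 \<Rightarrow> 'o2"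
  on_mor :: "'m1 \<Rightarrow> 'm2"

definition is_functor ::
  "('o1, 'm1) category \<Rightarrow> ('o2, 'm2) category \<Rightarrow> ('o1, 'm1, 'o2, 'm2) functor_data \<Rightarrow> bool" where
  "is_functor C D F \<longleftrightarrow>
     (\<forall>A \<in> Obj C. on_obj F A \<in> Obj D) \<and>
     (\<forall>A B. \<forall>f \<in> hom C A B. on_mor F f \<in> hom D (on_obj F A) (on_obj F B)) \<and>
     (\<forall>A \<in> Obj C. on_mor F (Idm C A) = Idm D (on_obj F A)) \<and>
     (\<forall>X Y Z. \<forall>f \<in> hom C X Y. \<forall>g \<in> hom C Y Z.
        on_mor F (g \<cdot>\<^bsub>C\<^esub> f) = on_mor F g \<cdot>\<^bsub>D\<^esub> on_mor F f)"

definition id_functor :: "('o, 'm, 'o, 'm) functor_data" where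
  "id_functor = \<lparr>on_obj = (\<lambda>A. A), on_mor = (\<lambda>f. f)\<rparr>"

definition comp_functor ::
  "('o2, 'm2, 'o3, 'm3) functor_data \<Rightarrow> ('o1, 'm1, 'o2, 'm2) functor_data \<Rightarrow>
   ('o1, 'm1, 'o3, 'm3) functor_data" where
  "comp_functor G F =
     \<lparr>on_obj = (\<lambda>A. on_obj G (on_obj F A)), on_mor = (\<lambda>f. on_mor G (on_mor F f))\<rparr>"

definition nat_trans ::
  "('o1, 'm1) category \<Rightarrow> ('o2, 'm2) category \<Rightarrow> ('o1, 'm1, 'o2, 'm2) functor_data \<Rightarrow>
   ('o1, 'm1, 'o2, 'm2) functor_data \<Rightarrow> ('o1 \<Rightarrow> 'm2) \<Rightarrow> bool" where
  "nat_trans C D F G \<tau> \<longleftrightarrow>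
     (\<forall>A \<in> Obj C. \<tau> A \<in> hom D (on_obj F A) (on_obj G A)) \<and>
     (\<forall>A B. \<forall>f \<in> hom C A B. on_mor G f \<cdot>\<^bsub>D\<^esub> \<tau> A = \<tau> B \<cdot>\<^bsub>D\<^esub> on_mor F f)"

text \<open>\<open>F \<stileturn> G\<close> with unit \<open>\<eta>\<close>, each component of which is universal from an object to \<open>G\<close>.\<close>

definition adjunction ::
  "('o1, 'm1) category \<Rightarrow> ('o2, 'm2) category \<Rightarrow> ('o1, 'm1, 'o2, 'm2) functor_data \<Rightarrow>
   ('o2, 'm2, 'o1, 'm1) functor_data \<Rightarrow> ('o1 \<Rightarrow> 'm1) \<Rightarrow> bool" where
  "adjunction C D F G \<eta> \<longleftrightarrow>
     is_functor C D F \<and> is_functor D C G \<and>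
     nat_trans C C id_functor (comp_functor G F) \<eta> \<and>
     (\<forall>A \<in> Obj C. \<forall>B \<in> Obj D. \<forall>f \<in> hom C A (on_obj G B).
        \<exists>!g. g \<in> hom D (on_obj F A) B \<and> on_mor G g \<cdot>\<^bsub>C\<^esub> \<eta> A = f)"

text \<open>The inclusion of a full subcategory acts as the identity on the underlying types, hence it is
  represented by \<open>id_functor\<close>.\<close>

definition reflective :: "('o, 'm) category \<Rightarrow> 'o set \<Rightarrow> bool" where
  "reflective C S \<longleftrightarrow> S \<subseteq> Obj C \<and> (\<exists>F \<eta>. adjunction C (full_subcategory C S) F id_functor \<eta>)"


section \<open>Limits\<close>

definition is_cone ::
  "('j, 'k) category \<Rightarrow> ('o, 'm) category \<Rightarrow> ('j, 'k, 'o, 'm) functor_data \<Rightarrow> 'o \<Rightarrow> ('j \<Rightarrow> 'm) \<Rightarrow> bool"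
where
  "is_cone J C D L \<pi> \<longleftrightarrow> L \<in> Obj C \<and>
     (\<forall>j \<in> Obj J. \<pi> j \<in> hom C L (on_obj D j)) \<and>
     (\<forall>i j. \<forall>u \<in> hom J i j. on_mor D u \<cdot>\<^bsub>C\<^esub> \<pi> i = \<pi> j)"

definition is_limit ::
  "('j, 'k) category \<Rightarrow> ('o, 'm) category \<Rightarrow> ('j, 'k, 'o, 'm) functor_data \<Rightarrow> 'o \<Rightarrow> ('j \<Rightarrow> 'm) \<Rightarrow> bool"
where
  "is_limit J C D L \<pi> \<longleftrightarrow> is_cone J C D L \<pi> \<and>
     (\<forall>X \<xi>. is_cone J C D X \<xi> \<longrightarrow>
        (\<exists>!h. h \<in> hom C X L \<and> (\<forall>j \<in> Obj J. \<pi> j \<cdot>\<^bsub>C\<^esub> h = \<xi> j)))"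

text \<open>Every finite category is isomorphic to one whose objects and morphisms are natural numbers,
  so these shapes suffice.\<close>

definition finitely_complete :: "('o, 'm) category \<Rightarrow> bool" where
  "finitely_complete C \<longleftrightarrow> category C \<and>
     (\<forall>(J :: (nat, nat) category) D.
        category J \<and> finite (Obj J) \<and> finite (Mor J) \<and> is_functor J C D \<longrightarrow>
        (\<exists>L \<pi>. is_limit J C D L \<pi>))"

definition finitely_cocomplete :: "('o, 'm) category \<Rightarrow> bool" where
  "finitely_cocomplete C \<longleftrightarrow> finitely_complete (op_category C)"

definition terminal :: "('o, 'm) category \<Rightarrow> 'o \<Rightarrow> bool" where
  "terminal C T \<longleftrightarrow> T \<in> Obj C \<and> (\<forall>X \<in> Obj C. \<exists>!t. t \<in> hom C X T)"

definition initial :: "('o, 'm) category \<Rightarrow> 'o \<Rightarrow> bool" where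
  "initial C I \<longleftrightarrow> I \<in> Obj C \<and> (\<forall>X \<in> Obj C. \<exists>!t. t \<in> hom C I X)"

definition is_product :: "('o, 'm) category \<Rightarrow> 'o \<Rightarrow> 'o \<Rightarrow> 'o \<Rightarrow> 'm \<Rightarrow> 'm \<Rightarrow> bool" where
  "is_product C A B P p q \<longleftrightarrow> p \<in> hom C P A \<and> q \<in> hom C P B \<and>
     (\<forall>X. \<forall>f \<in> hom C X A. \<forall>g \<in> hom C X B.
        \<exists>!h. h \<in> hom C X P \<and> p \<cdot>\<^bsub>C\<^esub> h = f \<and> q \<cdot>\<^bsub>C\<^esub> h = g)"

text \<open>The morphism \<open>\<langle>f, g\<rangle>\<close> into the product with projections \<open>p\<close> and \<open>q\<close>.\<close>

definition pairing :: "('o, 'm) category \<Rightarrow> 'm \<Rightarrow> 'm \<Rightarrow> 'm \<Rightarrow> 'm \<Rightarrow> 'm" where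
  "pairing C p q f g =
     (THE h. h \<in> hom C (Dom C f) (Dom C p) \<and> p \<cdot>\<^bsub>C\<^esub> h = f \<and> q \<cdot>\<^bsub>C\<^esub> h = g)"

text \<open>The square \<open>f \<cdot> p = g \<cdot> q\<close> is a pullback.\<close>

definition is_pullback :: "('o, 'm) category \<Rightarrow> 'm \<Rightarrow> 'm \<Rightarrow> 'm \<Rightarrow> 'm \<Rightarrow> bool" where
  "is_pullback C f g p q \<longleftrightarrow>
     f \<in> Mor C \<and> g \<in> Mor C \<and> p \<in> Mor C \<and> q \<in> Mor C \<and>
     Cod C f = Cod C g \<and> Dom C p = Dom C q \<and> Cod C p = Dom C f \<and> Cod C q = Dom C g \<and>
     f \<cdot>\<^bsub>C\<^esub> p = g \<cdot>\<^bsub>C\<^esub> q \<and>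
     (\<forall>X. \<forall>a \<in> hom C X (Dom C f). \<forall>b \<in> hom C X (Dom C g). f \<cdot>\<^bsub>C\<^esub> a = g \<cdot>\<^bsub>C\<^esub> b \<longrightarrow>
        (\<exists>!h. h \<in> hom C X (Dom C p) \<and> p \<cdot>\<^bsub>C\<^esub> h = a \<and> q \<cdot>\<^bsub>C\<^esub> h = b))"

definition kernel_pair :: "('o, 'm) category \<Rightarrow> 'm \<Rightarrow> 'm \<Rightarrow> 'm \<Rightarrow> bool" where
  "kernel_pair C f p q \<longleftrightarrow> is_pullback C f f p q"


section \<open>Barr-exact categories\<close>

definition monic :: "('o, 'm) category \<Rightarrow> 'm \<Rightarrow> bool" where
  "monic C m \<longleftrightarrow> m \<in> Mor C \<and>
     (\<forall>X. \<forall>a \<in> hom C X (Dom C m). \<forall>b \<in> hom C X (Dom C m).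
        m \<cdot>\<^bsub>C\<^esub> a = m \<cdot>\<^bsub>C\<^esub> b \<longrightarrow> a = b)"

definition is_coequalizer :: "('o, 'm) category \<Rightarrow> 'm \<Rightarrow> 'm \<Rightarrow> 'm \<Rightarrow> bool" where
  "is_coequalizer C u v f \<longleftrightarrow>
     u \<in> Mor C \<and> v \<in> Mor C \<and> f \<in> Mor C \<and>
     Dom C u = Dom C v \<and> Cod C u = Dom C f \<and> Cod C v = Dom C f \<and>
     f \<cdot>\<^bsub>C\<^esub> u = f \<cdot>\<^bsub>C\<^esub> v \<and>
     (\<forall>Y. \<forall>g \<in> hom C (Dom C f) Y. g \<cdot>\<^bsub>C\<^esub> u = g \<cdot>\<^bsub>C\<^esub> v \<longrightarrow>
        (\<exists>!h. h \<in> hom C (Cod C f) Y \<and> h \<cdot>\<^bsub>C\<^esub> f = g))"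

definition regular_epi :: "('o, 'm) category \<Rightarrow> 'm \<Rightarrow> bool" where
  "regular_epi C f \<longleftrightarrow> (\<exists>u v. is_coequalizer C u v f)"

definition regular_category :: "('o, 'm) category \<Rightarrow> bool" where
  "regular_category C \<longleftrightarrow> finitely_complete C \<and>
     (\<forall>f p q. kernel_pair C f p q \<longrightarrow> (\<exists>e. is_coequalizer C p q e)) \<and>
     (\<forall>f g p q. is_pullback C f g p q \<and> regular_epi C f \<longrightarrow> regular_epi C q)"

definition equivalence_relation :: "('o, 'm) category \<Rightarrow> 'o \<Rightarrow> 'm \<Rightarrow> 'm \<Rightarrow> bool" where
  "equivalence_relation C X r\<^sub>1 r\<^sub>2 \<longleftrightarrow>
     (\<exists>R. r\<^sub>1 \<in> hom C R X \<and> r\<^sub>2 \<in> hom C R X \<and>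
        (\<forall>W. \<forall>a \<in> hom C W R. \<forall>b \<in> hom C W R.
           r\<^sub>1 \<cdot>\<^bsub>C\<^esub> a = r\<^sub>1 \<cdot>\<^bsub>C\<^esub> b \<and> r\<^sub>2 \<cdot>\<^bsub>C\<^esub> a = r\<^sub>2 \<cdot>\<^bsub>C\<^esub> b \<longrightarrow> a = b) \<and>
        (\<exists>d \<in> hom C X R. r\<^sub>1 \<cdot>\<^bsub>C\<^esub> d = Idm C X \<and> r\<^sub>2 \<cdot>\<^bsub>C\<^esub> d = Idm C X) \<and>
        (\<exists>s \<in> hom C R R. r\<^sub>1 \<cdot>\<^bsub>C\<^esub> s = r\<^sub>2 \<and> r\<^sub>2 \<cdot>\<^bsub>C\<^esub> s = r\<^sub>1) \<and>
        (\<forall>p q. is_pullback C r\<^sub>2 r\<^sub>1 p q \<longrightarrow>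
           (\<exists>t \<in> hom C (Dom C p) R.
              r\<^sub>1 \<cdot>\<^bsub>C\<^esub> t = r\<^sub>1 \<cdot>\<^bsub>C\<^esub> p \<and> r\<^sub>2 \<cdot>\<^bsub>C\<^esub> t = r\<^sub>2 \<cdot>\<^bsub>C\<^esub> q)))"

definition Barr_exact :: "('o, 'm) category \<Rightarrow> bool" where
  "Barr_exact C \<longleftrightarrow> regular_category C \<and>
     (\<forall>X r\<^sub>1 r\<^sub>2. equivalence_relation C X r\<^sub>1 r\<^sub>2 \<longrightarrow> (\<exists>f. kernel_pair C f r\<^sub>1 r\<^sub>2))"


section \<open>Unital categories and abelian objects\<close>

definition zero_object :: "('o, 'm) category \<Rightarrow> 'o \<Rightarrow> bool" where
  "zero_object C Z \<longleftrightarrow> initial C Z \<and> terminal C Z"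

definition zero_morphism :: "('o, 'm) category \<Rightarrow> 'm \<Rightarrow> bool" where
  "zero_morphism C f \<longleftrightarrow>
     (\<exists>Z a b. zero_object C Z \<and> a \<in> hom C (Dom C f) Z \<and> b \<in> hom C Z (Cod C f) \<and> f = b \<cdot>\<^bsub>C\<^esub> a)"

text \<open>Jointly epimorphic, and orthogonal as a family to all monomorphisms (the diagonal filler is
  unique because \<open>m\<close> is a monomorphism).\<close>

definition jointly_strongly_epic :: "('o, 'm) category \<Rightarrow> 'm \<Rightarrow> 'm \<Rightarrow> bool" where
  "jointly_strongly_epic C i j \<longleftrightarrow>
     i \<in> Mor C \<and> j \<in> Mor C \<and> Cod C i = Cod C j \<and>
     (\<forall>Y. \<forall>a \<in> hom C (Cod C i) Y. \<forall>b \<in> hom C (Cod C i) Y.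
        a \<cdot>\<^bsub>C\<^esub> i = b \<cdot>\<^bsub>C\<^esub> i \<and> a \<cdot>\<^bsub>C\<^esub> j = b \<cdot>\<^bsub>C\<^esub> j \<longrightarrow> a = b) \<and>
     (\<forall>m. monic C m \<longrightarrow>
        (\<forall>h \<in> hom C (Cod C i) (Cod C m).
           \<forall>u \<in> hom C (Dom C i) (Dom C m). \<forall>v \<in> hom C (Dom C j) (Dom C m).
           m \<cdot>\<^bsub>C\<^esub> u = h \<cdot>\<^bsub>C\<^esub> i \<and> m \<cdot>\<^bsub>C\<^esub> v = h \<cdot>\<^bsub>C\<^esub> j \<longrightarrow>
           (\<exists>d \<in> hom C (Cod C i) (Dom C m).
              m \<cdot>\<^bsub>C\<^esub> d = h \<and> d \<cdot>\<^bsub>C\<^esub> i = u \<and> d \<cdot>\<^bsub>C\<^esub> j = v)))"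

definition unital :: "('o, 'm) category \<Rightarrow> bool" where
  "unital C \<longleftrightarrow> finitely_complete C \<and> (\<exists>Z. zero_object C Z) \<and>
     (\<forall>A B P p q z z'.
        is_product C A B P p q \<and>
        z \<in> hom C A B \<and> zero_morphism C z \<and> z' \<in> hom C B A \<and> zero_morphism C z' \<longrightarrow>
        jointly_strongly_epic C (pairing C p q (Idm C A) z) (pairing C p q z' (Idm C B)))"

text \<open>\<open>A\<close> with multiplication \<open>m\<close>, unit \<open>e\<close> and inverse \<open>i\<close>, where \<open>p, q\<close> are the projections of
  \<open>P = A \<times> A\<close>, and \<open>r, s\<close> those of \<open>(A \<times> A) \<times> A\<close>; \<open>z\<close> is the composite of \<open>e\<close> with the morphism
  from \<open>A\<close> to the terminal object \<open>T\<close>.  The remaining unit and inverse laws follow by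
  commutativity.\<close>

definition internal_abelian_group ::
  "('o, 'm) category \<Rightarrow> 'o \<Rightarrow> 'o \<Rightarrow> 'm \<Rightarrow> 'm \<Rightarrow> 'o \<Rightarrow> 'm \<Rightarrow> 'm \<Rightarrow> 'm \<Rightarrow> bool" where
  "internal_abelian_group C A P p q T m e i \<longleftrightarrow>
     is_product C A A P p q \<and> terminal C T \<and>
     m \<in> hom C P A \<and> e \<in> hom C T A \<and> i \<in> hom C A A \<and>
     (\<forall>W r s. is_product C P A W r s \<longrightarrow>
        m \<cdot>\<^bsub>C\<^esub> pairing C p q (m \<cdot>\<^bsub>C\<^esub> r) s =
        m \<cdot>\<^bsub>C\<^esub> pairing C p q (p \<cdot>\<^bsub>C\<^esub> r) (m \<cdot>\<^bsub>C\<^esub> pairing C p q (q \<cdot>\<^bsub>C\<^esub> r) s)) \<and>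
     (let z = e \<cdot>\<^bsub>C\<^esub> (THE t. t \<in> hom C A T) in
        m \<cdot>\<^bsub>C\<^esub> pairing C p q (Idm C A) z = Idm C A \<and>
        m \<cdot>\<^bsub>C\<^esub> pairing C p q (Idm C A) i = z) \<and>
     m \<cdot>\<^bsub>C\<^esub> pairing C p q q p = m"

definition abelian_objects :: "('o, 'm) category \<Rightarrow> 'o set" where
  "abelian_objects C = {A \<in> Obj C. \<exists>P p q T m e i. internal_abelian_group C A P p q T m e i}"

definition abelian_core :: "('o, 'm) category \<Rightarrow> ('o, 'm) category" where
  "abelian_core C = full_subcategory C (abelian_objects C)"


section \<open>Galois structures and extensions\<close>

text \<open>The data of a Galois structure, an adjunction \<open>left_adj \<stileturn> right_adj\<close> between \<open>base\<close> and \<open>target\<close>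
  together with a class of morphisms in each of them.  The counit is determined by the rest.\<close>

record ('o, 'm, 'o1, 'm1) galois_structure =
  base :: "('o, 'm) category"
  target :: "('o1, 'm1) category"
  left_adj :: "('o, 'm, 'o1, 'm1) functor_data"
  right_adj :: "('o1, 'm1, 'o, 'm) functor_data"
  adj_unit :: "'o \<Rightarrow> 'm"
  base_class :: "'m set"
  target_class :: "'m1 set"

text \<open>A reflector is unique only up to isomorphism, so \<open>\<Gamma>\<^sub>A\<^sub>b\<close> is specified by a predicate.\<close>

definition is_Gamma_Ab :: "('o, 'm) category \<Rightarrow> ('o, 'm, 'o, 'm) galois_structure \<Rightarrow> bool" where
  "is_Gamma_Ab C \<Gamma> \<longleftrightarrow>
     base \<Gamma> = C \<and> target \<Gamma> = abelian_core C \<and> right_adj \<Gamma> = id_functor \<and>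
     adjunction C (abelian_core C) (left_adj \<Gamma>) id_functor (adj_unit \<Gamma>) \<and>
     base_class \<Gamma> = {f. regular_epi C f} \<and>
     target_class \<Gamma> = {f. regular_epi (abelian_core C) f}"

definition trivial_extension :: "('o, 'm, 'o1, 'm1) galois_structure \<Rightarrow> 'm \<Rightarrow> bool" where
  "trivial_extension \<Gamma> f \<longleftrightarrow> f \<in> base_class \<Gamma> \<and>
     is_pullback (base \<Gamma>) (on_mor (right_adj \<Gamma>) (on_mor (left_adj \<Gamma>) f)) (adj_unit \<Gamma> (Cod (base \<Gamma>) f))
       (adj_unit \<Gamma> (Dom (base \<Gamma>) f)) f"

definition normal_extension :: "('o, 'm, 'o1, 'm1) galois_structure \<Rightarrow> 'm \<Rightarrow> bool" where
  "normal_extension \<Gamma> f \<longleftrightarrow> f \<in> base_class \<Gamma> \<and>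
     (\<forall>p q. kernel_pair (base \<Gamma>) f p q \<longrightarrow> trivial_extension \<Gamma> p \<and> trivial_extension \<Gamma> q)"

end

theory Submission
  imports Defs
begin

text \<open>
  The proof treats morphisms \<open>X \<rightarrow> A\<close> as generalised elements of \<open>A\<close> and rests on one consequence of
  unitality: a morphism on \<open>A \<times> B\<close> is determined by its restrictions to \<open>A\<close> and to \<open>B\<close>.
  Hence an object carries at most one binary operation with the zero morphism as unit, that operation
  is automatically associative and commutative, and every morphism between objects that carry one is
  additive.  Elements of an abelian object may therefore be added and subtracted freely.

  \<^emph>\<open>The abelian core is reflective.\<close>  Identifying the two inclusions of \<open>A\<close> in \<open>A \<times> A\<close> gives the
  universal commutative object \<open>Q\<close> under \<open>A\<close>: the quotient morphism \<open>A \<times> A \<rightarrow> Q\<close> is a cooperator of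
  the unit \<open>A \<rightarrow> Q\<close> with itself, and as that unit is a regular epimorphism, the identity of \<open>Q\<close> also
  cooperates with itself (\<open>cooperator_descend\<close>).  The quotient of \<open>Q \<times> Q\<close> by its diagonal is then the
  Grothendieck group of \<open>Q\<close>; the exchange of the factors induces inverses.

  \<^emph>\<open>Normal extensions are principal.\<close>  The kernel pair projection \<open>R \<rightarrow> A\<close> of \<open>f: A \<rightarrow> B\<close> is split by
  the diagonal, so its abelianisation is a product projection \<open>ab A \<oplus> L \<rightarrow> ab A\<close>.  If the naturality
  square is a pullback, \<open>R\<close> is thereby \<open>A \<times> L\<close> over \<open>A\<close>, and the second projection becomes an action
  of \<open>L\<close> on \<open>A\<close>.  So \<open>f\<close> is normal exactly when it is a regular epimorphism whose kernel pair has the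
  form \<open>A \<times> L \<rightrightarrows> A\<close>, given by a projection and an action: two elements of \<open>A\<close> in the same fibre differ
  by a unique element of the abelian object \<open>L\<close> (\<open>normal_extension_iff\<close>).

  \<^emph>\<open>The reflection.\<close>  Let \<open>t\<close> map a regular epimorphism \<open>f: A \<rightarrow> B\<close>, with kernel pair \<open>R\<close>, into a
  principal extension with group \<open>L\<close>.  The differences \<open>t(a') - t(a)\<close> form a morphism \<open>\<delta>: R \<rightarrow> L\<close> with
  \<open>\<delta>(a, a'') = \<delta>(a, a') + \<delta>(a', a'')\<close>.  There is a universal such cocycle \<open>d: R \<rightarrow> K\<close>, a coequalizer
  of two morphisms into \<open>ab R\<close>.  By the cocycle identity,
  \<open>(a, k + d(a, a')) \<sim> (a', k)\<close> defines an equivalence relation on \<open>A \<times> K\<close>.  Exactness makes it effective,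
  and \<open>K\<close> acts on the quotient, which is a principal extension of \<open>B\<close> with group \<open>K\<close>.  It is the
  reflection of \<open>f\<close>: writing \<open>\<delta> = \<phi> d\<close>, the only extension of \<open>t\<close> sends the class of \<open>(a, k)\<close> to
  \<open>t(a) + \<phi>(k)\<close>.
\<close>

section \<open>Composition, pullbacks and coequalizers\<close>

context category
begin

abbreviation arr :: "'m \<Rightarrow> bool" where
  "arr f \<equiv> f \<in> Mor C"

text \<open>Membership in a hom-set is split into equations for domain and codomain, so that the
  simplifier can compute the type of a composite.  The premises of the rules below are stated in the same
  form and contain no variable that their left-hand side lacks.\<close>

lemma hom_iff [simp]:
  "f \<in> hom C A B \<longleftrightarrow> arr f \<and> Dom C f = A \<and> Cod C f = B \<and> A \<in> Obj C \<and> B \<in> Obj C"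
  using dom_obj cod_obj unfolding hom_def by auto

lemma Dom_Obj [simp]: "arr f \<Longrightarrow> Dom C f \<in> Obj C"
  by (rule dom_obj)

lemma Cod_Obj [simp]: "arr f \<Longrightarrow> Cod C f \<in> Obj C"
  by (rule cod_obj)

lemma comp_arrow [simp]:
  assumes "arr f" "arr g" "Dom C g = Cod C f"
  shows "g \<cdot> f \<in> Mor C" "Dom C (g \<cdot> f) = Dom C f" "Cod C (g \<cdot> f) = Cod C g"
  using comp_hom [of f "Dom C f" "Cod C f" g "Cod C g"] assms by auto

lemma comp_assoc_arrow [simp]:
  assumes "arr f" "arr g" "arr h" "Dom C g = Cod C f" "Dom C h = Cod C g"
  shows "(h \<cdot> g) \<cdot> f = h \<cdot> (g \<cdot> f)"
  using comp_assoc [of f "Dom C f" "Cod C f" g "Cod C g" h "Cod C h"] assms by auto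

lemma Idm_arrow [simp]:
  assumes "A \<in> Obj C"
  shows "Idm C A \<in> Mor C" "Dom C (Idm C A) = A" "Cod C (Idm C A) = A"
  using id_hom [OF assms] by auto

lemma comp_Idm [simp]: "arr f \<Longrightarrow> Dom C f = A \<Longrightarrow> f \<cdot> Idm C A = f"
  using comp_id_right [of f A "Cod C f"] by auto

lemma Idm_comp [simp]: "arr f \<Longrightarrow> Cod C f = A \<Longrightarrow> Idm C A \<cdot> f = f"
  using comp_id_left [of f "Dom C f" A] by auto

lemma comp_cong_left:
  assumes "a \<cdot> b = c \<cdot> d" "arr a" "arr b" "arr c" "arr d"
    "Dom C a = Cod C b" "Dom C c = Cod C d" "arr x" "Cod C x = Dom C b" "Dom C b = Dom C d"
  shows "a \<cdot> (b \<cdot> x) = c \<cdot> (d \<cdot> x)"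
  using assms by (metis comp_assoc_arrow)

lemma pullbackD:
  assumes "is_pullback C f g p q"
  shows "arr f" "arr g" "arr p" "arr q" "Cod C f = Cod C g"
    "Dom C p = Dom C q" "Cod C p = Dom C f" "Cod C q = Dom C g" "f \<cdot> p = g \<cdot> q"
  using assms unfolding is_pullback_def by auto

lemma pullback_ex1:
  assumes "is_pullback C f g p q" "a \<in> hom C X (Dom C f)" "b \<in> hom C X (Dom C g)" "f \<cdot> a = g \<cdot> b"
  shows "\<exists>!h. h \<in> hom C X (Dom C p) \<and> p \<cdot> h = a \<and> q \<cdot> h = b"
proof -
  have "\<forall>X. \<forall>a \<in> hom C X (Dom C f). \<forall>b \<in> hom C X (Dom C g). f \<cdot> a = g \<cdot> b \<longrightarrow>
      (\<exists>!h. h \<in> hom C X (Dom C p) \<and> p \<cdot> h = a \<and> q \<cdot> h = b)"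
    using assms(1) unfolding is_pullback_def by (elim conjE) assumption
  then show ?thesis using assms(2-4) by blast
qed

lemma pullback_lift:
  assumes "is_pullback C f g p q" "arr a" "arr b" "Dom C a = Dom C b"
    "Cod C a = Dom C f" "Cod C b = Dom C g" "f \<cdot> a = g \<cdot> b"
  obtains h where "arr h" "Dom C h = Dom C a" "Cod C h = Dom C p" "p \<cdot> h = a" "q \<cdot> h = b"
proof -
  have "\<exists>!h. h \<in> hom C (Dom C a) (Dom C p) \<and> p \<cdot> h = a \<and> q \<cdot> h = b"
    by (rule pullback_ex1 [OF assms(1) _ _ assms(7)])
      (use assms(2-6) pullbackD(1,2) [OF assms(1)] in auto)
  then show thesis using that by auto
qed

lemma pullback_eqI:
  assumes "is_pullback C f g p q" "arr a" "arr b" "Dom C a = Dom C b"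
    "Cod C a = Dom C p" "Cod C b = Dom C p" "p \<cdot> a = p \<cdot> b" "q \<cdot> a = q \<cdot> b"
  shows "a = b"
proof -
  note pb = pullbackD [OF assms(1)]
  have eq: "f \<cdot> (p \<cdot> a) = g \<cdot> (q \<cdot> a)"
    by (rule comp_cong_left) (use assms pb in auto)
  have "\<exists>!h. h \<in> hom C (Dom C a) (Dom C p) \<and> p \<cdot> h = p \<cdot> a \<and> q \<cdot> h = q \<cdot> a"
    by (rule pullback_ex1 [OF assms(1) _ _ eq]) (use assms(2-6) pb in auto)
  moreover have "a \<in> hom C (Dom C a) (Dom C p)" "b \<in> hom C (Dom C a) (Dom C p)"
    using assms pb by auto
  ultimately show ?thesis using assms by metis
qed

lemma pullbackI:
  assumes "arr f" "arr g" "arr p" "arr q" "Cod C f = Cod C g"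
    "Dom C p = Dom C q" "Cod C p = Dom C f" "Cod C q = Dom C g" "f \<cdot> p = g \<cdot> q"
    and lift: "\<And>a b. arr a \<Longrightarrow> arr b \<Longrightarrow> Dom C a = Dom C b \<Longrightarrow> Cod C a = Dom C f \<Longrightarrow>
      Cod C b = Dom C g \<Longrightarrow> f \<cdot> a = g \<cdot> b \<Longrightarrow>
      \<exists>h. arr h \<and> Dom C h = Dom C a \<and> Cod C h = Dom C p \<and> p \<cdot> h = a \<and> q \<cdot> h = b"
    and uniq: "\<And>a b. arr a \<Longrightarrow> arr b \<Longrightarrow> Dom C a = Dom C b \<Longrightarrow> Cod C a = Dom C p \<Longrightarrow>
      Cod C b = Dom C p \<Longrightarrow> p \<cdot> a = p \<cdot> b \<Longrightarrow> q \<cdot> a = q \<cdot> b \<Longrightarrow> a = b"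
  shows "is_pullback C f g p q"
proof -
  have ex1: "\<exists>!h. h \<in> hom C X (Dom C p) \<and> p \<cdot> h = a \<and> q \<cdot> h = b"
    if ab: "a \<in> hom C X (Dom C f)" "b \<in> hom C X (Dom C g)" "f \<cdot> a = g \<cdot> b" for X a b
  proof -
    obtain h where h: "arr h" "Dom C h = X" "Cod C h = Dom C p" "p \<cdot> h = a" "q \<cdot> h = b"
      using lift [of a b] ab by auto
    show ?thesis
    proof (rule ex1I [of _ h])
      show "h \<in> hom C X (Dom C p) \<and> p \<cdot> h = a \<and> q \<cdot> h = b" using h assms(3) ab by auto
      show "h' = h" if "h' \<in> hom C X (Dom C p) \<and> p \<cdot> h' = a \<and> q \<cdot> h' = b" for h'
        by (rule uniq) (use h that in auto)
    qed
  qed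
  show ?thesis unfolding is_pullback_def
    by (intro conjI allI ballI impI; (rule ex1; assumption)?; fact)
qed

lemma pullback_sym:
  assumes "is_pullback C f g p q"
  shows "is_pullback C g f q p"
proof -
  note d = pullbackD [OF assms]
  show ?thesis
  proof (rule pullbackI)
    fix a b assume *: "arr a" "arr b" "Dom C a = Dom C b" "Cod C a = Dom C g"
      "Cod C b = Dom C f" "g \<cdot> a = f \<cdot> b"
    obtain h where "arr h" "Dom C h = Dom C b" "Cod C h = Dom C p" "p \<cdot> h = b" "q \<cdot> h = a"
      using pullback_lift [OF assms, of b a] * by metis
    then show "\<exists>h. arr h \<and> Dom C h = Dom C a \<and> Cod C h = Dom C q \<and> q \<cdot> h = a \<and> p \<cdot> h = b"
      using * d by metis
  next
    fix a b assume "arr a" "arr b" "Dom C a = Dom C b" "Cod C a = Dom C q"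
      "Cod C b = Dom C q" "q \<cdot> a = q \<cdot> b" "p \<cdot> a = p \<cdot> b"
    then show "a = b" using d by - (rule pullback_eqI [OF assms], auto)
  qed (use d in auto)
qed

lemma kernel_pair_sym: "kernel_pair C f p q \<Longrightarrow> kernel_pair C f q p"
  unfolding kernel_pair_def by (rule pullback_sym)

lemma coequalizerD:
  assumes "is_coequalizer C u v f"
  shows "arr u" "arr v" "arr f" "Dom C u = Dom C v" "Cod C u = Dom C f"
    "Cod C v = Dom C f" "f \<cdot> u = f \<cdot> v"
  using assms unfolding is_coequalizer_def by auto

lemma coequalizer_ex1:
  assumes "is_coequalizer C u v f" "g \<in> hom C (Dom C f) Y" "g \<cdot> u = g \<cdot> v"
  shows "\<exists>!h. h \<in> hom C (Cod C f) Y \<and> h \<cdot> f = g"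
proof -
  have "\<forall>Y. \<forall>g \<in> hom C (Dom C f) Y. g \<cdot> u = g \<cdot> v \<longrightarrow> (\<exists>!h. h \<in> hom C (Cod C f) Y \<and> h \<cdot> f = g)"
    using assms(1) unfolding is_coequalizer_def by (elim conjE) assumption
  then show ?thesis using assms(2,3) by blast
qed

lemma coequalizer_lift:
  assumes "is_coequalizer C u v f" "arr g" "Dom C g = Dom C f" "g \<cdot> u = g \<cdot> v"
  obtains h where "arr h" "Dom C h = Cod C f" "Cod C h = Cod C g" "h \<cdot> f = g"
proof -
  have "g \<in> hom C (Dom C f) (Cod C g)" using assms coequalizerD [OF assms(1)] by auto
  then have "\<exists>!h. h \<in> hom C (Cod C f) (Cod C g) \<and> h \<cdot> f = g"
    by (rule coequalizer_ex1 [OF assms(1) _ assms(4)])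
  then show thesis using that by auto
qed

lemma regular_epi_arrow: "regular_epi C f \<Longrightarrow> arr f"
  unfolding regular_epi_def is_coequalizer_def by auto

lemma regular_epi_cancel:
  assumes "regular_epi C f" "arr a" "arr b" "Dom C a = Cod C f" "Dom C b = Cod C f"
    "a \<cdot> f = b \<cdot> f"
  shows "a = b"
proof -
  obtain u v where uv: "is_coequalizer C u v f" using assms(1) unfolding regular_epi_def by auto
  note d = coequalizerD [OF uv]
  have c: "Cod C a = Cod C b"
    using arg_cong [OF assms(6), of "Cod C"] assms(2-5) d by simp
  have "(a \<cdot> f) \<in> hom C (Dom C f) (Cod C a)" using assms(2-5) d by auto
  moreover have "(a \<cdot> f) \<cdot> u = (a \<cdot> f) \<cdot> v" using assms(2-5) d by auto
  ultimately have "\<exists>!h. h \<in> hom C (Cod C f) (Cod C a) \<and> h \<cdot> f = a \<cdot> f"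
    by (rule coequalizer_ex1 [OF uv])
  moreover have "a \<in> hom C (Cod C f) (Cod C a)" "b \<in> hom C (Cod C f) (Cod C a)"
    using assms d c by auto
  ultimately show ?thesis using assms(6) by metis
qed

lemma coequalizerI:
  assumes "arr u" "arr v" "arr f" "Dom C u = Dom C v" "Cod C u = Dom C f"
    "Cod C v = Dom C f" "f \<cdot> u = f \<cdot> v"
    and lift: "\<And>g. arr g \<Longrightarrow> Dom C g = Dom C f \<Longrightarrow> g \<cdot> u = g \<cdot> v \<Longrightarrow>
      \<exists>h. arr h \<and> Dom C h = Cod C f \<and> Cod C h = Cod C g \<and> h \<cdot> f = g"
    and uniq: "\<And>a b. arr a \<Longrightarrow> arr b \<Longrightarrow> Dom C a = Cod C f \<Longrightarrow> Dom C b = Cod C f \<Longrightarrow>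
      a \<cdot> f = b \<cdot> f \<Longrightarrow> a = b"
  shows "is_coequalizer C u v f"
proof -
  have ex1: "\<exists>!h. h \<in> hom C (Cod C f) Y \<and> h \<cdot> f = g"
    if g: "g \<in> hom C (Dom C f) Y" "g \<cdot> u = g \<cdot> v" for Y g
  proof -
    obtain h where h: "arr h" "Dom C h = Cod C f" "Cod C h = Y" "h \<cdot> f = g"
      using lift [of g] g by auto
    show ?thesis
    proof (rule ex1I [of _ h])
      show "h \<in> hom C (Cod C f) Y \<and> h \<cdot> f = g" using h assms(3) g by auto
      show "h' = h" if "h' \<in> hom C (Cod C f) Y \<and> h' \<cdot> f = g" for h'
        by (rule uniq) (use h that in auto)
    qed
  qed
  show ?thesis unfolding is_coequalizer_def
    by (intro conjI allI ballI impI; (rule ex1; assumption)?; fact)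
qed

end

section \<open>Pullbacks and coequalizers from finite limits and colimits\<close>

text \<open>The objects \<open>0, 1, 2\<close> stand for their identities among the morphisms; \<open>3: 0 \<rightarrow> 2\<close> and
  \<open>4: 1 \<rightarrow> 2\<close>.\<close>

definition cospan_shape :: "(nat, nat) category" where
  "cospan_shape = \<lparr>Obj = {0, 1, 2}, Mor = {0, 1, 2, 3, 4},
     Dom = (\<lambda>k. if k = 3 then 0 else if k = 4 then 1 else k), Cod = (\<lambda>k. if k < 3 then k else 2),
     Idm = (\<lambda>k. k), Comp = (\<lambda>l k. if l < 3 then k else l)\<rparr>"

text \<open>Again objects stand for their identities; \<open>2, 3: 0 \<rightarrow> 1\<close>.  In the opposite category the
  arrows \<open>2\<close> and \<open>3\<close> become a parallel pair into the object assigned to \<open>0\<close>.\<close>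

definition parallel_shape :: "(nat, nat) category" where
  "parallel_shape = \<lparr>Obj = {0, 1}, Mor = {0, 1, 2, 3},
     Dom = (\<lambda>k. if k < 2 then k else 0), Cod = (\<lambda>k. if k < 2 then k else 1),
     Idm = (\<lambda>k. k), Comp = (\<lambda>l k. if l < 2 then k else l)\<rparr>"

lemma category_cospan_shape: "category cospan_shape"
  unfolding cospan_shape_def
  by unfold_locales (auto simp: hom_def)

lemma category_parallel_shape: "category parallel_shape"
  unfolding parallel_shape_def
  by unfold_locales (auto simp: hom_def)

lemma cospan_shape_finite: "finite (Obj cospan_shape)" "finite (Mor cospan_shape)"
  by (auto simp: cospan_shape_def)

lemma parallel_shape_finite: "finite (Obj parallel_shape)" "finite (Mor parallel_shape)"
  by (auto simp: parallel_shape_def)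

lemma finitely_complete_category: "finitely_complete C \<Longrightarrow> category C"
  by (simp add: finitely_complete_def)

lemma finitely_complete_pullback:
  fixes C :: "('o, 'm) category" (structure)
  assumes fc: "finitely_complete C" and f: "f \<in> Mor C" and g: "g \<in> Mor C" and fg: "Cod C f = Cod C g"
  shows "\<exists>p q. is_pullback C f g p q"
proof -
  interpret category C using fc by (rule finitely_complete_category)
  define D where "D = \<lparr>on_obj = (\<lambda>k::nat. if k = 0 then Dom C f else if k = 1 then Dom C g else Cod C f),
    on_mor = (\<lambda>k::nat. if k = 0 then Idm C (Dom C f) else if k = 1 then Idm C (Dom C g)
      else if k = 2 then Idm C (Cod C f) else if k = 3 then f else g)\<rparr>"
  have "is_functor cospan_shape C D"
    unfolding is_functor_def D_def cospan_shape_def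
    using f g fg by (auto simp: hom_def)
  then obtain L \<pi> where lim: "is_limit cospan_shape C D L \<pi>"
    using fc category_cospan_shape cospan_shape_finite unfolding finitely_complete_def
    by blast
  have cone_iff: "is_cone cospan_shape C D X \<xi> \<longleftrightarrow> \<xi> 0 \<in> hom C X (Dom C f) \<and> \<xi> 1 \<in> hom C X (Dom C g) \<and>
    \<xi> 2 \<in> hom C X (Cod C f) \<and> f \<cdot> \<xi> 0 = \<xi> 2 \<and> g \<cdot> \<xi> 1 = \<xi> 2" for X \<xi>
    unfolding is_cone_def D_def cospan_shape_def
    using f g fg by (auto simp: hom_def)
  have cone: "\<pi> 0 \<in> hom C L (Dom C f)" "\<pi> 1 \<in> hom C L (Dom C g)" "\<pi> 2 = f \<cdot> \<pi> 0" "f \<cdot> \<pi> 0 = g \<cdot> \<pi> 1"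
    using lim unfolding is_limit_def cone_iff by simp_all
  have obj: "Obj cospan_shape = {0, 1, 2}" by (simp add: cospan_shape_def)
  have "\<exists>!h. h \<in> hom C X (Dom C (\<pi> 0)) \<and> \<pi> 0 \<cdot> h = a \<and> \<pi> 1 \<cdot> h = b"
    if "a \<in> hom C X (Dom C f)" "b \<in> hom C X (Dom C g)" "f \<cdot> a = g \<cdot> b" for X a b
  proof -
    define \<xi> where "\<xi> = (\<lambda>k::nat. if k = 0 then a else if k = 1 then b else f \<cdot> a)"
    have "is_cone cospan_shape C D X \<xi>" unfolding cone_iff \<xi>_def using that f g fg by simp
    then have "\<exists>!h. h \<in> hom C X L \<and> (\<forall>j \<in> {0, 1, 2}. \<pi> j \<cdot> h = \<xi> j)"
      using lim unfolding is_limit_def obj by blast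
    moreover have "(h \<in> hom C X L \<and> (\<forall>j \<in> {0, 1, 2}. \<pi> j \<cdot> h = \<xi> j)) \<longleftrightarrow>
      (h \<in> hom C X L \<and> \<pi> 0 \<cdot> h = a \<and> \<pi> 1 \<cdot> h = b)" for h
    proof -
      have "\<pi> 2 \<cdot> h = f \<cdot> (\<pi> 0 \<cdot> h)" if "h \<in> hom C X L"
        using that cone f by (metis comp_assoc_arrow hom_iff)
      then show ?thesis by (auto simp: \<xi>_def simp del: hom_iff)
    qed
    ultimately show ?thesis using cone by simp
  qed
  then have "is_pullback C f g (\<pi> 0) (\<pi> 1)"
    unfolding is_pullback_def using cone f g fg
    by (intro conjI allI ballI impI; assumption?; (simp; fail)?; blast?)
  then show ?thesis by blast
qed

lemma op_category_simps [simp]: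
  "Obj (op_category C) = Obj C" "Mor (op_category C) = Mor C"
  "Dom (op_category C) = Cod C" "Cod (op_category C) = Dom C" "Idm (op_category C) = Idm C"
  "Comp (op_category C) g f = Comp C f g" "hom (op_category C) A B = hom C B A"
  unfolding op_category_def hom_def by auto

lemma finitely_cocomplete_coequalizer:
  fixes C :: "('o, 'm) category" (structure)
  assumes cat: "category C" and fc: "finitely_cocomplete C" and u: "u \<in> Mor C" and v: "v \<in> Mor C"
    and uv: "Dom C u = Dom C v" "Cod C u = Cod C v"
  shows "\<exists>f. is_coequalizer C u v f"
proof -
  interpret category C by (rule cat)
  define D where "D = \<lparr>on_obj = (\<lambda>k::nat. if k = 0 then Cod C u else Dom C u),
    on_mor = (\<lambda>k::nat. if k = 0 then Idm C (Cod C u) else if k = 1 then Idm C (Dom C u)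
      else if k = 2 then u else v)\<rparr>"
  have "is_functor parallel_shape (op_category C) D"
    unfolding is_functor_def D_def parallel_shape_def
    using u v uv by (auto simp: hom_def)
  then obtain L \<pi> where lim: "is_limit parallel_shape (op_category C) D L \<pi>"
    using fc category_parallel_shape parallel_shape_finite
    unfolding finitely_complete_def finitely_cocomplete_def by blast
  have cone_iff: "is_cone parallel_shape (op_category C) D X \<xi> \<longleftrightarrow> \<xi> 0 \<in> hom C (Cod C u) X \<and>
    \<xi> 1 \<in> hom C (Dom C u) X \<and> \<xi> 0 \<cdot> u = \<xi> 1 \<and> \<xi> 0 \<cdot> v = \<xi> 1" for X \<xi>
    unfolding is_cone_def D_def parallel_shape_def
    using u v uv by (auto simp: hom_def)
  have cone: "\<pi> 0 \<in> hom C (Cod C u) L" "\<pi> 1 = \<pi> 0 \<cdot> u" "\<pi> 0 \<cdot> u = \<pi> 0 \<cdot> v"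
    using lim unfolding is_limit_def cone_iff by simp_all
  have obj: "Obj parallel_shape = {0, 1}" by (simp add: parallel_shape_def)
  have "\<exists>!h. h \<in> hom C (Cod C (\<pi> 0)) Y \<and> h \<cdot> \<pi> 0 = g"
    if "g \<in> hom C (Cod C u) Y" "g \<cdot> u = g \<cdot> v" for Y g
  proof -
    define \<xi> where "\<xi> = (\<lambda>k::nat. if k = 0 then g else g \<cdot> u)"
    have "is_cone parallel_shape (op_category C) D Y \<xi>" unfolding cone_iff \<xi>_def using that u v uv by simp
    then have "\<exists>!h. h \<in> hom C L Y \<and> (\<forall>j \<in> {0, 1}. h \<cdot> \<pi> j = \<xi> j)"
      using lim unfolding is_limit_def obj by simp
    moreover have "(h \<in> hom C L Y \<and> (\<forall>j \<in> {0, 1}. h \<cdot> \<pi> j = \<xi> j)) \<longleftrightarrow>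
      (h \<in> hom C L Y \<and> h \<cdot> \<pi> 0 = g)" for h
    proof -
      have "h \<cdot> \<pi> 1 = (h \<cdot> \<pi> 0) \<cdot> u" if "h \<in> hom C L Y"
        using that cone u by (metis comp_assoc_arrow hom_iff)
      then show ?thesis by (auto simp: \<xi>_def simp del: hom_iff)
    qed
    ultimately show ?thesis using cone by simp
  qed
  moreover have "Cod C u = Dom C (\<pi> 0)" using cone by simp
  ultimately have "\<exists>!h. h \<in> hom C (Cod C (\<pi> 0)) Y \<and> h \<cdot> \<pi> 0 = g"
    if "g \<in> hom C (Dom C (\<pi> 0)) Y" "g \<cdot> u = g \<cdot> v" for Y g
    using that by (simp only:)
  then have "is_coequalizer C u v (\<pi> 0)"
    unfolding is_coequalizer_def using cone u v uv
    by (intro conjI allI ballI impI; assumption?; (simp; fail)?; blast?)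
  then show ?thesis by blast
qed

section \<open>Zero morphisms and products in unital categories\<close>

locale unital_category = category C for C :: "('o, 'm) category" (structure) +
  assumes unital: "unital C"
begin

definition zero_ob :: 'o where
  "zero_ob = (SOME Z. zero_object C Z)"

lemma zero_object_zero_ob: "zero_object C zero_ob"
  using unital unfolding unital_def zero_ob_def by (auto intro: someI_ex)

lemma zero_ob_Obj [simp]: "zero_ob \<in> Obj C"
  using zero_object_zero_ob by (simp add: zero_object_def initial_def)

definition from_zero :: "'o \<Rightarrow> 'm" where
  "from_zero B = (THE b. b \<in> hom C zero_ob B)"

definition to_zero :: "'o \<Rightarrow> 'm" where
  "to_zero A = (THE a. a \<in> hom C A zero_ob)"

definition zer :: "'o \<Rightarrow> 'o \<Rightarrow> 'm" where
  "zer A B = from_zero B \<cdot> to_zero A"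

lemma from_zero:
  assumes "B \<in> Obj C"
  shows from_zero_hom: "from_zero B \<in> hom C zero_ob B"
    and from_zero_unique: "b \<in> hom C zero_ob B \<Longrightarrow> from_zero B = b"
proof -
  have ex1: "\<exists>!b. b \<in> hom C zero_ob B"
    using zero_object_zero_ob assms by (simp add: zero_object_def initial_def del: hom_iff)
  show "from_zero B \<in> hom C zero_ob B" unfolding from_zero_def by (rule theI' [OF ex1])
  show "b \<in> hom C zero_ob B \<Longrightarrow> from_zero B = b"
    unfolding from_zero_def by (rule the1_equality [OF ex1])
qed

lemma to_zero:
  assumes "A \<in> Obj C"
  shows to_zero_hom: "to_zero A \<in> hom C A zero_ob"
    and to_zero_unique: "a \<in> hom C A zero_ob \<Longrightarrow> to_zero A = a"
proof -
  have ex1: "\<exists>!a. a \<in> hom C A zero_ob"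
    using zero_object_zero_ob assms by (simp add: zero_object_def terminal_def del: hom_iff)
  show "to_zero A \<in> hom C A zero_ob" unfolding to_zero_def by (rule theI' [OF ex1])
  show "a \<in> hom C A zero_ob \<Longrightarrow> to_zero A = a"
    unfolding to_zero_def by (rule the1_equality [OF ex1])
qed

lemma zer_arrow [simp]:
  assumes "A \<in> Obj C" "B \<in> Obj C"
  shows "zer A B \<in> Mor C" "Dom C (zer A B) = A" "Cod C (zer A B) = B"
  using from_zero_hom [OF assms(2)] to_zero_hom [OF assms(1)] by (simp_all add: zer_def)

lemma zero_morphism_zer: "A \<in> Obj C \<Longrightarrow> B \<in> Obj C \<Longrightarrow> zero_morphism C (zer A B)"
  unfolding zero_morphism_def using zero_object_zero_ob from_zero_hom [of B] to_zero_hom [of A]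
  by (metis zer_arrow(2,3) zer_def)

lemma comp_zer [simp]:
  assumes "arr f" "Dom C f = B" "A \<in> Obj C"
  shows "f \<cdot> zer A B = zer A (Cod C f)"
proof -
  have "B \<in> Obj C" using assms by auto
  then have "from_zero (Cod C f) = f \<cdot> from_zero B"
    using from_zero_hom [of B] from_zero_unique [of "Cod C f"] assms by simp
  then show ?thesis using assms from_zero_hom [OF \<open>B \<in> Obj C\<close>] to_zero_hom [of A]
    by (simp add: zer_def)
qed

lemma zer_comp [simp]:
  assumes "arr f" "Cod C f = A" "B \<in> Obj C"
  shows "zer A B \<cdot> f = zer (Dom C f) B"
proof -
  have "A \<in> Obj C" using assms by auto
  then have "to_zero (Dom C f) = to_zero A \<cdot> f"
    using to_zero_hom [of A] to_zero_unique [of "Dom C f"] assms by simp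
  then show ?thesis using assms to_zero_hom [OF \<open>A \<in> Obj C\<close>] from_zero_hom [of B]
    by (simp add: zer_def)
qed

lemma terminal_comp_zer:
  assumes "terminal C T" "arr e" "Dom C e = T"
  shows "e = zer T (Cod C e)"
proof -
  have T: "T \<in> Obj C" "\<And>t t'. t \<in> hom C T T \<Longrightarrow> t' \<in> hom C T T \<Longrightarrow> t = t'"
    using assms(1) unfolding terminal_def by blast+
  have "Idm C T = zer T T" by (rule T(2)) (use T(1) in auto)
  then have "e \<cdot> Idm C T = e \<cdot> zer T T" by simp
  then show ?thesis using assms T by simp
qed

lemma terminal_zero_ob: "terminal C zero_ob"
  using zero_object_zero_ob by (simp add: zero_object_def)

lemma pullback_ex:
  assumes "arr f" "arr g" "Cod C f = Cod C g"
  obtains p q where "is_pullback C f g p q"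
proof -
  have "finitely_complete C" using unital by (simp add: unital_def)
  from finitely_complete_pullback [OF this assms] show thesis using that by blast
qed

lemma product_ex:
  assumes "A \<in> Obj C" "B \<in> Obj C"
  shows "\<exists>P p q. is_product C A B P p q"
proof -
  obtain p q where pb: "is_pullback C (zer A zero_ob) (zer B zero_ob) p q"
    using pullback_ex [of "zer A zero_ob" "zer B zero_ob"] assms by auto
  note d = pullbackD [OF pb]
  have "\<exists>!h. h \<in> hom C X (Dom C p) \<and> p \<cdot> h = f \<and> q \<cdot> h = g"
    if "f \<in> hom C X A" "g \<in> hom C X B" for X f g
    by (rule pullback_ex1 [OF pb]) (use that assms in simp_all)
  moreover have "p \<in> hom C (Dom C p) A" "q \<in> hom C (Dom C p) B" using d assms by auto
  ultimately have "is_product C A B (Dom C p) p q" unfolding is_product_def by blast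
  then show ?thesis by blast
qed

lemma product_ex1:
  assumes "is_product C A B P p q" "f \<in> hom C X A" "g \<in> hom C X B"
  shows "\<exists>!h. h \<in> hom C X P \<and> p \<cdot> h = f \<and> q \<cdot> h = g"
proof -
  have "\<forall>X. \<forall>f \<in> hom C X A. \<forall>g \<in> hom C X B. \<exists>!h. h \<in> hom C X P \<and> p \<cdot> h = f \<and> q \<cdot> h = g"
    using assms(1) unfolding is_product_def by (elim conjE) assumption
  then show ?thesis using assms(2,3) by blast
qed

lemma productD:
  assumes "is_product C A B P p q"
  shows "arr p" "arr q" "Dom C p = P" "Dom C q = P" "Cod C p = A" "Cod C q = B"
    "A \<in> Obj C" "B \<in> Obj C" "P \<in> Obj C"
  using assms unfolding is_product_def by auto

lemma product_pairing:
  assumes "is_product C A B P p q" "arr f" "arr g" "Dom C f = Dom C g" "Cod C f = A" "Cod C g = B"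
  shows "pairing C p q f g \<in> Mor C" "Dom C (pairing C p q f g) = Dom C f"
    "Cod C (pairing C p q f g) = P" "p \<cdot> pairing C p q f g = f" "q \<cdot> pairing C p q f g = g"
proof -
  have "f \<in> hom C (Dom C f) A" "g \<in> hom C (Dom C f) B" using assms productD [OF assms(1)] by auto
  then have "\<exists>!h. h \<in> hom C (Dom C f) (Dom C p) \<and> p \<cdot> h = f \<and> q \<cdot> h = g"
    using product_ex1 [OF assms(1)] productD [OF assms(1)] by (simp only:)
  then have "pairing C p q f g \<in> hom C (Dom C f) (Dom C p) \<and> p \<cdot> pairing C p q f g = f \<and>
    q \<cdot> pairing C p q f g = g" unfolding pairing_def by (rule theI')
  then show "pairing C p q f g \<in> Mor C" "Dom C (pairing C p q f g) = Dom C f"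
    "Cod C (pairing C p q f g) = P" "p \<cdot> pairing C p q f g = f" "q \<cdot> pairing C p q f g = g"
    using productD [OF assms(1)] by simp_all
qed

lemma product_eqI:
  assumes "is_product C A B P p q" "arr a" "arr b" "Dom C a = Dom C b" "Cod C a = P" "Cod C b = P"
    "p \<cdot> a = p \<cdot> b" "q \<cdot> a = q \<cdot> b"
  shows "a = b"
proof -
  note d = productD [OF assms(1)]
  have "\<exists>!h. h \<in> hom C (Dom C a) P \<and> p \<cdot> h = p \<cdot> a \<and> q \<cdot> h = q \<cdot> a"
    by (rule product_ex1 [OF assms(1)]) (use d assms(2-6) in auto)
  moreover have "a \<in> hom C (Dom C a) P" "b \<in> hom C (Dom C a) P" using assms(2-6) d by auto
  ultimately show ?thesis using assms(7,8) by metis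
qed

definition chosen_product :: "'o \<Rightarrow> 'o \<Rightarrow> 'o \<times> 'm \<times> 'm" where
  "chosen_product A B = (SOME (P, p, q). is_product C A B P p q)"

definition prd :: "'o \<Rightarrow> 'o \<Rightarrow> 'o" (infixr "\<otimes>" 75) where
  "A \<otimes> B = fst (chosen_product A B)"

definition pr1 :: "'o \<Rightarrow> 'o \<Rightarrow> 'm" where
  "pr1 A B = fst (snd (chosen_product A B))"

definition pr2 :: "'o \<Rightarrow> 'o \<Rightarrow> 'm" where
  "pr2 A B = snd (snd (chosen_product A B))"

definition pair :: "'m \<Rightarrow> 'm \<Rightarrow> 'm" ("\<langle>(_),/ (_)\<rangle>") where
  "\<langle>f, g\<rangle> = pairing C (pr1 (Cod C f) (Cod C g)) (pr2 (Cod C f) (Cod C g)) f g"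

abbreviation inl :: "'o \<Rightarrow> 'o \<Rightarrow> 'm" where
  "inl A B \<equiv> \<langle>Idm C A, zer A B\<rangle>"

abbreviation inr :: "'o \<Rightarrow> 'o \<Rightarrow> 'm" where
  "inr A B \<equiv> \<langle>zer B A, Idm C B\<rangle>"

lemma is_product_prd:
  assumes "A \<in> Obj C" "B \<in> Obj C"
  shows "is_product C A B (A \<otimes> B) (pr1 A B) (pr2 A B)"
proof -
  have "\<exists>x. case x of (P, p, q) \<Rightarrow> is_product C A B P p q" using product_ex [OF assms] by simp
  from someI_ex [OF this] show ?thesis
    unfolding prd_def pr1_def pr2_def chosen_product_def by (simp add: case_prod_unfold)
qed

lemma prd_arrow [simp]:
  assumes "A \<in> Obj C" "B \<in> Obj C"
  shows "A \<otimes> B \<in> Obj C"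
    "pr1 A B \<in> Mor C" "Dom C (pr1 A B) = A \<otimes> B" "Cod C (pr1 A B) = A"
    "pr2 A B \<in> Mor C" "Dom C (pr2 A B) = A \<otimes> B" "Cod C (pr2 A B) = B"
  using productD [OF is_product_prd [OF assms]] by auto

lemma pair_arrow [simp]:
  assumes "arr f" "arr g" "Dom C f = Dom C g"
  shows "\<langle>f, g\<rangle> \<in> Mor C" "Dom C \<langle>f, g\<rangle> = Dom C g" "Cod C \<langle>f, g\<rangle> = Cod C f \<otimes> Cod C g"
  using product_pairing [OF is_product_prd [of "Cod C f" "Cod C g"], of f g] assms
  by (simp_all add: pair_def)

lemma pr_pair [simp]:
  assumes "arr f" "arr g" "Dom C f = Dom C g" "Cod C f = A" "Cod C g = B"
  shows "pr1 A B \<cdot> \<langle>f, g\<rangle> = f" "pr2 A B \<cdot> \<langle>f, g\<rangle> = g"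
  using product_pairing [OF is_product_prd [of "Cod C f" "Cod C g"], of f g] assms
    Cod_Obj [OF assms(1)] Cod_Obj [OF assms(2)]
  by (simp_all add: pair_def)

lemma prd_eqI:
  assumes "arr a" "arr b" "Dom C a = Dom C b" "A \<in> Obj C" "B \<in> Obj C" "Cod C a = A \<otimes> B"
    "Cod C b = A \<otimes> B" "pr1 A B \<cdot> a = pr1 A B \<cdot> b" "pr2 A B \<cdot> a = pr2 A B \<cdot> b"
  shows "a = b"
  using product_eqI [OF is_product_prd [of A B]] assms by simp

lemma pair_comp [simp]:
  assumes "arr f" "arr g" "Dom C f = Dom C g" "arr h" "Dom C g = Cod C h"
  shows "\<langle>f, g\<rangle> \<cdot> h = \<langle>f \<cdot> h, g \<cdot> h\<rangle>"
proof (rule prd_eqI)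
  show "pr1 (Cod C f) (Cod C g) \<cdot> (\<langle>f, g\<rangle> \<cdot> h) = pr1 (Cod C f) (Cod C g) \<cdot> \<langle>f \<cdot> h, g \<cdot> h\<rangle>"
    using assms by (subst comp_assoc_arrow [symmetric]) simp_all
  show "pr2 (Cod C f) (Cod C g) \<cdot> (\<langle>f, g\<rangle> \<cdot> h) = pr2 (Cod C f) (Cod C g) \<cdot> \<langle>f \<cdot> h, g \<cdot> h\<rangle>"
    using assms by (subst comp_assoc_arrow [symmetric]) simp_all
qed (use assms in simp_all)

lemma pair_eta [simp]:
  assumes "arr h" "Cod C h = A \<otimes> B" "A \<in> Obj C" "B \<in> Obj C"
  shows "\<langle>pr1 A B \<cdot> h, pr2 A B \<cdot> h\<rangle> = h"
  by (rule prd_eqI [of _ _ A B]) (use assms in simp_all)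

lemma pair_pr [simp]:
  assumes "A \<in> Obj C" "B \<in> Obj C"
  shows "\<langle>pr1 A B, pr2 A B\<rangle> = Idm C (A \<otimes> B)"
  using pair_eta [of "Idm C (A \<otimes> B)" A B] assms by simp

lemma pair_cong_eq:
  assumes "\<langle>f, g\<rangle> = \<langle>f', g'\<rangle>" "arr f" "arr g" "Dom C f = Dom C g"
    "arr f'" "arr g'" "Dom C f' = Dom C g'" "Cod C f = Cod C f'" "Cod C g = Cod C g'"
  shows "f = f'" "g = g'"
  using assms by (metis pr_pair(1), metis pr_pair(2))

section \<open>Commutative and abelian objects\<close>

lemma jointly_strongly_epic_inl_inr:
  assumes "A \<in> Obj C" "B \<in> Obj C"
  shows "jointly_strongly_epic C (inl A B) (inr A B)"
proof -
  have "\<forall>A B P p q z z'.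
        is_product C A B P p q \<and>
        z \<in> hom C A B \<and> zero_morphism C z \<and> z' \<in> hom C B A \<and> zero_morphism C z' \<longrightarrow>
        jointly_strongly_epic C (pairing C p q (Idm C A) z) (pairing C p q z' (Idm C B))"
    using unital unfolding unital_def by (elim conjE) assumption
  moreover have "zer A B \<in> hom C A B" "zer B A \<in> hom C B A" using assms by simp_all
  ultimately have "jointly_strongly_epic C (pairing C (pr1 A B) (pr2 A B) (Idm C A) (zer A B))
      (pairing C (pr1 A B) (pr2 A B) (zer B A) (Idm C B))"
    using is_product_prd [OF assms] zero_morphism_zer [of A B] zero_morphism_zer [of B A] assms by blast
  then show ?thesis using assms by (simp add: pair_def)
qed

lemma unital_eqI:
  assumes "arr a" "arr b" "A \<in> Obj C" "B \<in> Obj C" "Dom C a = A \<otimes> B" "Dom C b = A \<otimes> B"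
    "Cod C a = Cod C b" "a \<cdot> inl A B = b \<cdot> inl A B" "a \<cdot> inr A B = b \<cdot> inr A B"
  shows "a = b"
proof -
  have "\<forall>Y. \<forall>a \<in> hom C (Cod C (inl A B)) Y. \<forall>b \<in> hom C (Cod C (inl A B)) Y.
        a \<cdot> inl A B = b \<cdot> inl A B \<and> a \<cdot> inr A B = b \<cdot> inr A B \<longrightarrow> a = b"
    using jointly_strongly_epic_inl_inr [OF assms(3,4)] unfolding jointly_strongly_epic_def
    by (elim conjE) assumption
  moreover have "a \<in> hom C (Cod C (inl A B)) (Cod C a)" "b \<in> hom C (Cod C (inl A B)) (Cod C a)"
    using assms(1-7) by simp_all
  ultimately show ?thesis using assms(8,9) by blast
qed

text \<open>With \<open>\<phi>\<close> read as a binary operation, restriction to the first factor is evaluation at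
  second argument zero.\<close>

lemma binary_left:
  assumes "arr \<phi>" "Dom C \<phi> = A \<otimes> B" "\<phi> \<cdot> inl A B = f" "A \<in> Obj C" "B \<in> Obj C"
    "arr x" "Cod C x = A" "Dom C x = X"
  shows "\<phi> \<cdot> \<langle>x, zer X B\<rangle> = f \<cdot> x"
proof -
  have "\<phi> \<cdot> \<langle>x, zer X B\<rangle> = (\<phi> \<cdot> inl A B) \<cdot> x" using assms(1,2,4-) by auto
  then show ?thesis using assms by simp
qed

lemma binary_right:
  assumes "arr \<phi>" "Dom C \<phi> = A \<otimes> B" "\<phi> \<cdot> inr A B = g" "A \<in> Obj C" "B \<in> Obj C"
    "arr y" "Cod C y = B" "Dom C y = X"
  shows "\<phi> \<cdot> \<langle>zer X A, y\<rangle> = g \<cdot> y"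
proof -
  have "\<phi> \<cdot> \<langle>zer X A, y\<rangle> = (\<phi> \<cdot> inr A B) \<cdot> y" using assms(1,2,4-) by auto
  then show ?thesis using assms by simp
qed

definition comm_op :: "'o \<Rightarrow> 'm \<Rightarrow> bool" where
  "comm_op A m \<longleftrightarrow> A \<in> Obj C \<and> m \<in> hom C (A \<otimes> A) A \<and> m \<cdot> inl A A = Idm C A \<and> m \<cdot> inr A A = Idm C A"

definition comm_ob :: "'o \<Rightarrow> bool" where
  "comm_ob A \<longleftrightarrow> (\<exists>m. comm_op A m)"

definition mul :: "'o \<Rightarrow> 'm" where
  "mul A = (SOME m. comm_op A m)"

definition add :: "'m \<Rightarrow> 'm \<Rightarrow> 'm" (infixl "\<oplus>" 65) where
  "f \<oplus> g = mul (Cod C f) \<cdot> \<langle>f, g\<rangle>"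

lemma comm_obD:
  assumes "comm_ob A"
  shows "A \<in> Obj C" "mul A \<in> Mor C" "Dom C (mul A) = A \<otimes> A" "Cod C (mul A) = A"
    "mul A \<cdot> inl A A = Idm C A" "mul A \<cdot> inr A A = Idm C A"
proof -
  have "comm_op A (mul A)" using assms unfolding comm_ob_def mul_def by (rule someI_ex)
  then show "A \<in> Obj C" "mul A \<in> Mor C" "Dom C (mul A) = A \<otimes> A" "Cod C (mul A) = A"
    "mul A \<cdot> inl A A = Idm C A" "mul A \<cdot> inr A A = Idm C A"
    unfolding comm_op_def by simp_all
qed

lemma mul_arrow [simp]:
  assumes "comm_ob A"
  shows "A \<in> Obj C" "mul A \<in> Mor C" "Dom C (mul A) = A \<otimes> A" "Cod C (mul A) = A"
  using comm_obD [OF assms] by auto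

lemma add_arrow [simp]:
  assumes "arr f" "arr g" "Dom C f = Dom C g" "Cod C f = Cod C g" "comm_ob (Cod C g)"
  shows "f \<oplus> g \<in> Mor C" "Dom C (f \<oplus> g) = Dom C g" "Cod C (f \<oplus> g) = Cod C g"
  using assms by (simp_all add: add_def)

lemma add_comp [simp]:
  assumes "arr f" "arr g" "Dom C f = Dom C g" "Cod C f = Cod C g" "comm_ob (Cod C g)"
    "arr h" "Dom C g = Cod C h"
  shows "(f \<oplus> g) \<cdot> h = f \<cdot> h \<oplus> g \<cdot> h"
  using assms by (simp add: add_def)

lemma add_zer [simp]:
  assumes "arr f" "Dom C f = X" "Cod C f = A" "comm_ob A"
  shows "f \<oplus> zer X A = f" "zer X A \<oplus> f = f"
  using assms binary_left [of "mul A" A A "Idm C A" f X] binary_right [of "mul A" A A "Idm C A" f X]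
    comm_obD [of A] by (auto simp add: add_def)

lemma add_pr [simp]: "comm_ob A \<Longrightarrow> pr1 A A \<oplus> pr2 A A = mul A"
  by (simp add: add_def)

text \<open>Both sides are operations on \<open>A \<times> A\<close>, composed with \<open>\<langle>f, g\<rangle>\<close>, and agree on the two
  inclusions of \<open>A\<close>.  Commutativity and associativity follow in the same way.\<close>

lemma comp_add:
  assumes "arr k" "Dom C k = A" "Cod C k = B" "comm_ob A" "comm_ob B"
    "arr f" "arr g" "Dom C f = Dom C g" "Cod C f = A" "Cod C g = A"
  shows "k \<cdot> (f \<oplus> g) = k \<cdot> f \<oplus> k \<cdot> g"
proof -
  have "k \<cdot> mul A = k \<cdot> pr1 A A \<oplus> k \<cdot> pr2 A A"
    by (rule unital_eqI [of _ _ A A]) (use assms(1-5) comm_obD [of A] in simp_all)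
  then have "(k \<cdot> mul A) \<cdot> \<langle>f, g\<rangle> = (k \<cdot> pr1 A A \<oplus> k \<cdot> pr2 A A) \<cdot> \<langle>f, g\<rangle>" by simp
  then show ?thesis using assms by (simp add: add_def)
qed

lemma add_commute:
  assumes "arr f" "arr g" "Dom C f = Dom C g" "Cod C f = Cod C g" "comm_ob (Cod C g)"
  shows "f \<oplus> g = g \<oplus> f"
proof -
  let ?A = "Cod C g"
  have "mul ?A = pr2 ?A ?A \<oplus> pr1 ?A ?A"
    by (rule unital_eqI [of _ _ ?A ?A]) (use assms comm_obD [of ?A] in simp_all)
  then have "mul ?A \<cdot> \<langle>f, g\<rangle> = (pr2 ?A ?A \<oplus> pr1 ?A ?A) \<cdot> \<langle>f, g\<rangle>" by simp
  then show ?thesis using assms by (simp add: add_def)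
qed

lemma add_assoc:
  assumes "arr f" "arr g" "arr h" "Dom C f = Dom C g" "Dom C g = Dom C h"
    "Cod C f = Cod C g" "Cod C g = Cod C h" "comm_ob (Cod C h)"
  shows "(f \<oplus> g) \<oplus> h = f \<oplus> (g \<oplus> h)"
proof -
  let ?A = "Cod C h" let ?P = "?A \<otimes> ?A"
  have "mul ?A \<cdot> pr1 ?P ?A \<oplus> pr2 ?P ?A =
     pr1 ?A ?A \<cdot> pr1 ?P ?A \<oplus> (pr2 ?A ?A \<cdot> pr1 ?P ?A \<oplus> pr2 ?P ?A)" (is "?l = ?r")
  proof (rule unital_eqI [of _ _ ?P ?A])
    show "?l \<cdot> inl ?P ?A = ?r \<cdot> inl ?P ?A"
      using assms by simp
  qed (use assms in simp_all)
  then have "?l \<cdot> \<langle>\<langle>f, g\<rangle>, h\<rangle> = ?r \<cdot> \<langle>\<langle>f, g\<rangle>, h\<rangle>" by simp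
  then show ?thesis using assms by (simp add: add_def)
qed

lemma add_left_commute:
  assumes "arr f" "arr g" "arr h" "Dom C f = Dom C g" "Dom C g = Dom C h"
    "Cod C f = Cod C g" "Cod C g = Cod C h" "comm_ob (Cod C h)"
  shows "f \<oplus> (g \<oplus> h) = g \<oplus> (f \<oplus> h)"
  using add_assoc [of f g h] add_assoc [of g f h] add_commute [of f g] assms by simp

text \<open>By \<open>add_commute\<close> and \<open>add_assoc\<close> a unital operation is commutative and associative, so this
  describes the internal abelian groups; see \<open>abel_iff_abelian_object\<close>.\<close>

definition abel :: "'o \<Rightarrow> bool" where
  "abel A \<longleftrightarrow> comm_ob A \<and> (\<exists>i. i \<in> hom C A A \<and> Idm C A \<oplus> i = zer A A)"

definition inverse_map :: "'o \<Rightarrow> 'm" where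
  "inverse_map A = (SOME i. i \<in> hom C A A \<and> Idm C A \<oplus> i = zer A A)"

definition neg :: "'m \<Rightarrow> 'm" ("\<ominus> _" [81] 80) where
  "\<ominus> f = inverse_map (Cod C f) \<cdot> f"

lemma abel_comm_ob [simp]: "abel A \<Longrightarrow> comm_ob A"
  by (simp add: abel_def)

lemma inverse_map:
  assumes "abel A"
  shows "inverse_map A \<in> hom C A A" "Idm C A \<oplus> inverse_map A = zer A A"
proof -
  have "\<exists>i. i \<in> hom C A A \<and> Idm C A \<oplus> i = zer A A" using assms unfolding abel_def by blast
  from someI_ex [OF this] show "inverse_map A \<in> hom C A A" "Idm C A \<oplus> inverse_map A = zer A A"
    unfolding inverse_map_def by auto
qed

lemma neg_arrow [simp]:
  assumes "arr f" "abel (Cod C f)"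
  shows "\<ominus> f \<in> Mor C" "Dom C (\<ominus> f) = Dom C f" "Cod C (\<ominus> f) = Cod C f"
  using inverse_map(1) [OF assms(2)] assms by (simp_all add: neg_def)

lemma add_neg [simp]:
  assumes "arr f" "Cod C f = A" "abel A"
  shows "f \<oplus> \<ominus> f = zer (Dom C f) A" "\<ominus> f \<oplus> f = zer (Dom C f) A"
proof -
  have "f \<oplus> \<ominus> f = (Idm C A \<oplus> inverse_map A) \<cdot> f"
    using inverse_map(1) [of A] assms by (simp add: neg_def)
  also have "\<dots> = zer (Dom C f) A" using inverse_map(2) [of A] assms by simp
  finally show "f \<oplus> \<ominus> f = zer (Dom C f) A" .
  then show "\<ominus> f \<oplus> f = zer (Dom C f) A" using add_commute [of f "\<ominus> f"] assms by simp
qed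

lemma neg_comp [simp]:
  assumes "arr f" "abel (Cod C f)" "arr h" "Dom C f = Cod C h"
  shows "(\<ominus> f) \<cdot> h = \<ominus> (f \<cdot> h)"
  using inverse_map(1) [OF assms(2)] assms by (simp add: neg_def)

lemma add_left_cancel:
  assumes "f \<oplus> g = f \<oplus> h" "arr f" "arr g" "arr h" "Dom C f = Dom C g" "Dom C g = Dom C h"
    "Cod C f = Cod C g" "Cod C g = Cod C h" "abel (Cod C h)"
  shows "g = h"
proof -
  have "\<ominus> f \<oplus> f \<oplus> g = \<ominus> f \<oplus> f \<oplus> h"
    using assms add_assoc [of "\<ominus> f" f g] add_assoc [of "\<ominus> f" f h] by simp
  then show ?thesis using assms by simp
qed

lemma inverse_unique:
  assumes "f \<oplus> g = zer X A" "f \<oplus> h = zer X A" "arr f" "arr g" "arr h"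
    "Dom C f = X" "Dom C g = X" "Dom C h = X" "Cod C f = A" "Cod C g = A" "Cod C h = A" "comm_ob A"
  shows "g = h"
proof -
  have "g = (f \<oplus> h) \<oplus> g" using assms by simp
  also have "\<dots> = (f \<oplus> g) \<oplus> h" using assms(3-) by (simp add: add_assoc add_commute [of g h])
  also have "\<dots> = h" using assms by simp
  finally show ?thesis .
qed

lemma comp_neg:
  assumes "arr k" "Dom C k = A" "Cod C k = B" "abel A" "abel B" "arr f" "Cod C f = A"
  shows "k \<cdot> \<ominus> f = \<ominus> (k \<cdot> f)"
proof (rule inverse_unique [of "k \<cdot> f" _ "Dom C f" B])
  have "k \<cdot> (f \<oplus> \<ominus> f) = zer (Dom C f) B" using assms by simp
  then show "k \<cdot> f \<oplus> k \<cdot> \<ominus> f = zer (Dom C f) B"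
    using comp_add [of k A B f "\<ominus> f"] assms by simp
qed (use assms in simp_all)

text \<open>The internal structure may live on any product \<open>P\<close> and any terminal object; transporting the
  multiplication along the comparison \<open>A \<otimes> A \<rightarrow> P\<close> gives the operation required here.  Its unit is
  necessarily the zero morphism, because a terminal object is a zero object.\<close>

lemma abel_iff_abelian_object: "abel A \<longleftrightarrow> A \<in> abelian_objects C"
proof
  assume A: "abel A"
  then have [simp]: "A \<in> Obj C" "comm_ob A" using mul_arrow by auto
  let ?i = "\<ominus> (Idm C A)"
  have pairing: "pairing C (pr1 A A) (pr2 A A) f g = \<langle>f, g\<rangle>"
    if "Cod C f = A" "Cod C g = A" for f g using that by (simp add: pair_def)
  have the: "to_zero A \<in> hom C A zero_ob" by (rule to_zero_hom) simp
  have "internal_abelian_group C A (A \<otimes> A) (pr1 A A) (pr2 A A) zero_ob (mul A) (zer zero_ob A) ?i"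
    unfolding internal_abelian_group_def Let_def to_zero_def [symmetric]
  proof (intro conjI allI impI)
    fix W r s assume "is_product C (A \<otimes> A) A W r s"
    note d = productD [OF this]
    have "mul A \<cdot> r = pr1 A A \<cdot> r \<oplus> pr2 A A \<cdot> r" using d by (simp add: add_def)
    then have "(mul A \<cdot> r) \<oplus> s = pr1 A A \<cdot> r \<oplus> (pr2 A A \<cdot> r \<oplus> s)"
      using d by (simp add: add_assoc)
    then show "mul A \<cdot> pairing C (pr1 A A) (pr2 A A) (mul A \<cdot> r) s =
       mul A \<cdot> pairing C (pr1 A A) (pr2 A A) (pr1 A A \<cdot> r)
         (mul A \<cdot> pairing C (pr1 A A) (pr2 A A) (pr2 A A \<cdot> r) s)"
      using d by (simp add: pairing add_def)
  next
    show "mul A \<cdot> pairing C (pr1 A A) (pr2 A A) (Idm C A) (zer zero_ob A \<cdot> to_zero A) = Idm C A"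
      using the comm_obD [of A] by (simp add: pairing)
    show "mul A \<cdot> pairing C (pr1 A A) (pr2 A A) (Idm C A) ?i = zer zero_ob A \<cdot> to_zero A"
      using the A add_neg [of "Idm C A" A] by (simp add: pairing add_def)
    show "mul A \<cdot> pairing C (pr1 A A) (pr2 A A) (pr2 A A) (pr1 A A) = mul A"
      using add_commute [of "pr2 A A" "pr1 A A"] by (simp add: pairing add_def)
  qed (use A in \<open>simp_all add: is_product_prd terminal_zero_ob\<close>)
  then show "A \<in> abelian_objects C" using \<open>A \<in> Obj C\<close> unfolding abelian_objects_def by blast
next
  assume "A \<in> abelian_objects C"
  then obtain P p q T m e i where g: "internal_abelian_group C A P p q T m e i" and [simp]: "A \<in> Obj C"
    unfolding abelian_objects_def by auto
  have P: "is_product C A A P p q" and T: "terminal C T" and m: "m \<in> hom C P A"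
    and e: "e \<in> hom C T A" and i: "i \<in> hom C A A"
    using g unfolding internal_abelian_group_def by simp_all
  define t where "t = (THE t. t \<in> hom C A T)"
  have "\<exists>!t. t \<in> hom C A T" using T by (simp add: terminal_def del: hom_iff)
  then have t: "t \<in> hom C A T" unfolding t_def by (rule theI')
  have "e = zer T A" using terminal_comp_zer [OF T, of e] e unfolding hom_iff by metis
  then have et: "e \<cdot> t = zer A A" using t by simp
  note d = productD [OF P]
  note pp = product_pairing [OF P]
  have laws: "m \<cdot> pairing C p q (Idm C A) (zer A A) = Idm C A"
    "m \<cdot> pairing C p q (Idm C A) i = zer A A" "m \<cdot> pairing C p q q p = m"
    using g unfolding internal_abelian_group_def Let_def t_def [symmetric] et by simp_all
  define c where "c = pairing C p q (pr1 A A) (pr2 A A)"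
  have c: "arr c" "Dom C c = A \<otimes> A" "Cod C c = P" "p \<cdot> c = pr1 A A" "q \<cdot> c = pr2 A A"
    unfolding c_def using pp [of "pr1 A A" "pr2 A A"] by auto
  have cp: "c \<cdot> \<langle>f, g\<rangle> = pairing C p q f g" if "arr f" "arr g" "Dom C f = Dom C g"
    "Cod C f = A" "Cod C g = A" for f g
  proof (rule product_eqI [OF P])
    have "p \<cdot> (c \<cdot> \<langle>f, g\<rangle>) = (p \<cdot> c) \<cdot> \<langle>f, g\<rangle>" "q \<cdot> (c \<cdot> \<langle>f, g\<rangle>) = (q \<cdot> c) \<cdot> \<langle>f, g\<rangle>"
      using that c(1-3) d by simp_all
    then show "p \<cdot> (c \<cdot> \<langle>f, g\<rangle>) = p \<cdot> pairing C p q f g" "q \<cdot> (c \<cdot> \<langle>f, g\<rangle>) = q \<cdot> pairing C p q f g"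
      using c(4,5) pp [of f g] that by simp_all
  qed (use that pp [of f g] c d in simp_all)
  have swap: "m \<cdot> pairing C p q g f = m \<cdot> pairing C p q f g" if "arr f" "arr g" "Dom C f = Dom C g"
    "Cod C f = A" "Cod C g = A" for f g
  proof -
    have "pairing C p q q p \<cdot> pairing C p q f g = pairing C p q g f"
    proof (rule product_eqI [OF P])
      have "p \<cdot> (pairing C p q q p \<cdot> pairing C p q f g) = (p \<cdot> pairing C p q q p) \<cdot> pairing C p q f g"
        "q \<cdot> (pairing C p q q p \<cdot> pairing C p q f g) = (q \<cdot> pairing C p q q p) \<cdot> pairing C p q f g"
        using that pp(1-3) [of f g] pp(1-3) [of q p] d by simp_all
      then show "p \<cdot> (pairing C p q q p \<cdot> pairing C p q f g) = p \<cdot> pairing C p q g f"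
        "q \<cdot> (pairing C p q q p \<cdot> pairing C p q f g) = q \<cdot> pairing C p q g f"
        using pp [of f g] pp [of q p] pp [of g f] that d by simp_all
    qed (use that pp [of f g] pp [of q p] pp [of g f] d in simp_all)
    then have "m \<cdot> pairing C p q g f = (m \<cdot> pairing C p q q p) \<cdot> pairing C p q f g"
      using m that pp(1-3) [of f g] pp(1-3) [of q p] d by simp
    then show ?thesis using laws(3) by simp
  qed
  have op: "comm_op A (m \<cdot> c)"
    unfolding comm_op_def using m c laws(1) cp [of "Idm C A" "zer A A"] cp [of "zer A A" "Idm C A"]
      swap [of "Idm C A" "zer A A"] by simp
  then have comm: "comm_ob A" unfolding comm_ob_def by blast
  have "mul A = m \<cdot> c"
    by (rule unital_eqI [of _ _ A A]) (use op comm comm_obD [OF comm] in \<open>simp_all add: comm_op_def\<close>)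
  then have "Idm C A \<oplus> i = zer A A"
    using m c i laws(2) cp [of "Idm C A" i] by (simp add: add_def)
  then show "abel A" unfolding abel_def using comm i by blast
qed

end

section \<open>Universal arrows and monomorphisms\<close>

text \<open>Reflectivity is proved one object at a time; a choice of universal arrows is assembled into an
  adjunction only in \<open>reflective_if_universal_arrows\<close>.\<close>

definition universal_arrow :: "('o, 'm) category \<Rightarrow> 'o set \<Rightarrow> 'o \<Rightarrow> 'm \<Rightarrow> bool" where
  "universal_arrow C S A \<eta> \<longleftrightarrow> \<eta> \<in> Mor C \<and> Dom C \<eta> = A \<and> Cod C \<eta> \<in> S \<and>
     (\<forall>B \<in> S. \<forall>f \<in> hom C A B. \<exists>!g. g \<in> hom C (Cod C \<eta>) B \<and> g \<cdot>\<^bsub>C\<^esub> \<eta> = f)"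

context category
begin

lemma universal_arrowD:
  assumes "universal_arrow C S A \<eta>"
  shows "arr \<eta>" "Dom C \<eta> = A" "Cod C \<eta> \<in> S"
  using assms unfolding universal_arrow_def by auto

lemma universal_arrow_ex1:
  assumes "universal_arrow C S A \<eta>" "arr f" "Dom C f = A" "Cod C f \<in> S"
  shows "\<exists>!g. g \<in> hom C (Cod C \<eta>) (Cod C f) \<and> g \<cdot> \<eta> = f"
proof -
  have "\<forall>B \<in> S. \<forall>f \<in> hom C A B. \<exists>!g. g \<in> hom C (Cod C \<eta>) B \<and> g \<cdot> \<eta> = f"
    using assms(1) unfolding universal_arrow_def by (elim conjE) assumption
  moreover have "f \<in> hom C A (Cod C f)" using assms(2,3) by auto
  ultimately show ?thesis using assms(4) by blast
qed

lemma universal_arrow_lift: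
  assumes "universal_arrow C S A \<eta>" "arr f" "Dom C f = A" "Cod C f \<in> S"
  obtains g where "arr g" "Dom C g = Cod C \<eta>" "Cod C g = Cod C f" "g \<cdot> \<eta> = f"
  using universal_arrow_ex1 [OF assms] by auto

lemma universal_arrow_eqI:
  assumes "universal_arrow C S A \<eta>" "arr g" "arr g'" "Dom C g = Cod C \<eta>" "Dom C g' = Cod C \<eta>"
    "Cod C g = Cod C g'" "Cod C g' \<in> S" "g \<cdot> \<eta> = g' \<cdot> \<eta>"
  shows "g = g'"
proof -
  note d = universal_arrowD [OF assms(1)]
  have "\<exists>!h. h \<in> hom C (Cod C \<eta>) (Cod C (g' \<cdot> \<eta>)) \<and> h \<cdot> \<eta> = g' \<cdot> \<eta>"
    by (rule universal_arrow_ex1 [OF assms(1)]) (use d assms(3,5,7) in simp_all)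
  moreover have "g \<in> hom C (Cod C \<eta>) (Cod C (g' \<cdot> \<eta>))" "g' \<in> hom C (Cod C \<eta>) (Cod C (g' \<cdot> \<eta>))"
    using d assms(2-6) by auto
  ultimately show ?thesis using assms(8) by metis
qed

lemma universal_arrowI:
  assumes "arr \<eta>" "Dom C \<eta> = A" "Cod C \<eta> \<in> S"
    and ex: "\<And>f. arr f \<Longrightarrow> Dom C f = A \<Longrightarrow> Cod C f \<in> S \<Longrightarrow>
      \<exists>g. arr g \<and> Dom C g = Cod C \<eta> \<and> Cod C g = Cod C f \<and> g \<cdot> \<eta> = f"
    and uniq: "\<And>g g'. arr g \<Longrightarrow> arr g' \<Longrightarrow> Dom C g = Cod C \<eta> \<Longrightarrow> Dom C g' = Cod C \<eta> \<Longrightarrow>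
      Cod C g = Cod C g' \<Longrightarrow> Cod C g' \<in> S \<Longrightarrow> g \<cdot> \<eta> = g' \<cdot> \<eta> \<Longrightarrow> g = g'"
  shows "universal_arrow C S A \<eta>"
proof -
  have ex1: "\<exists>!g. g \<in> hom C (Cod C \<eta>) B \<and> g \<cdot> \<eta> = f" if f: "B \<in> S" "f \<in> hom C A B" for B f
  proof -
    obtain g where g: "arr g" "Dom C g = Cod C \<eta>" "Cod C g = B" "g \<cdot> \<eta> = f"
      using ex [of f] f by auto
    show ?thesis
    proof (rule ex1I [of _ g])
      show "g \<in> hom C (Cod C \<eta>) B \<and> g \<cdot> \<eta> = f" using g f assms(1) by auto
      show "g' = g" if "g' \<in> hom C (Cod C \<eta>) B \<and> g' \<cdot> \<eta> = f" for g'
        by (rule uniq) (use g that f in auto)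
    qed
  qed
  show ?thesis unfolding universal_arrow_def
    by (intro conjI ballI; (rule ex1; assumption)?; fact)
qed

lemma monicD:
  assumes "monic C m" "arr a" "arr b" "Dom C a = Dom C b" "Cod C a = Dom C m" "Cod C b = Dom C m"
    "m \<cdot> a = m \<cdot> b"
  shows "a = b"
proof -
  have "\<forall>X. \<forall>a \<in> hom C X (Dom C m). \<forall>b \<in> hom C X (Dom C m). m \<cdot> a = m \<cdot> b \<longrightarrow> a = b" "arr m"
    using assms(1) unfolding monic_def by auto
  moreover have "a \<in> hom C (Dom C b) (Dom C m)" "b \<in> hom C (Dom C b) (Dom C m)"
    using assms(2-6) \<open>m \<in> Mor C\<close> by auto
  ultimately show ?thesis using assms(7) by blast
qed

lemma monicI:
  assumes "arr m"
    and "\<And>a b. arr a \<Longrightarrow> arr b \<Longrightarrow> Dom C a = Dom C b \<Longrightarrow> Cod C a = Dom C m \<Longrightarrow> Cod C b = Dom C m \<Longrightarrow>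
      m \<cdot> a = m \<cdot> b \<Longrightarrow> a = b"
  shows "monic C m"
  unfolding monic_def using assms by simp

lemma regular_epi_descend:
  assumes e: "regular_epi C e" and g: "arr g" "Dom C g = Dom C e"
    and *: "\<And>u v. arr u \<Longrightarrow> arr v \<Longrightarrow> Dom C u = Dom C v \<Longrightarrow> Cod C u = Dom C e \<Longrightarrow> Cod C v = Dom C e \<Longrightarrow>
      e \<cdot> u = e \<cdot> v \<Longrightarrow> g \<cdot> u = g \<cdot> v"
  obtains h where "arr h" "Dom C h = Cod C e" "Cod C h = Cod C g" "h \<cdot> e = g"
proof -
  obtain u v where uv: "is_coequalizer C u v e" using e unfolding regular_epi_def by blast
  have "g \<cdot> u = g \<cdot> v" using coequalizerD [OF uv] by (intro *) auto
  from coequalizer_lift [OF uv g this] show thesis using that by blast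
qed

end

section \<open>Regular epimorphisms and images in exact categories\<close>

locale exact_unital_category = unital_category C for C :: "('o, 'm) category" (structure) +
  assumes exact: "Barr_exact C" and cocomplete: "finitely_cocomplete C"
begin

lemma coequalizer_ex:
  assumes "arr u" "arr v" "Dom C u = Dom C v" "Cod C u = Cod C v"
  obtains c where "is_coequalizer C u v c"
  using finitely_cocomplete_coequalizer [OF category_axioms cocomplete assms] by blast

lemma regular_epi_pullback:
  assumes "is_pullback C f g p q" "regular_epi C f"
  shows "regular_epi C q"
proof -
  have "\<forall>f g p q. is_pullback C f g p q \<and> regular_epi C f \<longrightarrow> regular_epi C q"
    using exact unfolding Barr_exact_def regular_category_def by (elim conjE) assumption
  then show ?thesis using assms by blast
qed

text \<open>This is how elements are chosen: along a regular epimorphism an element lifts after passing to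
  a cover \<open>w\<close> of its stage.\<close>

lemma local_lift:
  assumes "regular_epi C e" "arr x" "Cod C x = Cod C e"
  obtains w y where "regular_epi C w" "arr w" "Cod C w = Dom C x" "arr y" "Dom C y = Dom C w"
    "Cod C y = Dom C e" "e \<cdot> y = x \<cdot> w"
proof -
  obtain y w where pb: "is_pullback C e x y w"
    using pullback_ex [of e x] assms regular_epi_arrow [of e] by auto
  show thesis using that [of w y] regular_epi_pullback [OF pb assms(1)] pullbackD [OF pb] by auto
qed

text \<open>Let \<open>e\<close> be the coequalizer of the kernel pair of \<open>f = m e\<close>.  If \<open>m a = m b\<close>, lift \<open>a\<close> and
  \<open>b\<close> locally along \<open>e\<close>; the lifts have the same image under \<open>f\<close>, hence lie in the kernel pair and
  are identified by \<open>e\<close>, so \<open>a\<close> and \<open>b\<close> agree on a cover.\<close>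

lemma image_factorization:
  assumes f: "arr f"
  obtains e m where "regular_epi C e" "monic C m" "arr e" "arr m" "Dom C e = Dom C f"
    "Cod C m = Cod C f" "Dom C m = Cod C e" "m \<cdot> e = f"
proof -
  obtain p q where pb: "is_pullback C f f p q" using pullback_ex [of f f] f by auto
  note d = pullbackD [OF pb]
  obtain e where ce: "is_coequalizer C p q e" using coequalizer_ex [of p q] d by auto
  note de = coequalizerD [OF ce]
  have e: "regular_epi C e" using ce unfolding regular_epi_def by blast
  obtain m where m: "arr m" "Dom C m = Cod C e" "Cod C m = Cod C f" "m \<cdot> e = f"
    using coequalizer_lift [OF ce, of f] d de f by auto
  have "monic C m"
  proof (rule monicI [OF m(1)])
    fix a b assume ab: "arr a" "arr b" "Dom C a = Dom C b" "Cod C a = Dom C m"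
      "Cod C b = Dom C m" "m \<cdot> a = m \<cdot> b"
    obtain w a' where w: "regular_epi C w" "arr w" "Cod C w = Dom C a" "arr a'"
      "Dom C a' = Dom C w" "Cod C a' = Dom C e" "e \<cdot> a' = a \<cdot> w"
      using local_lift [OF e, of a] ab m by auto
    obtain z b' where z: "regular_epi C z" "arr z" "Cod C z = Dom C w" "arr b'"
      "Dom C b' = Dom C z" "Cod C b' = Dom C e" "e \<cdot> b' = (b \<cdot> w) \<cdot> z"
      using local_lift [OF e, of "b \<cdot> w"] ab m w by auto
    have "f \<cdot> (a' \<cdot> z) = m \<cdot> (e \<cdot> a') \<cdot> z" using m(1-3) w(2-6) z(2-6) de by (simp add: m(4) [symmetric])
    also have "\<dots> = (m \<cdot> a) \<cdot> (w \<cdot> z)" using m(1-3) w z(2-6) de ab(1-5) by simp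
    also have "\<dots> = m \<cdot> ((b \<cdot> w) \<cdot> z)" using m(1-3) w(2-6) z(2-6) de ab(1-5) by (simp add: ab(6))
    also have "\<dots> = m \<cdot> (e \<cdot> b')" using z by simp
    also have "\<dots> = f \<cdot> b'" using m(1-3) z(2-6) de by (simp add: m(4) [symmetric])
    finally obtain r where r: "arr r" "Cod C r = Dom C p" "p \<cdot> r = a' \<cdot> z" "q \<cdot> r = b'"
      using pullback_lift [OF pb, of "a' \<cdot> z" b'] w z de d by auto
    have "e \<cdot> (p \<cdot> r) = e \<cdot> (q \<cdot> r)" by (rule comp_cong_left) (use r(1,2) de d in auto)
    then have "e \<cdot> (a' \<cdot> z) = (b \<cdot> w) \<cdot> z" using r z(7) by simp
    then have "(e \<cdot> a') \<cdot> z = (b \<cdot> w) \<cdot> z" using w(2-6) z(2-3) de(3) by simp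
    then have "(a \<cdot> w) \<cdot> z = (b \<cdot> w) \<cdot> z" by (simp only: w(7))
    then have "a \<cdot> w = b \<cdot> w" by - (rule regular_epi_cancel [OF z(1)], use ab m w z in auto)
    then show "a = b" by - (rule regular_epi_cancel [OF w(1)], use ab m w z in auto)
  qed
  then show thesis using that e m de d by auto
qed

text \<open>The monic part of the image factorization of \<open>f\<close> has a section, so it is invertible, and \<open>f\<close> is
  a coequalizer of the same pair as the regular epimorphism onto its image.\<close>

lemma regular_epi_if_extremal:
  assumes f: "arr f"
    and split: "\<And>m x. monic C m \<Longrightarrow> arr x \<Longrightarrow> arr m \<Longrightarrow> Cod C x = Dom C m \<Longrightarrow> m \<cdot> x = f \<Longrightarrow>
      \<exists>s. arr s \<and> Dom C s = Cod C m \<and> Cod C s = Dom C m \<and> m \<cdot> s = Idm C (Cod C m)"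
  shows "regular_epi C f"
proof -
  obtain e m where e: "regular_epi C e" and mono: "monic C m" and em: "arr e" "arr m" "Dom C e = Dom C f"
    "Cod C m = Cod C f" "Dom C m = Cod C e" "m \<cdot> e = f"
    by (rule image_factorization [OF f])
  obtain s where s: "arr s" "Dom C s = Cod C m" "Cod C s = Dom C m" "m \<cdot> s = Idm C (Cod C m)"
    using split [OF mono, of e] em by auto
  have "m \<cdot> (s \<cdot> m) = (m \<cdot> s) \<cdot> m" using s(1-3) em by simp
  then have "m \<cdot> (s \<cdot> m) = m \<cdot> Idm C (Dom C m)" using s em by simp
  then have sm: "s \<cdot> m = Idm C (Dom C m)"
    by - (rule monicD [OF mono], use s em in auto)
  have "s \<cdot> (m \<cdot> e) = (s \<cdot> m) \<cdot> e" using s(1-3) em(1-5) by simp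
  then have sf: "s \<cdot> f = e" using em sm by simp
  obtain u v where uv: "is_coequalizer C u v e" using e unfolding regular_epi_def by blast
  note d = coequalizerD [OF uv]
  have "is_coequalizer C u v f"
  proof (rule coequalizerI)
    have "m \<cdot> (e \<cdot> u) = m \<cdot> (e \<cdot> v)" using d by simp
    then have "(m \<cdot> e) \<cdot> u = (m \<cdot> e) \<cdot> v" using d(1-6) em(1-5) by simp
    then show "f \<cdot> u = f \<cdot> v" using em(6) by simp
  next
    fix g assume g: "arr g" "Dom C g = Dom C f" "g \<cdot> u = g \<cdot> v"
    obtain h where h: "arr h" "Dom C h = Cod C e" "Cod C h = Cod C g" "h \<cdot> e = g"
      using coequalizer_lift [OF uv, of g] g em by auto
    have "(h \<cdot> s) \<cdot> f = g" using h s em(1-5) sf f by simp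
    then show "\<exists>h. arr h \<and> Dom C h = Cod C f \<and> Cod C h = Cod C g \<and> h \<cdot> f = g"
      using h s em(1-5) by (intro exI [of _ "h \<cdot> s"]) simp
  next
    fix a b assume ab: "arr a" "arr b" "Dom C a = Cod C f" "Dom C b = Cod C f" "a \<cdot> f = b \<cdot> f"
    have "(a \<cdot> m) \<cdot> e = (b \<cdot> m) \<cdot> e" using ab em by simp
    then have "a \<cdot> m = b \<cdot> m" by - (rule regular_epi_cancel [OF e], use ab em in auto)
    then have "(a \<cdot> m) \<cdot> s = (b \<cdot> m) \<cdot> s" by simp
    then show "a = b" using ab em(1-5) s by simp
  qed (use d em f in auto)
  then show ?thesis unfolding regular_epi_def by blast
qed

lemma regular_epi_right_cancel:
  assumes "regular_epi C (g \<cdot> h)" "arr g" "arr h" "Dom C g = Cod C h"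
  shows "regular_epi C g"
proof (rule regular_epi_if_extremal [OF assms(2)])
  fix m x assume m: "monic C m" "arr x" "arr m" "Cod C x = Dom C m" "m \<cdot> x = g"
  have dc: "Dom C x = Cod C h" "Cod C m = Cod C g" using m(2-5) assms(4) by auto
  obtain s where s: "arr s" "Dom C s = Cod C (g \<cdot> h)" "Cod C s = Cod C (x \<cdot> h)" "s \<cdot> (g \<cdot> h) = x \<cdot> h"
  proof (rule regular_epi_descend [OF assms(1), of "x \<cdot> h"])
    fix u v assume uv: "arr u" "arr v" "Dom C u = Dom C v" "Cod C u = Dom C (g \<cdot> h)"
      "Cod C v = Dom C (g \<cdot> h)" "(g \<cdot> h) \<cdot> u = (g \<cdot> h) \<cdot> v"
    then have "m \<cdot> ((x \<cdot> h) \<cdot> u) = m \<cdot> ((x \<cdot> h) \<cdot> v)"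
      using m(2-4) dc assms(2-4) by (simp add: m(5) [symmetric])
    then show "(x \<cdot> h) \<cdot> u = (x \<cdot> h) \<cdot> v"
      by - (rule monicD [OF m(1)], use uv m(2-4) dc assms(2-4) in auto)
  qed (use m dc assms in auto)
  have "(m \<cdot> s) \<cdot> (g \<cdot> h) = m \<cdot> (s \<cdot> (g \<cdot> h))" using s(1-3) m(2-4) dc assms(2-4) by simp
  also have "\<dots> = (m \<cdot> x) \<cdot> h" using s(4) m(2-4) dc assms(3) by simp
  also have "\<dots> = Idm C (Cod C m) \<cdot> (g \<cdot> h)" using m dc assms(2-4) by simp
  finally have "m \<cdot> s = Idm C (Cod C m)"
    by - (rule regular_epi_cancel [OF assms(1)], use s(1-3) m(2-4) dc assms(2-4) in simp_all)
  then show "\<exists>s. arr s \<and> Dom C s = Cod C m \<and> Cod C s = Dom C m \<and> m \<cdot> s = Idm C (Cod C m)"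
    using s m dc assms(2-4) by (intro exI [of _ s]) auto
qed

text \<open>A jointly monic pair represents a relation, and membership of \<open>(x, y)\<close> in a relation can be
  checked on a cover \<open>w\<close>: uniqueness makes the local witnesses compatible.\<close>

lemma mono_pair_descend:
  assumes w: "regular_epi C w" and m: "arr m" "arr n" "Dom C m = Dom C n"
    and mono: "\<And>a b. arr a \<Longrightarrow> arr b \<Longrightarrow> Dom C a = Dom C b \<Longrightarrow> Cod C a = Dom C n \<Longrightarrow>
      Cod C b = Dom C n \<Longrightarrow> m \<cdot> a = m \<cdot> b \<Longrightarrow> n \<cdot> a = n \<cdot> b \<Longrightarrow> a = b"
    and xy: "arr x" "arr y" "Dom C x = Cod C w" "Dom C y = Cod C w"
    and z: "arr z" "Dom C z = Dom C w" "Cod C z = Dom C n" "m \<cdot> z = x \<cdot> w" "n \<cdot> z = y \<cdot> w"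
  obtains z' where "arr z'" "Dom C z' = Cod C w" "Cod C z' = Dom C n" "m \<cdot> z' = x" "n \<cdot> z' = y"
proof -
  have wm: "arr w" by (rule regular_epi_arrow [OF w])
  obtain z' where z': "arr z'" "Dom C z' = Cod C w" "Cod C z' = Cod C z" "z' \<cdot> w = z"
  proof (rule regular_epi_descend [OF w z(1,2)])
    fix u v assume uv: "arr u" "arr v" "Dom C u = Dom C v" "Cod C u = Dom C w"
      "Cod C v = Dom C w" "w \<cdot> u = w \<cdot> v"
    have "x \<cdot> (w \<cdot> u) = x \<cdot> (w \<cdot> v)" "y \<cdot> (w \<cdot> u) = y \<cdot> (w \<cdot> v)" using uv(6) by simp_all
    then have "(x \<cdot> w) \<cdot> u = (x \<cdot> w) \<cdot> v" "(y \<cdot> w) \<cdot> u = (y \<cdot> w) \<cdot> v" using uv(1-5) xy wm by simp_all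
    then have "m \<cdot> (z \<cdot> u) = m \<cdot> (z \<cdot> v)" "n \<cdot> (z \<cdot> u) = n \<cdot> (z \<cdot> v)"
      unfolding z(4,5) [symmetric] using uv(1-5) m z(1-3) by simp_all
    then show "z \<cdot> u = z \<cdot> v" by - (rule mono, use uv(1-5) z(1-3) in simp_all)
  qed blast
  have "(m \<cdot> z') \<cdot> w = x \<cdot> w" "(n \<cdot> z') \<cdot> w = y \<cdot> w" using z' m z wm by simp_all
  note eqs = this
  have "m \<cdot> z' = x"
    by (rule regular_epi_cancel [OF w _ _ _ _ eqs(1)]) (use z'(1-3) m z(1-3) xy in simp_all)
  moreover have "n \<cdot> z' = y"
    by (rule regular_epi_cancel [OF w _ _ _ _ eqs(2)]) (use z'(1-3) m z(1-3) xy in simp_all)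
  ultimately show thesis using that z'(1-3) z(3) by simp
qed

section \<open>Cooperating morphisms and quotients of abelian objects\<close>

lemma regular_epi_prd_Idm:
  assumes e: "regular_epi C e" and D: "D \<in> Obj C" and AB: "Dom C e = A" "Cod C e = B"
  shows "regular_epi C \<langle>e \<cdot> pr1 A D, pr2 A D\<rangle>"
proof (rule regular_epi_pullback [OF _ e])
  have em: "arr e" by (rule regular_epi_arrow [OF e])
  then have O: "A \<in> Obj C" "B \<in> Obj C" using AB by auto
  let ?E = "\<langle>e \<cdot> pr1 A D, pr2 A D\<rangle>"
  show "is_pullback C e (pr1 B D) (pr1 A D) ?E"
  proof (rule pullbackI)
    fix a b assume ab: "arr a" "arr b" "Dom C a = Dom C b" "Cod C a = Dom C e"
      "Cod C b = Dom C (pr1 B D)" "e \<cdot> a = pr1 B D \<cdot> b"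
    let ?h = "\<langle>a, pr2 B D \<cdot> b\<rangle>"
    have "?E \<cdot> ?h = \<langle>pr1 B D \<cdot> b, pr2 B D \<cdot> b\<rangle>" using ab em O AB D by simp
    then have "?E \<cdot> ?h = b" using ab em O AB D by simp
    then show "\<exists>h. arr h \<and> Dom C h = Dom C a \<and> Cod C h = Dom C (pr1 A D) \<and> pr1 A D \<cdot> h = a \<and> ?E \<cdot> h = b"
      using ab(1-5) em O AB D by (intro exI [of _ ?h]) simp
  next
    fix a b assume ab: "arr a" "arr b" "Dom C a = Dom C b" "Cod C a = Dom C (pr1 A D)"
      "Cod C b = Dom C (pr1 A D)" "pr1 A D \<cdot> a = pr1 A D \<cdot> b" "?E \<cdot> a = ?E \<cdot> b"
    then have "pr2 B D \<cdot> (?E \<cdot> a) = pr2 B D \<cdot> (?E \<cdot> b)" by (simp only:)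
    then have "pr2 A D \<cdot> a = pr2 A D \<cdot> b" using ab(1-5) em O AB D by simp
    then show "a = b" using ab(1-6) O D by - (rule prd_eqI [of _ _ A D], auto)
  qed (use em O AB D in simp_all)
qed

text \<open>Two morphisms with a common codomain cooperate if some morphism on the product of their domains,
  a cooperator, restricts to them; here \<open>\<phi>\<close> is a cooperator of \<open>f e\<close> and \<open>g\<close>, and \<open>\<psi>\<close> one of \<open>f\<close> and \<open>g\<close>.  As \<open>e \<times> 1\<close> is again a regular epimorphism, \<open>\<phi>\<close> has to be shown to depend on the first
  argument only through \<open>e\<close>.  For the kernel pair \<open>r, s\<close> of \<open>e\<close>, the morphisms \<open>\<phi> (r \<times> 1)\<close> and
  \<open>\<phi> (s \<times> 1)\<close> agree on both factors, so they are equal by unitality.\<close>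

lemma cooperator_descend:
  assumes e: "regular_epi C e" and AB: "Dom C e = A" "Cod C e = B"
    and f: "arr f" "Dom C f = B" and g: "arr g" "Dom C g = D" "Cod C g = Cod C f"
    and \<phi>: "arr \<phi>" "Dom C \<phi> = A \<otimes> D" "Cod C \<phi> = Cod C f" "\<phi> \<cdot> inl A D = f \<cdot> e" "\<phi> \<cdot> inr A D = g"
  obtains \<psi> where "arr \<psi>" "Dom C \<psi> = B \<otimes> D" "Cod C \<psi> = Cod C f" "\<psi> \<cdot> inl B D = f" "\<psi> \<cdot> inr B D = g"
    "\<psi> \<cdot> \<langle>e \<cdot> pr1 A D, pr2 A D\<rangle> = \<phi>"
proof -
  have em: "arr e" by (rule regular_epi_arrow [OF e])
  then have O: "A \<in> Obj C" "B \<in> Obj C" "D \<in> Obj C" using AB g by auto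
  let ?E = "\<langle>e \<cdot> pr1 A D, pr2 A D\<rangle>"
  have E: "regular_epi C ?E" using regular_epi_prd_Idm [OF e O(3) AB] .
  have Em: "arr ?E" "Dom C ?E = A \<otimes> D" "Cod C ?E = B \<otimes> D" using em O AB by simp_all
  obtain r s where pb: "is_pullback C e e r s" using pullback_ex [of e e] em by auto
  note d = pullbackD [OF pb]
  define R where "R = Dom C r"
  have R: "R \<in> Obj C" "Dom C r = R" "Dom C s = R" using d by (simp_all add: R_def)
  \<comment> \<open>The first argument matters only up to the kernel pair of \<open>e\<close>.\<close>
  have key: "\<phi> \<cdot> \<langle>r \<cdot> pr1 R D, pr2 R D\<rangle> = \<phi> \<cdot> \<langle>s \<cdot> pr1 R D, pr2 R D\<rangle>"
  proof (rule unital_eqI [of _ _ R D])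
    have "\<phi> \<cdot> \<langle>r, zer R D\<rangle> = (f \<cdot> e) \<cdot> r"
      by (rule binary_left [OF \<phi>(1,2,4)]) (use O d AB R in simp_all)
    moreover have "\<phi> \<cdot> \<langle>s, zer R D\<rangle> = (f \<cdot> e) \<cdot> s"
      by (rule binary_left [OF \<phi>(1,2,4)]) (use O d AB R in simp_all)
    ultimately have "\<phi> \<cdot> \<langle>r, zer R D\<rangle> = \<phi> \<cdot> \<langle>s, zer R D\<rangle>" using f em d AB by simp
    then show "(\<phi> \<cdot> \<langle>r \<cdot> pr1 R D, pr2 R D\<rangle>) \<cdot> inl R D = (\<phi> \<cdot> \<langle>s \<cdot> pr1 R D, pr2 R D\<rangle>) \<cdot> inl R D"
      using \<phi>(1-3) O R d AB by simp
  qed (use \<phi>(1-3) O R d AB in simp_all)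
  obtain \<psi> where \<psi>: "arr \<psi>" "Dom C \<psi> = Cod C ?E" "Cod C \<psi> = Cod C \<phi>" "\<psi> \<cdot> ?E = \<phi>"
  proof (rule regular_epi_descend [OF E \<phi>(1)])
    fix u v assume uv: "arr u" "arr v" "Dom C u = Dom C v" "Cod C u = Dom C ?E"
      "Cod C v = Dom C ?E" "?E \<cdot> u = ?E \<cdot> v"
    have uv': "Cod C u = A \<otimes> D" "Cod C v = A \<otimes> D" using uv Em by simp_all
    have "pr1 B D \<cdot> (?E \<cdot> u) = pr1 B D \<cdot> (?E \<cdot> v)" "pr2 B D \<cdot> (?E \<cdot> u) = pr2 B D \<cdot> (?E \<cdot> v)"
      using uv(6) by (simp_all only:)
    then have eq: "e \<cdot> (pr1 A D \<cdot> u) = e \<cdot> (pr1 A D \<cdot> v)" "pr2 A D \<cdot> u = pr2 A D \<cdot> v"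
      using uv(1-3) uv' em O AB by simp_all
    obtain t where t: "arr t" "Dom C t = Dom C v" "Cod C t = R" "r \<cdot> t = pr1 A D \<cdot> u" "s \<cdot> t = pr1 A D \<cdot> v"
      using pullback_lift [OF pb, of "pr1 A D \<cdot> u" "pr1 A D \<cdot> v"] eq uv(1-3) uv' O AB R by auto
    let ?d = "pr2 A D \<cdot> v"
    have "(\<phi> \<cdot> \<langle>r \<cdot> pr1 R D, pr2 R D\<rangle>) \<cdot> \<langle>t, ?d\<rangle> = (\<phi> \<cdot> \<langle>s \<cdot> pr1 R D, pr2 R D\<rangle>) \<cdot> \<langle>t, ?d\<rangle>"
      using key by simp
    then have "\<phi> \<cdot> \<langle>r \<cdot> t, ?d\<rangle> = \<phi> \<cdot> \<langle>s \<cdot> t, ?d\<rangle>"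
      using \<phi>(1-3) O R d AB t(1-3) uv(1-3) uv' by simp
    then have "\<phi> \<cdot> \<langle>pr1 A D \<cdot> u, pr2 A D \<cdot> u\<rangle> = \<phi> \<cdot> \<langle>pr1 A D \<cdot> v, pr2 A D \<cdot> v\<rangle>" by (simp only: t eq)
    then show "\<phi> \<cdot> u = \<phi> \<cdot> v" using uv(1-3) uv' O by simp
  qed (use \<phi> Em in auto)
  have "(\<psi> \<cdot> inl B D) \<cdot> e = (\<psi> \<cdot> ?E) \<cdot> inl A D" using \<psi>(1-3) em O AB by simp
  also have "\<dots> = f \<cdot> e" using \<psi>(4) \<phi>(4) by simp
  finally have 1: "\<psi> \<cdot> inl B D = f"
    by - (rule regular_epi_cancel [OF e], use f \<psi>(1-3) O AB em in simp_all)
  have "\<psi> \<cdot> inr B D = (\<psi> \<cdot> ?E) \<cdot> inr A D" using \<psi>(1-3) em O AB by simp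
  also have "\<dots> = g" using \<psi>(4) \<phi>(5) by simp
  finally show thesis using that [OF \<psi>(1) _ _ 1] \<psi>(2-4) Em \<phi>(3) by simp
qed

text \<open>Descend the cooperator first along \<open>e\<close> in the first argument, then, after exchanging the
  factors, in the second.\<close>

lemma comm_ob_quotient:
  assumes e: "regular_epi C e" "Dom C e = A" "Cod C e = Q"
    and \<phi>: "\<phi> \<in> hom C (A \<otimes> A) Q" "\<phi> \<cdot> inl A A = e" "\<phi> \<cdot> inr A A = e"
  shows "comm_ob Q"
proof -
  have em: "arr e" by (rule regular_epi_arrow [OF e(1)])
  then have O: "A \<in> Obj C" "Q \<in> Obj C" using e by auto
  obtain \<psi> where \<psi>: "arr \<psi>" "Dom C \<psi> = Q \<otimes> A" "Cod C \<psi> = Q" "\<psi> \<cdot> inl Q A = Idm C Q" "\<psi> \<cdot> inr Q A = e"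
    using cooperator_descend [OF e, of "Idm C Q" e A \<phi>] \<phi> em O e by auto
  have "\<psi> \<cdot> \<langle>pr2 A Q, pr1 A Q\<rangle> \<cdot> inl A Q = e" "\<psi> \<cdot> \<langle>pr2 A Q, pr1 A Q\<rangle> \<cdot> inr A Q = Idm C Q"
    using \<psi> O by simp_all
  then obtain \<chi> where "arr \<chi>" "Dom C \<chi> = Q \<otimes> Q" "Cod C \<chi> = Q" "\<chi> \<cdot> inl Q Q = Idm C Q" "\<chi> \<cdot> inr Q Q = Idm C Q"
    using cooperator_descend [OF e, of "Idm C Q" "Idm C Q" Q "\<psi> \<cdot> \<langle>pr2 A Q, pr1 A Q\<rangle>"] \<psi> em O e by auto
  then have "comm_op Q \<chi>" using O by (simp add: comm_op_def)
  then show ?thesis unfolding comm_ob_def by blast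
qed

lemma comm_ob_prd [simp]:
  assumes "comm_ob A" "comm_ob B"
  shows "comm_ob (A \<otimes> B)"
proof -
  let ?P = "A \<otimes> B"
  have O: "A \<in> Obj C" "B \<in> Obj C" using assms by auto
  have "comm_op ?P \<langle>pr1 A B \<cdot> pr1 ?P ?P \<oplus> pr1 A B \<cdot> pr2 ?P ?P, pr2 A B \<cdot> pr1 ?P ?P \<oplus> pr2 A B \<cdot> pr2 ?P ?P\<rangle>"
    unfolding comm_op_def using assms O by simp
  then show ?thesis unfolding comm_ob_def by blast
qed

lemma comm_ob_regular_quotient:
  assumes "comm_ob A" "regular_epi C c" "Dom C c = A" "Cod C c = Q"
  shows "comm_ob Q"
proof (rule comm_ob_quotient [OF assms(2-4)])
  have c: "arr c" by (rule regular_epi_arrow [OF assms(2)])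
  show "c \<cdot> mul A \<in> hom C (A \<otimes> A) Q" using assms c by auto
  show "(c \<cdot> mul A) \<cdot> inl A A = c" "(c \<cdot> mul A) \<cdot> inr A A = c" using assms c comm_obD [of A] by simp_all
qed

text \<open>For \<open>Q\<close> to inherit inverses, \<open>c \<ominus>\<close> has to coequalize \<open>u\<close> and \<open>v\<close>; this holds as \<open>c \<ominus> u\<close> and
  \<open>c \<ominus> v\<close> are both inverse to \<open>c u = c v\<close> in the commutative object \<open>Q\<close>.\<close>

lemma abel_quotient:
  assumes A: "abel A" and c: "is_coequalizer C u v c" "Dom C c = A" "Cod C c = Q"
  shows "abel Q"
proof -
  note d = coequalizerD [OF c(1)]
  have ce: "regular_epi C c" using c unfolding regular_epi_def by blast
  have Q: "comm_ob Q" using comm_ob_regular_quotient [of A c Q] ce A c by simp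
  have [simp]: "A \<in> Obj C" using A by (intro mul_arrow(1)) simp
  let ?i = "\<ominus> (Idm C A)"
  have inv: "c \<cdot> x \<oplus> (c \<cdot> ?i) \<cdot> x = zer (Dom C x) Q" if "arr x" "Cod C x = A" for x
  proof -
    have "c \<cdot> (x \<oplus> ?i \<cdot> x) = zer (Dom C x) Q" using that A c d by simp
    then show ?thesis using comp_add [of c A Q x "?i \<cdot> x"] that A c d Q by simp
  qed
  have "(c \<cdot> ?i) \<cdot> u = (c \<cdot> ?i) \<cdot> v"
  proof (rule inverse_unique [of "c \<cdot> u" _ "Dom C u" Q])
    show "c \<cdot> u \<oplus> (c \<cdot> ?i) \<cdot> u = zer (Dom C u) Q" using inv [of u] d c by simp
    show "c \<cdot> u \<oplus> (c \<cdot> ?i) \<cdot> v = zer (Dom C u) Q" using inv [of v] d c by simp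
  qed (use A c d Q in simp_all)
  then obtain j where j: "arr j" "Dom C j = Q" "Cod C j = Q" "j \<cdot> c = c \<cdot> ?i"
    using coequalizer_lift [OF c(1), of "c \<cdot> ?i"] A c d by auto
  have "(Idm C Q \<oplus> j) \<cdot> c = zer Q Q \<cdot> c" using inv [of "Idm C A"] j A c d Q by simp
  then have "Idm C Q \<oplus> j = zer Q Q"
    by - (rule regular_epi_cancel [OF ce], use j Q c in simp_all)
  then show ?thesis unfolding abel_def using Q j by auto
qed

section \<open>The reflection onto the abelian core\<close>

text \<open>The unit \<open>\<eta>\<close> is the common restriction to both factors of the coequalizer \<open>q: A \<times> A \<rightarrow> Q\<close> of the
  two inclusions.  Those inclusions are jointly strongly epic, so any monomorphism through which \<open>\<eta>\<close>
  factors also factors \<open>q\<close> and is split; thus \<open>\<eta>\<close> is a regular epimorphism.  Then \<open>q\<close>, a cooperator of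
  \<open>\<eta>\<close> with itself, makes \<open>Q\<close> commutative.\<close>

lemma commutative_reflection:
  assumes A: "A \<in> Obj C"
  obtains \<eta> where "universal_arrow C {Q. comm_ob Q} A \<eta>" "regular_epi C \<eta>"
proof -
  obtain q where q: "is_coequalizer C (inl A A) (inr A A) q"
    using coequalizer_ex [of "inl A A" "inr A A"] A by auto
  have d: "arr q" "Dom C q = A \<otimes> A" "q \<cdot> inl A A = q \<cdot> inr A A"
    using coequalizerD [OF q] A by simp_all
  have qe: "regular_epi C q" using q unfolding regular_epi_def by blast
  define Q where "Q = Cod C q"
  define \<eta> where "\<eta> = q \<cdot> inl A A"
  have \<eta>: "arr \<eta>" "Dom C \<eta> = A" "Cod C \<eta> = Q" unfolding \<eta>_def Q_def using d A by simp_all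
  have q\<eta>: "q \<cdot> inl A A = \<eta>" "q \<cdot> inr A A = \<eta>" using d unfolding \<eta>_def by simp_all
  have re: "regular_epi C \<eta>"
  proof (rule regular_epi_if_extremal [OF \<eta>(1)])
    fix m x assume m: "monic C m" "arr x" "arr m" "Cod C x = Dom C m" "m \<cdot> x = \<eta>"
    have dc: "Dom C x = A" "Cod C m = Q" using m(2-5) \<eta> by auto
    have fill: "\<forall>m. monic C m \<longrightarrow>
        (\<forall>h \<in> hom C (Cod C (inl A A)) (Cod C m).
           \<forall>u \<in> hom C (Dom C (inl A A)) (Dom C m). \<forall>v \<in> hom C (Dom C (inr A A)) (Dom C m).
           m \<cdot> u = h \<cdot> inl A A \<and> m \<cdot> v = h \<cdot> inr A A \<longrightarrow>
           (\<exists>d \<in> hom C (Cod C (inl A A)) (Dom C m). m \<cdot> d = h \<and> d \<cdot> inl A A = u \<and> d \<cdot> inr A A = v))"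
      using jointly_strongly_epic_inl_inr [OF A A] unfolding jointly_strongly_epic_def
      by (elim conjE) assumption
    have "q \<in> hom C (Cod C (inl A A)) (Cod C m)" "x \<in> hom C (Dom C (inl A A)) (Dom C m)"
      "x \<in> hom C (Dom C (inr A A)) (Dom C m)" using d m dc A by (simp_all add: Q_def)
    note h = this
    have "\<exists>d \<in> hom C (Cod C (inl A A)) (Dom C m). m \<cdot> d = q \<and> d \<cdot> inl A A = x \<and> d \<cdot> inr A A = x"
      by (rule fill [rule_format, OF m(1) h]) (use m(5) q\<eta> in simp)
    then obtain t where t: "arr t" "Dom C t = A \<otimes> A" "Cod C t = Dom C m" "m \<cdot> t = q"
      "t \<cdot> inl A A = t \<cdot> inr A A"
      using A by auto
    obtain s where s: "arr s" "Dom C s = Q" "Cod C s = Dom C m" "s \<cdot> q = t"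
      using coequalizer_lift [OF q, of t] t d by (auto simp: Q_def)
    have "(m \<cdot> s) \<cdot> q = Idm C Q \<cdot> q" using s t d m by (simp add: Q_def)
    then have "m \<cdot> s = Idm C Q"
      by - (rule regular_epi_cancel [OF qe], use s m dc d in \<open>auto simp: Q_def\<close>)
    then show "\<exists>s. arr s \<and> Dom C s = Cod C m \<and> Cod C s = Dom C m \<and> m \<cdot> s = Idm C (Cod C m)"
      using s dc by auto
  qed
  have Q: "comm_ob Q"
    by (rule comm_ob_quotient [OF re \<eta>(2,3) _ q\<eta>]) (use d A in \<open>simp add: Q_def\<close>)
  have "\<exists>g. arr g \<and> Dom C g = Q \<and> Cod C g = B \<and> g \<cdot> \<eta> = f"
    if B: "comm_ob B" and f: "arr f" "Dom C f = A" "Cod C f = B" for B f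
  proof -
    let ?s = "f \<cdot> pr1 A A \<oplus> f \<cdot> pr2 A A"
    obtain g where g: "arr g" "Dom C g = Q" "Cod C g = B" "g \<cdot> q = ?s"
      using coequalizer_lift [OF q, of ?s] f B A d by (auto simp: Q_def)
    have "g \<cdot> \<eta> = (g \<cdot> q) \<cdot> inl A A" unfolding \<eta>_def using g(1,2) d A by (simp add: Q_def)
    also have "\<dots> = f" using g(4) f B A by simp
    finally show ?thesis using g by blast
  qed
  moreover have "g = g'" if "arr g" "arr g'" "Dom C g = Q" "Dom C g' = Q" "g \<cdot> \<eta> = g' \<cdot> \<eta>" for g g'
    by (rule regular_epi_cancel [OF re]) (use that \<eta> in simp_all)
  ultimately have "universal_arrow C {Q. comm_ob Q} A \<eta>" using \<eta> Q by (intro universal_arrowI) auto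
  then show thesis using that re by blast
qed

text \<open>The Grothendieck group of the commutative reflection \<open>Q\<close>: the quotient \<open>G\<close> of \<open>Q \<times> Q\<close> by its
  diagonal.  The exchange \<open>\<sigma>\<close> of the factors induces an inverse, as \<open>(x, y) + (y, x)\<close> is diagonal.  A
  morphism \<open>f'\<close> from \<open>Q\<close> to an abelian object extends to \<open>G\<close> by \<open>(x, y) \<mapsto> f'(x) - f'(y)\<close>.\<close>

lemma abelian_reflection:
  assumes A: "A \<in> Obj C"
  obtains \<theta> where "universal_arrow C {B. abel B} A \<theta>"
proof -
  obtain \<eta> where univ: "universal_arrow C {Q. comm_ob Q} A \<eta>" and re: "regular_epi C \<eta>"
    by (rule commutative_reflection [OF A])
  define Q where "Q = Cod C \<eta>"
  have Q: "comm_ob Q" "regular_epi C \<eta>" "arr \<eta>" "Dom C \<eta> = A" "Cod C \<eta> = Q"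
    using universal_arrowD [OF univ] re by (simp_all add: Q_def)
  have O: "Q \<in> Obj C" using Q by simp
  let ?\<Delta> = "\<langle>Idm C Q, Idm C Q\<rangle>" let ?P = "Q \<otimes> Q"
  let ?\<sigma> = "\<langle>pr2 Q Q, pr1 Q Q\<rangle>"
  obtain c where c: "is_coequalizer C ?\<Delta> (zer Q ?P) c"
    using coequalizer_ex [of ?\<Delta> "zer Q ?P"] O by auto
  have d: "arr c" "Dom C c = ?P" using coequalizerD [OF c] O by simp_all
  define G where "G = Cod C c"
  have dG: "Cod C c = G" and GO: "G \<in> Obj C" using d by (auto simp: G_def)
  have c\<Delta>: "c \<cdot> ?\<Delta> = zer Q G" using coequalizerD [OF c] O d dG by simp
  have c\<Delta>': "c \<cdot> \<langle>x, x\<rangle> = zer (Dom C x) G" if "arr x" "Cod C x = Q" for x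
  proof -
    have "c \<cdot> \<langle>x, x\<rangle> = (c \<cdot> ?\<Delta>) \<cdot> x" using that O d by simp
    also have "\<dots> = zer (Dom C x) G" unfolding c\<Delta> using that GO by simp
    finally show ?thesis .
  qed
  have ce: "regular_epi C c" using c unfolding regular_epi_def by blast
  have G: "comm_ob G" using comm_ob_regular_quotient [of ?P c G] ce Q d dG by simp
  obtain i where i: "arr i" "Dom C i = G" "Cod C i = G" "i \<cdot> c = c \<cdot> ?\<sigma>"
    using coequalizer_lift [OF c, of "c \<cdot> ?\<sigma>"] O d dG c\<Delta> by auto
  \<comment> \<open>The sum of an element of \<open>Q \<times> Q\<close> and its exchange lies on the diagonal.\<close>
  have sum: "x \<oplus> ?\<sigma> \<cdot> x = \<langle>pr1 Q Q \<cdot> x \<oplus> pr2 Q Q \<cdot> x, pr1 Q Q \<cdot> x \<oplus> pr2 Q Q \<cdot> x\<rangle>"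
    if "arr x" "Cod C x = ?P" for x
  proof (rule prd_eqI [of _ _ Q Q])
    have cong: "pr1 Q Q \<cdot> (x \<oplus> ?\<sigma> \<cdot> x) = pr1 Q Q \<cdot> x \<oplus> pr1 Q Q \<cdot> (?\<sigma> \<cdot> x)"
      "pr2 Q Q \<cdot> (x \<oplus> ?\<sigma> \<cdot> x) = pr2 Q Q \<cdot> x \<oplus> pr2 Q Q \<cdot> (?\<sigma> \<cdot> x)"
      by (rule comp_add [of _ ?P Q]; use that O Q in simp)+
    then show "pr1 Q Q \<cdot> (x \<oplus> ?\<sigma> \<cdot> x) = pr1 Q Q \<cdot> \<langle>pr1 Q Q \<cdot> x \<oplus> pr2 Q Q \<cdot> x, pr1 Q Q \<cdot> x \<oplus> pr2 Q Q \<cdot> x\<rangle>"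
      using that(1,2) O Q(1) by simp
    have "pr2 Q Q \<cdot> x \<oplus> pr1 Q Q \<cdot> x = pr1 Q Q \<cdot> x \<oplus> pr2 Q Q \<cdot> x"
      by (rule add_commute) (use that O Q in simp_all)
    then show "pr2 Q Q \<cdot> (x \<oplus> ?\<sigma> \<cdot> x) = pr2 Q Q \<cdot> \<langle>pr1 Q Q \<cdot> x \<oplus> pr2 Q Q \<cdot> x, pr1 Q Q \<cdot> x \<oplus> pr2 Q Q \<cdot> x\<rangle>"
      using that(1,2) O Q(1) cong(2) by simp
  qed (use that O Q in simp_all)
  have "(Idm C G \<oplus> i) \<cdot> c = c \<oplus> c \<cdot> ?\<sigma>" using i d dG G O GO by simp
  also have "\<dots> = c \<cdot> (Idm C ?P \<oplus> ?\<sigma>)" using comp_add [of c ?P G "Idm C ?P" ?\<sigma>] d dG G Q O by simp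
  also have "\<dots> = zer ?P G" using sum [of "Idm C ?P"] c\<Delta>' [of "mul Q"] Q O by simp
  also have "\<dots> = zer G G \<cdot> c" using d dG GO by simp
  finally have "Idm C G \<oplus> i = zer G G"
    by - (rule regular_epi_cancel [OF ce], use i d dG G GO in simp_all)
  then have abel: "abel G" unfolding abel_def using G i GO by auto
  let ?\<theta> = "c \<cdot> (inl Q Q \<cdot> \<eta>)"
  have \<theta>: "arr ?\<theta>" "Dom C ?\<theta> = A" "Cod C ?\<theta> = G" using d dG Q O A by simp_all
  have "universal_arrow C {B. abel B} A ?\<theta>"
  proof (rule universal_arrowI)
    fix f assume *: "arr f" "Dom C f = A" "Cod C f \<in> {B. abel B}"
    define B where "B = Cod C f"
    have B: "abel B" and f: "arr f" "Dom C f = A" "Cod C f = B" using * by (simp_all add: B_def)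
    obtain f' where f': "arr f'" "Dom C f' = Q" "Cod C f' = B" "f' \<cdot> \<eta> = f"
      using universal_arrow_lift [OF univ, of f] B f Q by auto
    let ?s = "f' \<cdot> pr1 Q Q \<oplus> \<ominus> (f' \<cdot> pr2 Q Q)"
    have z: "\<ominus> zer Q B = zer Q B"
      using add_neg(1) [of "zer Q B" B] B O Q add_zer(2) [of "\<ominus> zer Q B" Q B] mul_arrow(1) [of B] by simp
    have s: "arr ?s" "Dom C ?s = ?P" "Cod C ?s = B" using f'(1-3) B O by simp_all
    have "?s \<cdot> ?\<Delta> = ?s \<cdot> zer Q ?P" using f'(1-3) B O z mul_arrow(1) [of B] by simp
    then obtain g where g: "arr g" "Dom C g = G" "Cod C g = B" "g \<cdot> c = ?s"
      using coequalizer_lift [OF c s(1)] s d dG by metis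
    have "g \<cdot> ?\<theta> = ((g \<cdot> c) \<cdot> inl Q Q) \<cdot> \<eta>" using g(1-3) d dG O Q by simp
    also have "\<dots> = f" using g(4) f' B O z Q by simp
    finally show "\<exists>g. arr g \<and> Dom C g = Cod C ?\<theta> \<and> Cod C g = Cod C f \<and> g \<cdot> ?\<theta> = f"
      using g f \<theta> by auto
  next
    fix g g' assume *: "arr g" "arr g'" "Dom C g = Cod C ?\<theta>" "Dom C g' = Cod C ?\<theta>"
      "Cod C g = Cod C g'" "Cod C g' \<in> {B. abel B}" "g \<cdot> ?\<theta> = g' \<cdot> ?\<theta>"
    define B where "B = Cod C g'"
    have B: "abel B" and g: "arr g" "arr g'" "Dom C g = G" "Dom C g' = G" "Cod C g = B" "Cod C g' = B"
      using *(1-6) \<theta>(3) by (simp_all add: B_def)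
    have "(g \<cdot> (c \<cdot> inl Q Q)) \<cdot> \<eta> = (g' \<cdot> (c \<cdot> inl Q Q)) \<cdot> \<eta>" using *(7) g d dG O Q by simp
    then have l: "g \<cdot> (c \<cdot> inl Q Q) = g' \<cdot> (c \<cdot> inl Q Q)"
      by - (rule regular_epi_cancel [OF Q(2)], use g d dG O Q in simp_all)
    \<comment> \<open>The class of \<open>(0, x)\<close> is inverse to that of \<open>(x, 0)\<close>, so a morphism on \<open>G\<close> is determined by the latter.\<close>
    have zero: "c \<cdot> inl Q Q \<oplus> c \<cdot> inr Q Q = zer Q G"
    proof -
      have "c \<cdot> (inl Q Q \<oplus> ?\<sigma> \<cdot> inl Q Q) = zer Q G"
        using sum [of "inl Q Q"] O Q c\<Delta>' [of "Idm C Q"] by simp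
      then show ?thesis using comp_add [of c ?P G "inl Q Q" "inr Q Q"] O Q d dG G by simp
    qed
    have z: "h \<cdot> (c \<cdot> inl Q Q) \<oplus> h \<cdot> (c \<cdot> inr Q Q) = zer Q B"
      if "arr h" "Dom C h = G" "Cod C h = B" for h
    proof -
      have "h \<cdot> (c \<cdot> inl Q Q) \<oplus> h \<cdot> (c \<cdot> inr Q Q) = h \<cdot> (c \<cdot> inl Q Q \<oplus> c \<cdot> inr Q Q)"
        using comp_add [of h G B "c \<cdot> inl Q Q" "c \<cdot> inr Q Q"] that B G O d dG by simp
      also have "\<dots> = zer Q B" unfolding zero using that O by simp
      finally show ?thesis .
    qed
    have r: "g \<cdot> (c \<cdot> inr Q Q) = g' \<cdot> (c \<cdot> inr Q Q)"
      by (rule inverse_unique [of "g \<cdot> (c \<cdot> inl Q Q)" _ Q B])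
        (use z [of g] z [of g'] l g B O d dG in simp_all)
    have "g \<cdot> c = g' \<cdot> c" by (rule unital_eqI [of _ _ Q Q]) (use l r g O d dG in simp_all)
    then show "g = g'" by - (rule regular_epi_cancel [OF ce], use g dG in simp_all)
  qed (use \<theta> abel in simp_all)
  then show thesis by (rule that)
qed

section \<open>Cocycles on a kernel pair\<close>

text \<open>For a kernel pair \<open>p, q: R \<rightarrow> A\<close>, an element \<open>r\<close> of \<open>R\<close> is a pair \<open>(p r, q r)\<close> of elements of \<open>A\<close>
  in the same fibre, and the condition reads \<open>d(a, a'') = d(a, a') + d(a', a'')\<close>.\<close>

definition cocycle :: "'m \<Rightarrow> 'm \<Rightarrow> 'm \<Rightarrow> bool" where
  "cocycle p q d \<longleftrightarrow> arr d \<and> Dom C d = Dom C p \<and> abel (Cod C d) \<and>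
     (\<forall>r s t. r \<in> Mor C \<and> arr s \<and> arr t \<and> Dom C r = Dom C s \<and> Dom C t = Dom C s \<and>
        Cod C r = Dom C p \<and> Cod C s = Dom C p \<and> Cod C t = Dom C p \<and>
        p \<cdot> s = q \<cdot> r \<and> p \<cdot> t = p \<cdot> r \<and> q \<cdot> t = q \<cdot> s \<longrightarrow> d \<cdot> t = d \<cdot> r \<oplus> d \<cdot> s)"

lemma cocycleD:
  assumes "cocycle p q d"
  shows "arr d" "Dom C d = Dom C p" "abel (Cod C d)"
  using assms unfolding cocycle_def by simp_all

lemma cocycle_add:
  assumes "cocycle p q d" "arr r" "arr s" "arr t" "Dom C r = Dom C s" "Dom C t = Dom C s"
    "Cod C r = Dom C p" "Cod C s = Dom C p" "Cod C t = Dom C p"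
    "p \<cdot> s = q \<cdot> r" "p \<cdot> t = p \<cdot> r" "q \<cdot> t = q \<cdot> s"
  shows "d \<cdot> t = d \<cdot> r \<oplus> d \<cdot> s"
  using assms unfolding cocycle_def by blast

lemma cocycle_diagonal:
  assumes d: "cocycle p q d" and r: "arr r" "Cod C r = Dom C p" "p \<cdot> r = q \<cdot> r"
  shows "d \<cdot> r = zer (Dom C r) (Cod C d)"
proof -
  note D = cocycleD [OF d]
  have "d \<cdot> r = d \<cdot> r \<oplus> d \<cdot> r" by (rule cocycle_add [OF d]) (use r in simp_all)
  then have "d \<cdot> r \<oplus> d \<cdot> r = d \<cdot> r \<oplus> zer (Dom C r) (Cod C d)" using D r(1,2) by simp
  then show ?thesis by - (rule add_left_cancel [of "d \<cdot> r"], use D r(1,2) in simp_all)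
qed

text \<open>The cocycle condition for the generic composable pair \<open>(u, v)\<close>, with composite \<open>w\<close>, is a single
  equation between morphisms into the abelian reflection of \<open>R\<close>; coequalizing its two sides gives an
  abelian quotient that represents all cocycles.\<close>

lemma universal_cocycle:
  assumes kp: "kernel_pair C f p q"
  obtains d where "cocycle p q d"
    "\<forall>\<delta>. cocycle p q \<delta> \<longrightarrow> (\<exists>\<phi>. \<phi> \<in> hom C (Cod C d) (Cod C \<delta>) \<and> \<phi> \<cdot> d = \<delta>)"
    "\<forall>L \<phi> \<psi>. abel L \<and> \<phi> \<in> hom C (Cod C d) L \<and> \<psi> \<in> hom C (Cod C d) L \<and> \<phi> \<cdot> d = \<psi> \<cdot> d \<longrightarrow> \<phi> = \<psi>"
proof -
  have pb: "is_pullback C f f p q" using kp by (simp add: kernel_pair_def)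
  note P = pullbackD [OF pb]
  define R where "R = Dom C p"
  have R: "Dom C p = R" "Dom C q = R" "R \<in> Obj C" using P by (auto simp: R_def)
  \<comment> \<open>The generic composable pair \<open>u = (a, a')\<close>, \<open>v = (a', a'')\<close>; below, \<open>w = (a, a'')\<close> is its composite.\<close>
  obtain u v where pT: "is_pullback C q p u v" using pullback_ex [of q p] P by auto
  note T = pullbackD [OF pT]
  have "f \<cdot> (p \<cdot> u) = f \<cdot> (q \<cdot> u)" by (rule comp_cong_left) (use P T R in simp_all)
  also have "\<dots> = f \<cdot> (p \<cdot> v)" using T by simp
  also have "\<dots> = f \<cdot> (q \<cdot> v)" by (rule comp_cong_left) (use P T R in simp_all)
  finally obtain w where w: "arr w" "Dom C w = Dom C v" "Cod C w = R" "p \<cdot> w = p \<cdot> u" "q \<cdot> w = q \<cdot> v"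
    using pullback_lift [OF pb, of "p \<cdot> u" "q \<cdot> v"] P(1-8) T(1-8) R by auto
  obtain \<theta> where \<theta>: "universal_arrow C {B. abel B} R \<theta>" by (rule abelian_reflection [OF R(3)])
  define Y where "Y = Cod C \<theta>"
  have Y: "arr \<theta>" "Dom C \<theta> = R" "Cod C \<theta> = Y" "abel Y"
    using universal_arrowD [OF \<theta>] by (simp_all add: Y_def)
  let ?s = "\<theta> \<cdot> u \<oplus> \<theta> \<cdot> v"
  obtain c where c: "is_coequalizer C (\<theta> \<cdot> w) ?s c"
    using coequalizer_ex [of "\<theta> \<cdot> w" ?s] Y T(1-8) w R by auto
  note Q = coequalizerD [OF c]
  define K where "K = Cod C c"
  have D: "Dom C c = Y" "Cod C c = K" using Q(5) Y w by (simp_all add: K_def)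
  have K: "abel K" by (rule abel_quotient [OF Y(4) c D])
  have ce: "regular_epi C c" using c unfolding regular_epi_def by blast
  define d where "d = c \<cdot> \<theta>"
  have d: "arr d" "Dom C d = R" "Cod C d = K" unfolding d_def using Q(3) D Y by simp_all
  have "cocycle p q d"
    unfolding cocycle_def
  proof (intro conjI allI impI; (elim conjE)?)
    fix r s t
    assume *: "arr r" "arr s" "arr t" "Dom C r = Dom C s" "Dom C t = Dom C s"
      "Cod C r = Dom C p" "Cod C s = Dom C p" "Cod C t = Dom C p"
      "p \<cdot> s = q \<cdot> r" "p \<cdot> t = p \<cdot> r" "q \<cdot> t = q \<cdot> s"
    obtain z where z: "arr z" "Dom C z = Dom C r" "Cod C z = Dom C u" "u \<cdot> z = r" "v \<cdot> z = s"
      using pullback_lift [OF pT, of r s] * P R by auto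
    have "p \<cdot> (w \<cdot> z) = p \<cdot> (u \<cdot> z)" "q \<cdot> (w \<cdot> z) = q \<cdot> (v \<cdot> z)"
      by (rule comp_cong_left; use w T(1-8) P(1-8) R z(1-3) in simp)+
    then have t: "w \<cdot> z = t"
      by - (rule pullback_eqI [OF pb], use w(1-3) z *(1-8,10,11) R T(6) in simp_all)
    have "d \<cdot> t = c \<cdot> ((\<theta> \<cdot> w) \<cdot> z)" unfolding t [symmetric] d_def using Q(3) D Y w(1-3) z(1-3) T(6) by simp
    also have "\<dots> = c \<cdot> (?s \<cdot> z)"
      by (rule comp_cong_left) (use Q z(1-3) w T(6) Y D in simp_all)
    also have "\<dots> = c \<cdot> (\<theta> \<cdot> r \<oplus> \<theta> \<cdot> s)" using Y T(1-8) R z(1-3) by (simp add: z(4,5) [symmetric])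
    also have "\<dots> = d \<cdot> r \<oplus> d \<cdot> s"
      unfolding d_def using comp_add [of c Y K "\<theta> \<cdot> r" "\<theta> \<cdot> s"] Q(3) D Y K *(1-8) R by simp
    finally show "d \<cdot> t = d \<cdot> r \<oplus> d \<cdot> s" .
  qed (use d K R in simp_all)
  moreover have "\<exists>\<phi>. \<phi> \<in> hom C (Cod C d) (Cod C \<delta>) \<and> \<phi> \<cdot> d = \<delta>"
    if \<delta>: "cocycle p q \<delta>" for \<delta>
  proof -
    define M where "M = Cod C \<delta>"
    have \<Delta>: "arr \<delta>" "Dom C \<delta> = R" "Cod C \<delta> = M" "abel M"
      using cocycleD [OF \<delta>] R by (simp_all add: M_def)
    obtain g where g: "arr g" "Dom C g = Y" "Cod C g = M" "g \<cdot> \<theta> = \<delta>"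
      using universal_arrow_lift [OF \<theta>, of \<delta>] \<Delta> Y R by auto
    have "g \<cdot> (\<theta> \<cdot> w) = \<delta> \<cdot> w" using g Y w(1-3) by (simp add: g(4) [symmetric])
    also have "\<dots> = \<delta> \<cdot> u \<oplus> \<delta> \<cdot> v"
      by (rule cocycle_add [OF \<delta>]) (use T w R in simp_all)
    also have "\<dots> = g \<cdot> (\<theta> \<cdot> u) \<oplus> g \<cdot> (\<theta> \<cdot> v)" using g(1-3) Y T(1-8) R by (simp add: g(4) [symmetric])
    also have "\<dots> = g \<cdot> ?s"
      using comp_add [of g Y M "\<theta> \<cdot> u" "\<theta> \<cdot> v"] g(1-3) Y T(1-8) R \<Delta>(4) by simp
    finally obtain \<phi> where \<phi>: "arr \<phi>" "Dom C \<phi> = Cod C c" "Cod C \<phi> = Cod C g" "\<phi> \<cdot> c = g"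
      using coequalizer_lift [OF c, of g] g D by auto
    have "\<phi> \<cdot> d = (\<phi> \<cdot> c) \<cdot> \<theta>" unfolding d_def using \<phi>(1,2) Q(3) D Y by simp
    then show ?thesis using \<phi> g d D \<Delta> by auto
  qed
  moreover have "\<phi> = \<psi>" if L: "abel L" "\<phi> \<in> hom C (Cod C d) L" "\<psi> \<in> hom C (Cod C d) L" "\<phi> \<cdot> d = \<psi> \<cdot> d" for L \<phi> \<psi>
  proof -
    have *: "arr \<phi>" "arr \<psi>" "Dom C \<phi> = Cod C d" "Dom C \<psi> = Cod C d"
      "Cod C \<phi> = Cod C \<psi>" "abel (Cod C \<psi>)" "\<phi> \<cdot> d = \<psi> \<cdot> d" using L by simp_all
    have "(\<phi> \<cdot> c) \<cdot> \<theta> = (\<psi> \<cdot> c) \<cdot> \<theta>" using *(7) unfolding d_def using *(1-4) Q(3) D Y d by simp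
    then have "\<phi> \<cdot> c = \<psi> \<cdot> c"
      by - (rule universal_arrow_eqI [OF \<theta>], use *(1-6) Q(3) D Y d in simp_all)
    then show ?thesis by - (rule regular_epi_cancel [OF ce], use *(1-4) D d in simp_all)
  qed
  ultimately show thesis using that by blast
qed

section \<open>Principal extensions\<close>

text \<open>The morphism \<open>m\<close> is an action of \<open>L\<close> on the domain of \<open>f\<close>.  That the projection and \<open>m\<close> form the
  kernel pair says that the action is free, with the fibres of \<open>f\<close> as orbits: \<open>f\<close> is a torsor under \<open>L\<close>.\<close>

definition principal :: "'m \<Rightarrow> 'o \<Rightarrow> 'm \<Rightarrow> bool" where
  "principal f L m \<longleftrightarrow> abel L \<and> m \<cdot> inl (Dom C f) L = Idm C (Dom C f) \<and> kernel_pair C f (pr1 (Dom C f) L) m"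

lemma principalD:
  assumes "principal f L m" "Dom C f = A"
  shows "arr f" "abel L" "A \<in> Obj C" "L \<in> Obj C" "arr m" "Dom C m = A \<otimes> L" "Cod C m = A" "m \<cdot> inl A L = Idm C A"
    "f \<cdot> m = f \<cdot> pr1 A L" "is_pullback C f f (pr1 A L) m"
proof -
  have pb: "is_pullback C f f (pr1 A L) m" using assms unfolding principal_def kernel_pair_def by simp
  note d = pullbackD [OF pb]
  show L: "abel L" "m \<cdot> inl A L = Idm C A" using assms unfolding principal_def by simp_all
  show O: "arr f" "A \<in> Obj C" "L \<in> Obj C" using d assms L(1) by auto
  show "arr m" "Dom C m = A \<otimes> L" "Cod C m = A" "f \<cdot> m = f \<cdot> pr1 A L" using d O assms by simp_all
  show "is_pullback C f f (pr1 A L) m" by (rule pb)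
qed

lemma principal_zer:
  assumes "principal f L m" "arr x" "Cod C x = Dom C f" "Dom C x = X"
  shows "m \<cdot> \<langle>x, zer X L\<rangle> = x"
proof -
  note P = principalD [OF assms(1) refl]
  have "m \<cdot> \<langle>x, zer X L\<rangle> = Idm C (Dom C f) \<cdot> x"
    by (rule binary_left [OF P(5,6,8,3,4)]) (use assms in simp_all)
  then show ?thesis using assms by simp
qed

text \<open>Associativity of the action is automatic: both sides agree on the three factors of
  \<open>(A \<times> L) \<times> L\<close>.\<close>

lemma principal_action:
  assumes "principal f L m" "arr x" "arr l" "arr l'" "Dom C x = Dom C l" "Dom C l' = Dom C l"
    "Cod C x = Dom C f" "Cod C l = L" "Cod C l' = L"
  shows "m \<cdot> \<langle>m \<cdot> \<langle>x, l\<rangle>, l'\<rangle> = m \<cdot> \<langle>x, l \<oplus> l'\<rangle>"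
proof -
  define A where "A = Dom C f"
  note P = principalD [OF assms(1) A_def [symmetric]]
  let ?P = "A \<otimes> L"
  let ?l = "m \<cdot> \<langle>m \<cdot> pr1 ?P L, pr2 ?P L\<rangle>"
  let ?r = "m \<cdot> \<langle>pr1 A L \<cdot> pr1 ?P L, pr2 A L \<cdot> pr1 ?P L \<oplus> pr2 ?P L\<rangle>"
  have "m \<cdot> \<langle>m, zer ?P L\<rangle> = m"
    by (rule principal_zer [OF assms(1)]) (use P in \<open>simp_all add: A_def [symmetric]\<close>)
  then have "?l = ?r" by - (rule unital_eqI [of _ _ ?P L], use P(1-7) in simp_all)
  then have "?l \<cdot> \<langle>\<langle>x, l\<rangle>, l'\<rangle> = ?r \<cdot> \<langle>\<langle>x, l\<rangle>, l'\<rangle>" by simp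
  then show ?thesis using P(1-7) assms(2-) by (simp add: A_def [symmetric])
qed

lemma principal_free:
  assumes "principal f L m" "arr x" "arr l" "arr l'" "Dom C x = Dom C l" "Dom C l' = Dom C l"
    "Cod C x = Dom C f" "Cod C l = L" "Cod C l' = L" "m \<cdot> \<langle>x, l\<rangle> = m \<cdot> \<langle>x, l'\<rangle>"
  shows "l = l'"
proof -
  define A where "A = Dom C f"
  note P = principalD [OF assms(1) A_def [symmetric]]
  have "\<langle>x, l\<rangle> = \<langle>x, l'\<rangle>"
    by (rule pullback_eqI [OF P(10)]) (use P(1-7) assms(2-) in \<open>simp_all add: A_def [symmetric]\<close>)
  then show ?thesis by (rule pair_cong_eq) (use assms(2-9) in simp_all)
qed

lemma principal_difference:
  assumes "principal f L m" "arr x" "arr y" "Dom C x = Dom C y" "Cod C x = Dom C f" "Cod C y = Dom C f"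
    "f \<cdot> x = f \<cdot> y"
  obtains l where "arr l" "Dom C l = Dom C y" "Cod C l = L" "m \<cdot> \<langle>x, l\<rangle> = y"
proof -
  define A where "A = Dom C f"
  note P = principalD [OF assms(1) A_def [symmetric]]
  obtain h where h: "arr h" "Dom C h = Dom C x" "Cod C h = A \<otimes> L" "pr1 A L \<cdot> h = x" "m \<cdot> h = y"
    using pullback_lift [OF P(10), of x y] assms P(1-7) by auto
  have "\<langle>pr1 A L \<cdot> h, pr2 A L \<cdot> h\<rangle> = h"
    by (rule pair_eta) (use h(1-3) P(3,4) in simp_all)
  then have "m \<cdot> \<langle>x, pr2 A L \<cdot> h\<rangle> = y" using h by simp
  then show thesis using h(1-3) P(3,4) assms(4) by (intro that [of "pr2 A L \<cdot> h"]) simp_all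
qed

section \<open>The principal extension of a cocycle\<close>

text \<open>Exactness presents the relation as a kernel pair of some morphism, which factors through the
  coequalizer; so the relation is the kernel pair of its own coequalizer.\<close>

lemma effective_relation:
  assumes "equivalence_relation C X r s"
  obtains c where "is_coequalizer C r s c" "kernel_pair C c r s"
proof -
  obtain f where f: "kernel_pair C f r s" using exact assms unfolding Barr_exact_def by blast
  then have pb: "is_pullback C f f r s" by (simp add: kernel_pair_def)
  note d = pullbackD [OF pb]
  obtain c where c: "is_coequalizer C r s c" using coequalizer_ex [of r s] d by auto
  note e = coequalizerD [OF c]
  obtain h where h: "arr h" "Dom C h = Cod C c" "Cod C h = Cod C f" "h \<cdot> c = f"
    using coequalizer_lift [OF c, of f] d e by auto
  have "is_pullback C c c r s"
  proof (rule pullbackI)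
    fix a b assume ab: "arr a" "arr b" "Dom C a = Dom C b" "Cod C a = Dom C c" "Cod C b = Dom C c"
      "c \<cdot> a = c \<cdot> b"
    have "h \<cdot> (c \<cdot> a) = h \<cdot> (c \<cdot> b)" using ab(6) by simp
    then have "f \<cdot> a = f \<cdot> b" using h(1-3) e(3) ab(1-5) by (simp add: h(4) [symmetric])
    then obtain k where "arr k" "Dom C k = Dom C a" "Cod C k = Dom C r" "r \<cdot> k = a" "s \<cdot> k = b"
      using pullback_lift [OF pb, of a b] ab d e by metis
    then show "\<exists>h. arr h \<and> Dom C h = Dom C a \<and> Cod C h = Dom C r \<and> r \<cdot> h = a \<and> s \<cdot> h = b" by blast
  next
    fix a b assume "arr a" "arr b" "Dom C a = Dom C b" "Cod C a = Dom C r" "Cod C b = Dom C r"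
      "r \<cdot> a = r \<cdot> b" "s \<cdot> a = s \<cdot> b"
    then show "a = b" by (rule pullback_eqI [OF pb])
  qed (use d e in auto)
  then show thesis using that c by (simp add: kernel_pair_def)
qed

text \<open>The relation \<open>(a, k + d(a, a')) \<sim> (a', k)\<close> on \<open>A \<times> K\<close>, parametrised by \<open>((a, a'), k)\<close> in
  \<open>R \<times> K\<close>.  Reflexivity uses \<open>d(a, a) = 0\<close>, symmetry \<open>d(a', a) = - d(a, a')\<close> and transitivity the
  cocycle identity itself.\<close>

lemma cocycle_relation:
  assumes kp: "kernel_pair C f p q" and A: "Dom C f = A" and d: "cocycle p q d" and R: "Dom C p = R"
    and K: "Cod C d = K"
  shows "equivalence_relation C (A \<otimes> K) \<langle>p \<cdot> pr1 R K, pr2 R K \<oplus> d \<cdot> pr1 R K\<rangle> \<langle>q \<cdot> pr1 R K, pr2 R K\<rangle>"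
proof -
  have pb: "is_pullback C f f p q" using kp by (simp add: kernel_pair_def)
  note P' = pullbackD [OF pb] note D' = cocycleD [OF d]
  have P: "arr p" "arr q" "Dom C p = R" "Dom C q = R" "Cod C p = A" "Cod C q = A" "arr f" "Dom C f = A"
    and D: "arr d" "Dom C d = R" "Cod C d = K" "abel K" and O: "A \<in> Obj C" "R \<in> Obj C" "K \<in> Obj C"
    using P' D' A R K by auto
  let ?e = "\<langle>p \<cdot> pr1 R K, pr2 R K \<oplus> d \<cdot> pr1 R K\<rangle>" and ?e' = "\<langle>q \<cdot> pr1 R K, pr2 R K\<rangle>"
  have E: "?e \<in> hom C (R \<otimes> K) (A \<otimes> K)" "?e' \<in> hom C (R \<otimes> K) (A \<otimes> K)" using P D O by simp_all
  have ev: "?e \<cdot> \<langle>r, k\<rangle> = \<langle>p \<cdot> r, k \<oplus> d \<cdot> r\<rangle>" "?e' \<cdot> \<langle>r, k\<rangle> = \<langle>q \<cdot> r, k\<rangle>"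
    if "arr r" "arr k" "Dom C r = Dom C k" "Cod C r = R" "Cod C k = K" for r k
    using that P D O by simp_all
  have split: "\<exists>r k. x = \<langle>r, k\<rangle> \<and> arr r \<and> arr k \<and> Dom C r = W \<and> Dom C k = W \<and> Cod C r = R \<and> Cod C k = K"
    if "x \<in> hom C W (R \<otimes> K)" for x W
    using that O by (intro exI [of _ "pr1 R K \<cdot> x"] exI [of _ "pr2 R K \<cdot> x"]) simp
  obtain \<Delta> where \<Delta>: "arr \<Delta>" "Dom C \<Delta> = A" "Cod C \<Delta> = R" "p \<cdot> \<Delta> = Idm C A" "q \<cdot> \<Delta> = Idm C A"
    using pullback_lift [OF pb, of "Idm C A" "Idm C A"] P O by auto
  obtain \<sigma> where \<sigma>: "arr \<sigma>" "Dom C \<sigma> = R" "Cod C \<sigma> = R" "p \<cdot> \<sigma> = q" "q \<cdot> \<sigma> = p"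
    using pullback_lift [OF pb, of q p] P P'(9) O by auto
  have mono: "a = b" if ab: "a \<in> hom C W (R \<otimes> K)" "b \<in> hom C W (R \<otimes> K)" and eq: "?e \<cdot> a = ?e \<cdot> b" "?e' \<cdot> a = ?e' \<cdot> b" for W a b
  proof -
    obtain r k where a: "a = \<langle>r, k\<rangle>" "arr r" "arr k" "Dom C r = W" "Dom C k = W" "Cod C r = R" "Cod C k = K"
      using split [OF ab(1)] by blast
    obtain s l where b: "b = \<langle>s, l\<rangle>" "arr s" "arr l" "Dom C s = W" "Dom C l = W" "Cod C s = R" "Cod C l = K"
      using split [OF ab(2)] by blast
    have 1: "\<langle>p \<cdot> r, k \<oplus> d \<cdot> r\<rangle> = \<langle>p \<cdot> s, l \<oplus> d \<cdot> s\<rangle>" "\<langle>q \<cdot> r, k\<rangle> = \<langle>q \<cdot> s, l\<rangle>"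
      using eq ev [of r k] ev [of s l] a b by simp_all
    have "p \<cdot> r = p \<cdot> s" by (rule pair_cong_eq [OF 1(1)]) (use a b P D O in simp_all)
    moreover have "q \<cdot> r = q \<cdot> s" by (rule pair_cong_eq [OF 1(2)]) (use a b P D O in simp_all)
    ultimately have "r = s" by - (rule pullback_eqI [OF pb], use a b P in simp_all)
    moreover have "k = l" by (rule pair_cong_eq [OF 1(2)]) (use a b P D O in simp_all)
    ultimately show ?thesis using a b by simp
  qed
  let ?d = "\<langle>\<Delta> \<cdot> pr1 A K, pr2 A K\<rangle>"
  have "d \<cdot> \<Delta> = zer A K" using cocycle_diagonal [OF d, of \<Delta>] \<Delta> P D by simp
  then have "d \<cdot> (\<Delta> \<cdot> pr1 A K) = zer (A \<otimes> K) K"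
    using comp_assoc_arrow [of "pr1 A K" \<Delta> d] \<Delta> D O by simp
  moreover have "p \<cdot> (\<Delta> \<cdot> pr1 A K) = pr1 A K" "q \<cdot> (\<Delta> \<cdot> pr1 A K) = pr1 A K"
    using comp_assoc_arrow [of "pr1 A K" \<Delta> p] comp_assoc_arrow [of "pr1 A K" \<Delta> q] \<Delta> P O by simp_all
  ultimately have refl: "?d \<in> hom C (A \<otimes> K) (R \<otimes> K)" "?e \<cdot> ?d = Idm C (A \<otimes> K)" "?e' \<cdot> ?d = Idm C (A \<otimes> K)"
    using \<Delta>(1-3) P D O by simp_all
  let ?s = "\<langle>\<sigma> \<cdot> pr1 R K, pr2 R K \<oplus> d \<cdot> pr1 R K\<rangle>"
  have "d \<cdot> (\<Delta> \<cdot> p) = d \<oplus> d \<cdot> \<sigma>"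
  proof -
    have "p \<cdot> (\<Delta> \<cdot> p) = p" "q \<cdot> (\<Delta> \<cdot> p) = p"
      using comp_assoc_arrow [of p \<Delta> p] comp_assoc_arrow [of p \<Delta> q] \<Delta> P O by simp_all
    then have "d \<cdot> (\<Delta> \<cdot> p) = d \<cdot> Idm C R \<oplus> d \<cdot> \<sigma>"
      by - (rule cocycle_add [OF d], use \<Delta> \<sigma> P D O in simp_all)
    then show ?thesis using D by simp
  qed
  moreover have "d \<cdot> (\<Delta> \<cdot> p) = zer R K" using \<open>d \<cdot> \<Delta> = zer A K\<close> comp_assoc_arrow [of p \<Delta> d] \<Delta> P D O by simp
  ultimately have "(d \<oplus> d \<cdot> \<sigma>) \<cdot> pr1 R K = zer R K \<cdot> pr1 R K" by simp
  then have inv: "d \<cdot> pr1 R K \<oplus> d \<cdot> (\<sigma> \<cdot> pr1 R K) = zer (R \<otimes> K) K" using \<sigma>(1-3) D O by simp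
  have "p \<cdot> (\<sigma> \<cdot> pr1 R K) = q \<cdot> pr1 R K" "q \<cdot> (\<sigma> \<cdot> pr1 R K) = p \<cdot> pr1 R K"
    using comp_assoc_arrow [of "pr1 R K" \<sigma> p] comp_assoc_arrow [of "pr1 R K" \<sigma> q] \<sigma> P O by simp_all
  moreover have "pr2 R K \<oplus> d \<cdot> pr1 R K \<oplus> d \<cdot> (\<sigma> \<cdot> pr1 R K) = pr2 R K"
    using add_assoc [of "pr2 R K" "d \<cdot> pr1 R K" "d \<cdot> (\<sigma> \<cdot> pr1 R K)"] inv \<sigma>(1-3) D O by simp
  ultimately have sym: "?s \<in> hom C (R \<otimes> K) (R \<otimes> K)" "?e \<cdot> ?s = ?e'" "?e' \<cdot> ?s = ?e"
    using \<sigma>(1-3) P D O by simp_all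
  have trans: "\<exists>t \<in> hom C (Dom C u) (R \<otimes> K). ?e \<cdot> t = ?e \<cdot> u \<and> ?e' \<cdot> t = ?e' \<cdot> v" if pb': "is_pullback C ?e' ?e u v" for u v
  proof -
    note U = pullbackD [OF pb']
    define W where "W = Dom C v"
    have uv: "u \<in> hom C W (R \<otimes> K)" "v \<in> hom C W (R \<otimes> K)" using U E by (auto simp: W_def)
    obtain r k where a: "u = \<langle>r, k\<rangle>" "arr r" "arr k" "Dom C r = W" "Dom C k = W" "Cod C r = R" "Cod C k = K"
      using split [OF uv(1)] by blast
    obtain s l where b: "v = \<langle>s, l\<rangle>" "arr s" "arr l" "Dom C s = W" "Dom C l = W" "Cod C s = R" "Cod C l = K"
      using split [OF uv(2)] by blast
    have 1: "\<langle>q \<cdot> r, k\<rangle> = \<langle>p \<cdot> s, l \<oplus> d \<cdot> s\<rangle>" using U(9) ev [of r k] ev [of s l] a b by simp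
    have qp: "q \<cdot> r = p \<cdot> s" by (rule pair_cong_eq [OF 1]) (use a b P D O in simp_all)
    have kl: "k = l \<oplus> d \<cdot> s" by (rule pair_cong_eq [OF 1]) (use a b P D O in simp_all)
    have "f \<cdot> (p \<cdot> r) = f \<cdot> (q \<cdot> r)" by (rule comp_cong_left) (use P P'(9) a in simp_all)
    also have "\<dots> = f \<cdot> (q \<cdot> s)" unfolding qp by (rule comp_cong_left) (use P P'(9) b in simp_all)
    finally obtain t where t: "arr t" "Dom C t = W" "Cod C t = R" "p \<cdot> t = p \<cdot> r" "q \<cdot> t = q \<cdot> s"
      using pullback_lift [OF pb, of "p \<cdot> r" "q \<cdot> s"] P a b by auto
    have "d \<cdot> t = d \<cdot> r \<oplus> d \<cdot> s" by (rule cocycle_add [OF d]) (use t a b P qp in simp_all)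
    also have "\<dots> = d \<cdot> s \<oplus> d \<cdot> r" by (rule add_commute) (use a b D in simp_all)
    finally have "l \<oplus> d \<cdot> t = k \<oplus> d \<cdot> r" unfolding kl using add_assoc [of l "d \<cdot> s" "d \<cdot> r"] a b D by simp
    then have "?e \<cdot> \<langle>t, l\<rangle> = ?e \<cdot> u" "?e' \<cdot> \<langle>t, l\<rangle> = ?e' \<cdot> v"
      using ev [of t l] ev [of r k] ev [of s l] t a b by simp_all
    moreover have "\<langle>t, l\<rangle> \<in> hom C (Dom C u) (R \<otimes> K)" using t a b O Dom_Obj [OF a(2)] by simp
    ultimately show ?thesis by blast
  qed
  show ?thesis unfolding equivalence_relation_def
    by (rule exI [of _ "R \<otimes> K"]) (use E mono refl sym trans in blast)
qed

text \<open>The quotient \<open>c: A \<times> K \<rightarrow> X\<close> of the relation of a cocycle.  The action \<open>m\<close> is translation in the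
  second component, which descends along \<open>c\<close> by \<open>cooperator_descend\<close>.  Write \<open>[a, k]\<close> for classes.
  The action is free, since \<open>[a, k + l] = [a, k + l']\<close> forces \<open>l = l' + d(a, a) = l'\<close>.  It is transitive
  on fibres, since for \<open>f(a) = f(a')\<close> the element \<open>- k + k' + d(a, a')\<close> carries \<open>[a, k]\<close> to
  \<open>[a, k' + d(a, a')] = [a', k']\<close>.  Representatives exist only locally; freeness lets the conclusions
  descend.\<close>

lemma cocycle_extension:
  assumes f: "regular_epi C f" and kp: "kernel_pair C f p q" and A: "Dom C f = A" and d: "cocycle p q d"
    and R: "Dom C p = R" and K: "Cod C d = K"
  obtains g c m where "arr g" "arr c" "Dom C g = Cod C c" "Dom C c = A \<otimes> K" "Cod C g = Cod C f"
    "is_coequalizer C \<langle>p \<cdot> pr1 R K, pr2 R K \<oplus> d \<cdot> pr1 R K\<rangle> \<langle>q \<cdot> pr1 R K, pr2 R K\<rangle> c"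
    "g \<cdot> c = f \<cdot> pr1 A K" "regular_epi C g" "principal g K m"
    "m \<cdot> inr (Cod C c) K = c \<cdot> inr A K"
    "m \<cdot> \<langle>(c \<cdot> inl A K) \<cdot> pr1 A K, pr2 A K\<rangle> = c"
proof -
  have pb: "is_pullback C f f p q" using kp by (simp add: kernel_pair_def)
  note P' = pullbackD [OF pb] note D' = cocycleD [OF d]
  have P: "arr p" "arr q" "Dom C p = R" "Dom C q = R" "Cod C p = A" "Cod C q = A" "arr f" "Dom C f = A"
    and D: "arr d" "Dom C d = R" "Cod C d = K" "abel K" and O: "A \<in> Obj C" "R \<in> Obj C" "K \<in> Obj C"
    using P' D' A R K by auto
  let ?e = "\<langle>p \<cdot> pr1 R K, pr2 R K \<oplus> d \<cdot> pr1 R K\<rangle>" and ?e' = "\<langle>q \<cdot> pr1 R K, pr2 R K\<rangle>"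
  have E: "?e \<in> hom C (R \<otimes> K) (A \<otimes> K)" "?e' \<in> hom C (R \<otimes> K) (A \<otimes> K)" using P D O by simp_all
  obtain c where c: "is_coequalizer C ?e ?e' c" and ckp: "kernel_pair C c ?e ?e'"
    by (rule effective_relation [OF cocycle_relation [OF kp A d R K]])
  have cpb: "is_pullback C c c ?e ?e'" using ckp by (simp add: kernel_pair_def)
  have ce: "regular_epi C c" using c unfolding regular_epi_def by blast
  note Q = coequalizerD [OF c]
  define X where "X = Cod C c"
  have X: "arr c" "Dom C c = A \<otimes> K" "Cod C c = X" "X \<in> Obj C" using Q E by (auto simp: X_def)
  define B where "B = Cod C f"
  have B: "Cod C f = B" "B \<in> Obj C" using P by (auto simp: B_def)
  have "f \<cdot> (p \<cdot> pr1 R K) = f \<cdot> (q \<cdot> pr1 R K)" by (rule comp_cong_left) (use P P'(9) O in simp_all)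
  then have "(f \<cdot> pr1 A K) \<cdot> ?e = (f \<cdot> pr1 A K) \<cdot> ?e'" using P D O by simp
  then obtain g where g: "arr g" "Dom C g = X" "Cod C g = B" "g \<cdot> c = f \<cdot> pr1 A K"
    using coequalizer_lift [OF c, of "f \<cdot> pr1 A K"] P X B O by auto
  have gc: "g \<cdot> (c \<cdot> x) = f \<cdot> (pr1 A K \<cdot> x)" if "arr x" "Cod C x = A \<otimes> K" for x
    by (rule comp_cong_left) (use that g X P O in simp_all)
  have "g \<cdot> (c \<cdot> inl A K) = f" using gc [of "inl A K"] P O by simp
  then have greg: "regular_epi C g"
    using regular_epi_right_cancel [of g "c \<cdot> inl A K"] f g X O by simp
  let ?j = "c \<cdot> inr A K"
  let ?\<phi> = "c \<cdot> \<langle>pr1 A K \<cdot> pr1 (A \<otimes> K) K, pr2 A K \<cdot> pr1 (A \<otimes> K) K \<oplus> pr2 (A \<otimes> K) K\<rangle>"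
  obtain m where m: "arr m" "Dom C m = X \<otimes> K" "Cod C m = X" "m \<cdot> inl X K = Idm C X" "m \<cdot> inr X K = ?j"
    and m': "m \<cdot> \<langle>c \<cdot> pr1 (A \<otimes> K) K, pr2 (A \<otimes> K) K\<rangle> = ?\<phi>"
    by (rule cooperator_descend [OF ce X(2,3), of "Idm C X" ?j K ?\<phi>]) (use X D O in simp_all)
  \<comment> \<open>In terms of classes, \<open>[a, k] + l = [a, k + l]\<close>.\<close>
  have mc: "m \<cdot> \<langle>c \<cdot> x, k\<rangle> = c \<cdot> \<langle>pr1 A K \<cdot> x, pr2 A K \<cdot> x \<oplus> k\<rangle>"
    if "arr x" "arr k" "Dom C x = Dom C k" "Cod C x = A \<otimes> K" "Cod C k = K" for x k
  proof -
    have "(m \<cdot> \<langle>c \<cdot> pr1 (A \<otimes> K) K, pr2 (A \<otimes> K) K\<rangle>) \<cdot> \<langle>x, k\<rangle> = ?\<phi> \<cdot> \<langle>x, k\<rangle>" using m' by simp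
    then show ?thesis using that m(1-3) X D O by simp
  qed
  have gm: "g \<cdot> m = g \<cdot> pr1 X K"
  proof (rule unital_eqI [of _ _ X K])
    have "g \<cdot> (m \<cdot> inl X K) = g" "g \<cdot> (m \<cdot> inr X K) = zer K B"
      unfolding m(4,5) using gc [of "inr A K"] g P O B by simp_all
    then show "(g \<cdot> m) \<cdot> inl X K = (g \<cdot> pr1 X K) \<cdot> inl X K" "(g \<cdot> m) \<cdot> inr X K = (g \<cdot> pr1 X K) \<cdot> inr X K"
      using g m(1-3) X O by simp_all
  qed (use g m X O in simp_all)
  have mono: "a = b" if ab: "arr a" "arr b" "Dom C a = Dom C b" "Cod C a = X \<otimes> K" "Cod C b = X \<otimes> K"
    "pr1 X K \<cdot> a = pr1 X K \<cdot> b" "m \<cdot> a = m \<cdot> b" for a b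
  proof -
    obtain w y where w: "regular_epi C w" "arr w" "Cod C w = Dom C b" "arr y" "Dom C y = Dom C w"
      "Cod C y = A \<otimes> K" "c \<cdot> y = (pr1 X K \<cdot> b) \<cdot> w"
      using local_lift [OF ce, of "pr1 X K \<cdot> b"] ab X O by auto
    let ?a = "pr2 X K \<cdot> (a \<cdot> w)" and ?b = "pr2 X K \<cdot> (b \<cdot> w)"
    let ?y1 = "pr1 A K \<cdot> y" and ?y2 = "pr2 A K \<cdot> y"
    have "(pr1 X K \<cdot> a) \<cdot> w = (pr1 X K \<cdot> b) \<cdot> w" using ab(6) by simp
    then have cy: "c \<cdot> y = pr1 X K \<cdot> (a \<cdot> w)" "c \<cdot> y = pr1 X K \<cdot> (b \<cdot> w)"
      using w ab(1-5) X O by simp_all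
    have pa: "\<langle>c \<cdot> y, ?a\<rangle> = a \<cdot> w" unfolding cy(1) by (rule pair_eta) (use ab w(1-6) X O in simp_all)
    have pb: "\<langle>c \<cdot> y, ?b\<rangle> = b \<cdot> w" unfolding cy(2) by (rule pair_eta) (use ab w(1-6) X O in simp_all)
    have "m \<cdot> (a \<cdot> w) = m \<cdot> (b \<cdot> w)" by (rule comp_cong_left) (use ab w(1-6) m in simp_all)
    then have "m \<cdot> \<langle>c \<cdot> y, ?a\<rangle> = m \<cdot> \<langle>c \<cdot> y, ?b\<rangle>" unfolding pa pb .
    then have eq: "c \<cdot> \<langle>?y1, ?y2 \<oplus> ?a\<rangle> = c \<cdot> \<langle>?y1, ?y2 \<oplus> ?b\<rangle>"
      using mc [of y ?a] mc [of y ?b] ab(1-5) w(1-6) X O by simp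
    obtain z where z: "arr z" "Dom C z = Dom C w" "Cod C z = R \<otimes> K" "?e \<cdot> z = \<langle>?y1, ?y2 \<oplus> ?a\<rangle>"
      "?e' \<cdot> z = \<langle>?y1, ?y2 \<oplus> ?b\<rangle>"
      using pullback_lift [OF cpb _ _ _ _ _ eq] ab(1-5) w(1-6) X O D E by auto
    let ?r = "pr1 R K \<cdot> z" and ?k = "pr2 R K \<cdot> z"
    have 1: "\<langle>p \<cdot> ?r, ?k \<oplus> d \<cdot> ?r\<rangle> = \<langle>?y1, ?y2 \<oplus> ?a\<rangle>" "\<langle>q \<cdot> ?r, ?k\<rangle> = \<langle>?y1, ?y2 \<oplus> ?b\<rangle>"
      using z P D O by simp_all
    have "p \<cdot> ?r = ?y1" by (rule pair_cong_eq [OF 1(1)]) (use z(1-3) ab(1-5) w(1-6) P D O X in simp_all)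
    moreover have "q \<cdot> ?r = ?y1" by (rule pair_cong_eq [OF 1(2)]) (use z(1-3) ab(1-5) w(1-6) P D O X in simp_all)
    \<comment> \<open>The two related representatives lie over the same \<open>a\<close>, where the cocycle vanishes.\<close>
    ultimately have "d \<cdot> ?r = zer (Dom C w) K"
      using cocycle_diagonal [OF d, of ?r] z(1-3) P D O by simp
    moreover have "?k \<oplus> d \<cdot> ?r = ?y2 \<oplus> ?a"
      by (rule pair_cong_eq [OF 1(1)]) (use z(1-3) ab(1-5) w(1-6) P D O X in simp_all)
    moreover have "?k = ?y2 \<oplus> ?b"
      by (rule pair_cong_eq [OF 1(2)]) (use z(1-3) ab(1-5) w(1-6) P D O X in simp_all)
    moreover have "?k \<oplus> zer (Dom C w) K = ?k" using z(1-3) D O by simp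
    ultimately have "?y2 \<oplus> ?a = ?y2 \<oplus> ?b" by metis
    then have "?a = ?b" by - (rule add_left_cancel [of ?y2], use ab(1-5) w(1-6) D O X in simp_all)
    then have "\<langle>c \<cdot> y, ?a\<rangle> = \<langle>c \<cdot> y, ?b\<rangle>" by (simp only:)
    then have "a \<cdot> w = b \<cdot> w" unfolding pa pb .
    then show ?thesis by - (rule regular_epi_cancel [OF w(1)], use ab(1-5) w(1-6) in simp_all)
  qed
  have lift: "\<exists>h. arr h \<and> Dom C h = Dom C x \<and> Cod C h = X \<otimes> K \<and> pr1 X K \<cdot> h = x \<and> m \<cdot> h = y"
    if xy: "arr x" "arr y" "Dom C x = Dom C y" "Cod C x = X" "Cod C y = X" "g \<cdot> x = g \<cdot> y" for x y
  proof -
    obtain w x' where w: "regular_epi C w" "arr w" "Cod C w = Dom C y" "arr x'" "Dom C x' = Dom C w"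
      "Cod C x' = A \<otimes> K" "c \<cdot> x' = x \<cdot> w"
      using local_lift [OF ce, of x] xy X by auto
    obtain v y' where v: "regular_epi C v" "arr v" "Cod C v = Dom C w" "arr y'" "Dom C y' = Dom C v"
      "Cod C y' = A \<otimes> K" "c \<cdot> y' = (y \<cdot> w) \<cdot> v"
      using local_lift [OF ce, of "y \<cdot> w"] xy w(1-6) X by auto
    let ?x = "x' \<cdot> v"
    let ?a = "pr1 A K \<cdot> ?x" and ?k = "pr2 A K \<cdot> ?x" and ?a' = "pr1 A K \<cdot> y'" and ?k' = "pr2 A K \<cdot> y'"
    have cx: "c \<cdot> ?x = (x \<cdot> w) \<cdot> v"
      using w(1-6) v(1-3) X by (simp add: w(7) [symmetric])
    have "f \<cdot> ?a = g \<cdot> (c \<cdot> ?x)" using gc [of ?x] w(1-6) v(1-6) by simp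
    also have "\<dots> = (g \<cdot> x) \<cdot> (w \<cdot> v)" unfolding cx using g(1-3) w(1-6) v(1-6) xy(1-5) by simp
    also have "\<dots> = g \<cdot> (c \<cdot> y')" unfolding v(7) xy(6) using g(1-3) w(1-6) v(1-6) xy(1-5) by simp
    also have "\<dots> = f \<cdot> ?a'" using gc [of y'] v(1-6) by simp
    finally obtain r where r: "arr r" "Dom C r = Dom C v" "Cod C r = R" "p \<cdot> r = ?a" "q \<cdot> r = ?a'"
      using pullback_lift [OF pb, of ?a ?a'] w(1-6) v(1-6) P O by auto
    \<comment> \<open>The difference of \<open>[a, k]\<close> and \<open>[a', k'] = [a, k' + d(a, a')]\<close>.\<close>
    let ?l = "\<ominus> ?k \<oplus> (?k' \<oplus> d \<cdot> r)"
    have ty: "arr ?k" "Dom C ?k = Dom C v" "Cod C ?k = K" "arr ?k'" "Dom C ?k' = Dom C v" "Cod C ?k' = K"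
      "d \<cdot> r \<in> Mor C" "Dom C (d \<cdot> r) = Dom C v" "Cod C (d \<cdot> r) = K"
      using w(1-6) v(1-6) r(1-3) D O by simp_all
    have "?k \<oplus> ?l = ?k' \<oplus> d \<cdot> r"
      using add_assoc [of ?k "\<ominus> ?k" "?k' \<oplus> d \<cdot> r"] ty D(4) by simp
    then have "m \<cdot> \<langle>c \<cdot> ?x, ?l\<rangle> = c \<cdot> \<langle>p \<cdot> r, ?k' \<oplus> d \<cdot> r\<rangle>"
      using mc [of ?x ?l] ty D(4) w(1-6) v(1-6) r(4) by simp
    also have "\<dots> = c \<cdot> (?e \<cdot> \<langle>r, ?k'\<rangle>)" using r(1-3) ty P D O by simp
    also have "\<dots> = c \<cdot> (?e' \<cdot> \<langle>r, ?k'\<rangle>)"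
      by (rule comp_cong_left) (use Q(7) E X r(1-3) ty O in simp_all)
    also have "\<dots> = c \<cdot> \<langle>?a', ?k'\<rangle>" using r ty P D O by simp
    also have "\<dots> = c \<cdot> y'" using v(4-6) O by simp
    finally have z2: "m \<cdot> \<langle>c \<cdot> ?x, ?l\<rangle> = (y \<cdot> w) \<cdot> v" using v(7) by simp
    have z1: "pr1 X K \<cdot> \<langle>c \<cdot> ?x, ?l\<rangle> = (x \<cdot> w) \<cdot> v" unfolding cx [symmetric]
      by (rule pr_pair) (use ty D(4) X w(1-6) v(1-6) in simp_all)
    obtain z where z: "arr z" "Dom C z = Cod C v" "Cod C z = Dom C m" "pr1 X K \<cdot> z = x \<cdot> w" "m \<cdot> z = y \<cdot> w"
    proof (rule mono_pair_descend [OF v(1) _ m(1) _ mono _ _ _ _ _ _ _ z1 z2])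
    qed (use ty D(4) m X O xy(1-5) w(1-6) v(1-6) in simp_all)
    obtain h where "arr h" "Dom C h = Cod C w" "Cod C h = Dom C m" "pr1 X K \<cdot> h = x" "m \<cdot> h = y"
    proof (rule mono_pair_descend [OF w(1) _ m(1) _ mono _ _ _ _ _ _ _ z(4,5)])
    qed (use z(1-3) m X O xy(1-5) w(1-6) v(1-6) in simp_all)
    then show ?thesis using w m xy by auto
  qed
  have "is_pullback C g g (pr1 X K) m"
    by (rule pullbackI) (use g m X O gm lift mono in simp_all)
  then have "principal g K m" unfolding principal_def kernel_pair_def using g m D by simp
  moreover have "m \<cdot> \<langle>(c \<cdot> inl A K) \<cdot> pr1 A K, pr2 A K\<rangle> = c"
    using mc [of "inl A K \<cdot> pr1 A K" "pr2 A K"] X D O by simp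
  ultimately show thesis using that [of g c m] g X B c greg m by simp
qed

text \<open>Universality of \<open>h: f \<rightarrow> g\<close> over the identity of the common codomain, tested against squares
  \<open>(t, v)\<close> into a principal extension \<open>g'\<close> that may lie over another object.\<close>

definition principal_universal :: "'m \<Rightarrow> 'm \<Rightarrow> 'm \<Rightarrow> bool" where
  "principal_universal f g h \<longleftrightarrow>
     (\<forall>g' t v L n. principal g' L n \<and> t \<in> hom C (Dom C f) (Dom C g') \<and>
        v \<in> hom C (Cod C f) (Cod C g') \<and> g' \<cdot> t = v \<cdot> f \<longrightarrow>
        (\<exists>!s. s \<in> hom C (Dom C g) (Dom C g') \<and> s \<cdot> h = t \<and> g' \<cdot> s = v \<cdot> g))"

text \<open>Take the extension of the universal cocycle \<open>d\<close> and \<open>h(a) = [a, 0]\<close>, so that \<open>h(a') = h(a) + d(a, a')\<close>.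
  Existence: the differences \<open>\<delta>(a, a')\<close> of \<open>t\<close> form a cocycle because the group of \<open>g'\<close> acts freely,
  \<open>\<delta> = \<phi> d\<close>, and \<open>(a, k) \<mapsto> t(a) + \<phi>(k)\<close> respects the relation.  Uniqueness: any \<open>s\<close> over \<open>v\<close> is
  equivariant along some \<open>\<psi>: K \<rightarrow> L\<close>; applying \<open>s\<close> to the equation for \<open>h\<close> shows that \<open>\<psi> d\<close> is the
  difference of \<open>s h\<close>, so \<open>s h\<close> determines \<open>\<psi>\<close> and thereby \<open>s\<close>.\<close>

lemma universal_principal_extension:
  assumes f: "regular_epi C f"
  obtains g h where "regular_epi C g" "arr g" "arr h" "Dom C h = Dom C f" "Cod C h = Dom C g" "Cod C g = Cod C f"
    "\<exists>K m. principal g K m" "g \<cdot> h = f"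
    "principal_universal f g h"
proof -
  have fm: "arr f" by (rule regular_epi_arrow [OF f])
  obtain p q where pb: "is_pullback C f f p q" using pullback_ex [of f f] fm by auto
  then have kp: "kernel_pair C f p q" by (simp add: kernel_pair_def)
  obtain d where d: "cocycle p q d"
    and d_ex: "\<forall>\<delta>. cocycle p q \<delta> \<longrightarrow> (\<exists>\<phi>. \<phi> \<in> hom C (Cod C d) (Cod C \<delta>) \<and> \<phi> \<cdot> d = \<delta>)"
    and d_uniq: "\<forall>L \<phi> \<psi>. abel L \<and> \<phi> \<in> hom C (Cod C d) L \<and> \<psi> \<in> hom C (Cod C d) L \<and> \<phi> \<cdot> d = \<psi> \<cdot> d \<longrightarrow> \<phi> = \<psi>"
    by (rule universal_cocycle [OF kp])
  define A R K B where "A = Dom C f" and "R = Dom C p" and "K = Cod C d" and "B = Cod C f"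
  note P' = pullbackD [OF pb] note D' = cocycleD [OF d]
  have P: "arr p" "arr q" "Dom C p = R" "Dom C q = R" "Cod C p = A" "Cod C q = A" "arr f" "Dom C f = A" "Cod C f = B"
    and D: "arr d" "Dom C d = R" "Cod C d = K" "abel K" and O: "A \<in> Obj C" "R \<in> Obj C" "K \<in> Obj C" "B \<in> Obj C"
    using P' D' by (auto simp: A_def R_def K_def B_def)
  let ?e = "\<langle>p \<cdot> pr1 R K, pr2 R K \<oplus> d \<cdot> pr1 R K\<rangle>" and ?e' = "\<langle>q \<cdot> pr1 R K, pr2 R K\<rangle>"
  obtain g c m where g: "arr g" "arr c" "Dom C g = Cod C c" "Dom C c = A \<otimes> K" "Cod C g = Cod C f"
    and c: "is_coequalizer C ?e ?e' c"
    and gc: "g \<cdot> c = f \<cdot> pr1 A K" and greg: "regular_epi C g" and m: "principal g K m"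
    and mr: "m \<cdot> inr (Cod C c) K = c \<cdot> inr A K"
    and mh: "m \<cdot> \<langle>(c \<cdot> inl A K) \<cdot> pr1 A K, pr2 A K\<rangle> = c"
    by (rule cocycle_extension [OF f kp P(8) d P(3) D(3)])
  define X where "X = Cod C c"
  have X: "Cod C c = X" "Dom C g = X" "Cod C g = B" "X \<in> Obj C" using g P by (auto simp: X_def)
  note M = principalD [OF m X(2)]
  have ce: "regular_epi C c" using c unfolding regular_epi_def by blast
  define h where "h = c \<cdot> inl A K"
  have h: "arr h" "Dom C h = A" "Cod C h = X" unfolding h_def using g X O by simp_all
  have c_eval: "c \<cdot> \<langle>a, k\<rangle> = m \<cdot> \<langle>h \<cdot> a, k\<rangle>" if "arr a" "arr k" "Dom C a = Dom C k" "Cod C a = A" "Cod C k = K" for a k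
  proof -
    have "c \<cdot> \<langle>a, k\<rangle> = (m \<cdot> \<langle>h \<cdot> pr1 A K, pr2 A K\<rangle>) \<cdot> \<langle>a, k\<rangle>" unfolding h_def mh ..
    then show ?thesis using that h M(1-7) O by simp
  qed
  have gc': "g \<cdot> (c \<cdot> x) = f \<cdot> (pr1 A K \<cdot> x)" if "arr x" "Cod C x = A \<otimes> K" for x
    by (rule comp_cong_left) (use that g gc P O in simp_all)
  have gh: "g \<cdot> h = f" unfolding h_def using gc' [of "inl A K"] P O by simp
  \<comment> \<open>The relation at \<open>k = 0\<close>: \<open>[a, d(a, a')] = [a', 0]\<close>.\<close>
  have hq: "m \<cdot> \<langle>h \<cdot> p, d\<rangle> = h \<cdot> q"
  proof -
    have "c \<cdot> (?e \<cdot> inl R K) = c \<cdot> (?e' \<cdot> inl R K)"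
      by (rule comp_cong_left) (use coequalizerD [OF c] P D O in simp_all)
    then have "c \<cdot> \<langle>p, d\<rangle> = c \<cdot> \<langle>q, zer R K\<rangle>" using P D O by simp
    then have "m \<cdot> \<langle>h \<cdot> p, d\<rangle> = m \<cdot> \<langle>h \<cdot> q, zer R K\<rangle>" using c_eval [of p d] c_eval [of q "zer R K"] P D O by simp
    also have "\<dots> = h \<cdot> q" by (rule principal_zer [OF m]) (use h P X in simp_all)
    finally show ?thesis .
  qed
  have ex: "\<exists>s. arr s \<and> Dom C s = Dom C g \<and> Cod C s = Dom C g' \<and> s \<cdot> h = t \<and> g' \<cdot> s = v \<cdot> g"
    if n: "principal g' L n" and tv: "arr t" "arr v" "Dom C t = Dom C f" "Cod C t = Dom C g'"
      "Dom C v = Cod C f" "Cod C v = Cod C g'" "g' \<cdot> t = v \<cdot> f" for g' t v L n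
  proof -
    define Y where "Y = Dom C g'"
    note N = principalD [OF n Y_def [symmetric]]
    have g': "Dom C g' = Y" by (simp add: Y_def)
    have ft: "g' \<cdot> (t \<cdot> x) = v \<cdot> (f \<cdot> x)" if "arr x" "Cod C x = A" for x
      by (rule comp_cong_left) (use that tv N P g' in simp_all)
    have "g' \<cdot> (t \<cdot> p) = g' \<cdot> (t \<cdot> q)" using ft [of p] ft [of q] P P'(9) by simp
    then obtain \<delta> where \<delta>: "arr \<delta>" "Dom C \<delta> = R" "Cod C \<delta> = L" "n \<cdot> \<langle>t \<cdot> p, \<delta>\<rangle> = t \<cdot> q"
      using principal_difference [OF n, of "t \<cdot> p" "t \<cdot> q"] tv P g' by auto
    have diff: "n \<cdot> \<langle>t \<cdot> (p \<cdot> r), \<delta> \<cdot> r\<rangle> = t \<cdot> (q \<cdot> r)" if "arr r" "Cod C r = R" for r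
    proof -
      have "(n \<cdot> \<langle>t \<cdot> p, \<delta>\<rangle>) \<cdot> r = (t \<cdot> q) \<cdot> r" using \<delta>(4) by simp
      then show ?thesis using that \<delta>(1-3) tv P N(1-7) g' by simp
    qed
    have "cocycle p q \<delta>" unfolding cocycle_def
    proof (intro conjI allI impI; (elim conjE)?)
      fix r s u
      assume *: "arr r" "arr s" "arr u" "Dom C r = Dom C s" "Dom C u = Dom C s"
        "Cod C r = Dom C p" "Cod C s = Dom C p" "Cod C u = Dom C p"
        "p \<cdot> s = q \<cdot> r" "p \<cdot> u = p \<cdot> r" "q \<cdot> u = q \<cdot> s"
      have "n \<cdot> \<langle>t \<cdot> (p \<cdot> r), \<delta> \<cdot> u\<rangle> = t \<cdot> (q \<cdot> s)" using diff [of u] *(3,8,10,11) P by simp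
      also have "\<dots> = n \<cdot> \<langle>t \<cdot> (q \<cdot> r), \<delta> \<cdot> s\<rangle>" using diff [of s] *(2,7,9) P by simp
      also have "\<dots> = n \<cdot> \<langle>n \<cdot> \<langle>t \<cdot> (p \<cdot> r), \<delta> \<cdot> r\<rangle>, \<delta> \<cdot> s\<rangle>" using diff [of r] *(1,6) P by simp
      also have "\<dots> = n \<cdot> \<langle>t \<cdot> (p \<cdot> r), \<delta> \<cdot> r \<oplus> \<delta> \<cdot> s\<rangle>"
        by (rule principal_action [OF n]) (use *(1-8) tv P \<delta>(1-3) g' in simp_all)
      finally show "\<delta> \<cdot> u = \<delta> \<cdot> r \<oplus> \<delta> \<cdot> s"
        by - (rule principal_free [OF n, of "t \<cdot> (p \<cdot> r)"], use *(1-8) tv P \<delta>(1-3) g' N(2) in simp_all)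
    qed (use \<delta> N P in simp_all)
    then obtain \<phi> where \<phi>: "arr \<phi>" "Dom C \<phi> = K" "Cod C \<phi> = L" "\<phi> \<cdot> d = \<delta>"
      using d_ex [rule_format, of \<delta>] \<delta> D by auto
    let ?\<tau> = "n \<cdot> \<langle>t \<cdot> pr1 A K, \<phi> \<cdot> pr2 A K\<rangle>"
    have \<tau>: "arr ?\<tau>" "Dom C ?\<tau> = A \<otimes> K" "Cod C ?\<tau> = Y" using tv P N(1-7) \<phi>(1-3) O g' by simp_all
    let ?r = "pr1 R K" and ?k = "pr2 R K"
    have "?\<tau> \<cdot> ?e = n \<cdot> \<langle>t \<cdot> (p \<cdot> ?r), \<phi> \<cdot> (?k \<oplus> d \<cdot> ?r)\<rangle>" using tv P N(1-7) \<phi>(1-3) D O g' by simp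
    also have "\<phi> \<cdot> (?k \<oplus> d \<cdot> ?r) = \<phi> \<cdot> ?k \<oplus> \<phi> \<cdot> (d \<cdot> ?r)"
      by (rule comp_add [of \<phi> K L]) (use \<phi> D N O in simp_all)
    also have "\<phi> \<cdot> (d \<cdot> ?r) = \<delta> \<cdot> ?r" using \<phi>(1-3) D O by (simp add: \<phi>(4) [symmetric])
    also have "\<phi> \<cdot> ?k \<oplus> \<delta> \<cdot> ?r = \<delta> \<cdot> ?r \<oplus> \<phi> \<cdot> ?k" by (rule add_commute) (use \<phi>(1-3) \<delta>(1-3) N(2) O in simp_all)
    also have "n \<cdot> \<langle>t \<cdot> (p \<cdot> ?r), \<delta> \<cdot> ?r \<oplus> \<phi> \<cdot> ?k\<rangle> = n \<cdot> \<langle>n \<cdot> \<langle>t \<cdot> (p \<cdot> ?r), \<delta> \<cdot> ?r\<rangle>, \<phi> \<cdot> ?k\<rangle>"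
      by (rule principal_action [OF n, symmetric]) (use \<phi>(1-3) \<delta>(1-3) N O P tv g' in simp_all)
    also have "\<dots> = n \<cdot> \<langle>t \<cdot> (q \<cdot> ?r), \<phi> \<cdot> ?k\<rangle>" using diff [of ?r] O by simp
    also have "\<dots> = ?\<tau> \<cdot> ?e'" using tv P N(1-7) \<phi>(1-3) D O g' by simp
    finally obtain s where s: "arr s" "Dom C s = X" "Cod C s = Y" "s \<cdot> c = ?\<tau>"
      using coequalizer_lift [OF c \<tau>(1)] \<tau> g X by metis
    have "s \<cdot> h = ?\<tau> \<cdot> inl A K" unfolding h_def using s(1-3) g X O by (simp add: s(4) [symmetric])
    also have "\<dots> = n \<cdot> \<langle>t, zer A L\<rangle>" using tv P N(1-7) \<phi>(1-3) O g' by simp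
    also have "\<dots> = t" by (rule principal_zer [OF n]) (use tv P in simp_all)
    finally have sh: "s \<cdot> h = t" .
    have "(g' \<cdot> s) \<cdot> c = g' \<cdot> ?\<tau>" using s g X N(1) g' by simp
    also have "\<dots> = g' \<cdot> (pr1 Y L \<cdot> \<langle>t \<cdot> pr1 A K, \<phi> \<cdot> pr2 A K\<rangle>)"
      by (rule comp_cong_left) (use N(1-9) tv P \<phi>(1-3) O g' in simp_all)
    also have "\<dots> = v \<cdot> (f \<cdot> pr1 A K)" using ft [of "pr1 A K"] tv P \<phi>(1-3) N(1-7) O g' by simp
    also have "\<dots> = (v \<cdot> g) \<cdot> c" using g X tv P by (simp add: gc)
    finally have "g' \<cdot> s = v \<cdot> g"
      by - (rule regular_epi_cancel [OF ce], use s(1-3) g X tv P N(1) g' in simp_all)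
    then show ?thesis using s(1-3) sh X(2) g' by (intro exI [of _ s]) simp
  qed
  have uniq: "s = s'"
    if n: "principal g' L n" and s: "arr s" "arr s'" "arr v" "Dom C s = Dom C g" "Dom C s' = Dom C g"
      "Cod C s = Dom C g'" "Cod C s' = Dom C g'" "Dom C v = Cod C f" "s \<cdot> h = s' \<cdot> h"
      "g' \<cdot> s = v \<cdot> g" "g' \<cdot> s' = v \<cdot> g" for g' s s' v L n
  proof -
    define Y where "Y = Dom C g'"
    note N = principalD [OF n Y_def [symmetric]]
    have g': "Dom C g' = Y" by (simp add: Y_def)
    let ?j = "c \<cdot> inr A K"
    have j: "arr ?j" "Dom C ?j = K" "Cod C ?j = X" "g \<cdot> ?j = zer K B"
      using gc' [of "inr A K"] g X P O by simp_all
    \<comment> \<open>The class \<open>[0, k]\<close> goes to the fibre of \<open>g'\<close> over zero, where it is \<open>\<psi>(k)\<close> acting on zero.\<close>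
    have equivariant: "\<exists>\<psi>. arr \<psi> \<and> Dom C \<psi> = K \<and> Cod C \<psi> = L \<and> u \<cdot> m = n \<cdot> \<langle>u \<cdot> pr1 X K, \<psi> \<cdot> pr2 X K\<rangle>"
      if u: "arr u" "Dom C u = X" "Cod C u = Y" "g' \<cdot> u = v \<cdot> g" for u
    proof -
      have "g' \<cdot> (u \<cdot> ?j) = v \<cdot> (g \<cdot> ?j)" by (rule comp_cong_left) (use u s g' N(1) j X P g in simp_all)
      also have "\<dots> = zer K (Cod C v)" unfolding j(4) using s P O by simp
      also have "\<dots> = g' \<cdot> zer K Y"
        using arg_cong [OF u(4), of "Cod C"] u(1-3) s(3,8) g' N(1) X g P O by simp
      finally obtain \<psi> where \<psi>: "arr \<psi>" "Dom C \<psi> = K" "Cod C \<psi> = L" "n \<cdot> \<langle>zer K Y, \<psi>\<rangle> = u \<cdot> ?j"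
        using principal_difference [OF n, of "zer K Y" "u \<cdot> ?j"] u j(1-3) N O g' by auto
      have "u \<cdot> m = n \<cdot> \<langle>u \<cdot> pr1 X K, \<psi> \<cdot> pr2 X K\<rangle>"
      proof (rule unital_eqI [of _ _ X K])
        have "n \<cdot> \<langle>u, zer X L\<rangle> = u" by (rule principal_zer [OF n]) (use u g' in simp_all)
        moreover have "u \<cdot> (m \<cdot> inl X K) = u" unfolding M(8) using u by simp
        ultimately show "(u \<cdot> m) \<cdot> inl X K = (n \<cdot> \<langle>u \<cdot> pr1 X K, \<psi> \<cdot> pr2 X K\<rangle>) \<cdot> inl X K"
          using u M(1-7) N(1-7) \<psi>(1-3) by simp
        have "u \<cdot> (m \<cdot> inr X K) = n \<cdot> \<langle>zer K Y, \<psi>\<rangle>" using mr \<psi>(4) by (simp only: X(1))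
        then show "(u \<cdot> m) \<cdot> inr X K = (n \<cdot> \<langle>u \<cdot> pr1 X K, \<psi> \<cdot> pr2 X K\<rangle>) \<cdot> inr X K"
          using u(1-3) M(1-7) N(1-7) \<psi>(1-3) by simp
      qed (use u M(1-7) N(1-7) \<psi>(1-3) in simp_all)
      then show ?thesis using \<psi>(1-3) by blast
    qed
    have sX: "Dom C s = X" "Cod C s = Y" "Dom C s' = X" "Cod C s' = Y" using s X g' by simp_all
    obtain \<psi> where \<psi>: "arr \<psi>" "Dom C \<psi> = K" "Cod C \<psi> = L" "s \<cdot> m = n \<cdot> \<langle>s \<cdot> pr1 X K, \<psi> \<cdot> pr2 X K\<rangle>"
      using equivariant [OF s(1) sX(1,2) s(10)] by blast
    obtain \<psi>' where \<psi>': "arr \<psi>'" "Dom C \<psi>' = K" "Cod C \<psi>' = L" "s' \<cdot> m = n \<cdot> \<langle>s' \<cdot> pr1 X K, \<psi>' \<cdot> pr2 X K\<rangle>"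
      using equivariant [OF s(2) sX(3,4) s(11)] by blast
    have ev: "u \<cdot> (m \<cdot> \<langle>x, k\<rangle>) = n \<cdot> \<langle>u \<cdot> x, \<chi> \<cdot> k\<rangle>"
      if "u \<cdot> m = n \<cdot> \<langle>u \<cdot> pr1 X K, \<chi> \<cdot> pr2 X K\<rangle>" "arr u" "Dom C u = X" "Cod C u = Y"
        "arr \<chi>" "Dom C \<chi> = K" "Cod C \<chi> = L"
        "arr x" "arr k" "Dom C x = Dom C k" "Cod C x = X" "Cod C k = K" for u \<chi> x k
    proof -
      have "(u \<cdot> m) \<cdot> \<langle>x, k\<rangle> = (n \<cdot> \<langle>u \<cdot> pr1 X K, \<chi> \<cdot> pr2 X K\<rangle>) \<cdot> \<langle>x, k\<rangle>" using that(1) by simp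
      then show ?thesis using that(2-) M(1-7) N(1-7) by simp
    qed
    have hp: "s \<cdot> (h \<cdot> x) = s' \<cdot> (h \<cdot> x)" if "arr x" "Cod C x = A" for x
      by (rule comp_cong_left) (use that s h X in simp_all)
    have "n \<cdot> \<langle>s \<cdot> (h \<cdot> p), \<psi> \<cdot> d\<rangle> = s \<cdot> (h \<cdot> q)"
      using ev [OF \<psi>(4) s(1) sX(1,2) \<psi>(1-3), of "h \<cdot> p" d] h P D by (simp add: hq)
    moreover have "n \<cdot> \<langle>s' \<cdot> (h \<cdot> p), \<psi>' \<cdot> d\<rangle> = s' \<cdot> (h \<cdot> q)"
      using ev [OF \<psi>'(4) s(2) sX(3,4) \<psi>'(1-3), of "h \<cdot> p" d] h P D by (simp add: hq)
    ultimately have "n \<cdot> \<langle>s \<cdot> (h \<cdot> p), \<psi> \<cdot> d\<rangle> = n \<cdot> \<langle>s \<cdot> (h \<cdot> p), \<psi>' \<cdot> d\<rangle>" using hp [of p] hp [of q] P by simp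
    then have "\<psi> \<cdot> d = \<psi>' \<cdot> d"
      by - (rule principal_free [OF n, of "s \<cdot> (h \<cdot> p)"], use s(1,2) sX g' h P D \<psi>(1-3) \<psi>'(1-3) in simp_all)
    then have eq: "\<psi> = \<psi>'" by - (rule d_uniq [rule_format, of L], use \<psi>(1-3) \<psi>'(1-3) D N(2,4) O in simp)
    have cc: "c = m \<cdot> \<langle>h \<cdot> pr1 A K, pr2 A K\<rangle>" unfolding h_def mh ..
    have "s \<cdot> c = n \<cdot> \<langle>s \<cdot> (h \<cdot> pr1 A K), \<psi> \<cdot> pr2 A K\<rangle>"
      unfolding cc by (rule ev [OF \<psi>(4) s(1) sX(1,2) \<psi>(1-3)]) (use h O in simp_all)
    moreover have "s' \<cdot> c = n \<cdot> \<langle>s' \<cdot> (h \<cdot> pr1 A K), \<psi>' \<cdot> pr2 A K\<rangle>"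
      unfolding cc by (rule ev [OF \<psi>'(4) s(2) sX(3,4) \<psi>'(1-3)]) (use h O in simp_all)
    ultimately have "s \<cdot> c = s' \<cdot> c" using hp [of "pr1 A K"] eq O by simp
    then show ?thesis by - (rule regular_epi_cancel [OF ce], use s(1,2) sX X in simp_all)
  qed
  have "\<exists>!s. s \<in> hom C (Dom C g) (Dom C g') \<and> s \<cdot> h = t \<and> g' \<cdot> s = v \<cdot> g"
    if n: "principal g' L n" and t: "t \<in> hom C (Dom C f) (Dom C g')" and v: "v \<in> hom C (Cod C f) (Cod C g')"
      and gt: "g' \<cdot> t = v \<cdot> f" for g' t v L n
  proof -
    obtain s where s: "arr s" "Dom C s = Dom C g" "Cod C s = Dom C g'" "s \<cdot> h = t" "g' \<cdot> s = v \<cdot> g"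
      using ex [OF n _ _ _ _ _ _ gt] t v by auto
    show ?thesis
    proof (rule ex1I [of _ s])
      show "s \<in> hom C (Dom C g) (Dom C g') \<and> s \<cdot> h = t \<and> g' \<cdot> s = v \<cdot> g" using s t g(1) by auto
      show "s' = s" if "s' \<in> hom C (Dom C g) (Dom C g') \<and> s' \<cdot> h = t \<and> g' \<cdot> s' = v \<cdot> g" for s'
        by (rule uniq [OF n]) (use that s v in auto)
    qed
  qed
  then have univ: "principal_universal f g h"
    unfolding principal_universal_def by blast
  show thesis by (rule that [OF greg g(1) h(1) _ _ _ _ gh univ]) (use h P X m in auto)
qed

end

section \<open>Reflections from universal arrows, and the category of arrows\<close>

lemma full_subcategory_simps [simp]:
  "Obj (full_subcategory C S) = Obj C \<inter> S" "Mor (full_subcategory C S) = {f \<in> Mor C. Dom C f \<in> S \<and> Cod C f \<in> S}"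
  "Dom (full_subcategory C S) = Dom C" "Cod (full_subcategory C S) = Cod C" "Idm (full_subcategory C S) = Idm C"
  "Comp (full_subcategory C S) = Comp C"
  by (simp_all add: full_subcategory_def)

lemma full_subcategory_hom:
  "f \<in> hom (full_subcategory C S) A B \<longleftrightarrow> f \<in> hom C A B \<and> A \<in> S \<and> B \<in> S"
  by (auto simp: hom_def)

lemma full_subcategory_category:
  assumes "category C"
  shows "category (full_subcategory C S)"
proof -
  interpret category C by (rule assms)
  show ?thesis
    by unfold_locales (auto simp: full_subcategory_hom)
qed

text \<open>The left adjoint sends \<open>A\<close> to the codomain of its chosen universal arrow; functoriality is
  uniqueness of factorizations.\<close>

lemma reflective_if_universal_arrows:
  fixes C :: "('o, 'm) category" (structure)
  assumes C: "category C" and S: "S \<subseteq> Obj C"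
    and univ: "\<And>A. A \<in> Obj C \<Longrightarrow> \<exists>\<eta>. universal_arrow C S A \<eta>"
  shows "reflective C S"
proof -
  interpret category C by (rule C)
  obtain \<eta> where \<eta>: "\<And>A. A \<in> Obj C \<Longrightarrow> universal_arrow C S A (\<eta> A)" using univ by metis
  note D = universal_arrowD [OF \<eta>]
  define F where "F f = (SOME g. g \<in> Mor C \<and> Dom C g = Cod C (\<eta> (Dom C f)) \<and> Cod C g = Cod C (\<eta> (Cod C f)) \<and>
    g \<cdot> \<eta> (Dom C f) = \<eta> (Cod C f) \<cdot> f)" for f
  have F: "F f \<in> Mor C \<and> Dom C (F f) = Cod C (\<eta> (Dom C f)) \<and> Cod C (F f) = Cod C (\<eta> (Cod C f)) \<and>
    F f \<cdot> \<eta> (Dom C f) = \<eta> (Cod C f) \<cdot> f" if f: "f \<in> Mor C" for f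
  proof -
    have "\<exists>g. g \<in> Mor C \<and> Dom C g = Cod C (\<eta> (Dom C f)) \<and> Cod C g = Cod C (\<eta> (Cod C f)) \<and>
      g \<cdot> \<eta> (Dom C f) = \<eta> (Cod C f) \<cdot> f"
      using universal_arrow_lift [OF \<eta> [of "Dom C f"], of "\<eta> (Cod C f) \<cdot> f"] f D [of "Cod C f"] by auto
    then show ?thesis unfolding F_def by (rule someI_ex)
  qed
  have F_id: "F (Idm C A) = Idm C (Cod C (\<eta> A))" if A: "A \<in> Obj C" for A
    by (rule universal_arrow_eqI [OF \<eta> [OF A]]) (use F [of "Idm C A"] A D [OF A] in auto)
  have F_comp: "F (g \<cdot> f) = F g \<cdot> F f" if fg: "f \<in> Mor C" "g \<in> Mor C" "Dom C g = Cod C f" for f g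
  proof (rule universal_arrow_eqI [OF \<eta> [of "Dom C f"]])
    note Ff = F [OF fg(1)] and Fg = F [OF fg(2)] and Fgf = F [of "g \<cdot> f"]
    have "(F g \<cdot> F f) \<cdot> \<eta> (Dom C f) = F g \<cdot> (\<eta> (Cod C f) \<cdot> f)"
      using Ff Fg fg D [of "Dom C f"] by simp
    also have "\<dots> = \<eta> (Cod C g) \<cdot> (g \<cdot> f)"
      by (rule comp_cong_left) (use Fg fg D [of "Cod C f"] D [of "Cod C g"] in auto)
    finally show "F (g \<cdot> f) \<cdot> \<eta> (Dom C f) = (F g \<cdot> F f) \<cdot> \<eta> (Dom C f)" using Fgf fg by simp
  qed (use F [OF fg(1)] F [OF fg(2)] F [of "g \<cdot> f"] fg D [of "Cod C g"] in auto)
  let ?F = "\<lparr>on_obj = \<lambda>A. Cod C (\<eta> A), on_mor = F\<rparr>"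
  let ?D = "full_subcategory C S"
  have fun1: "is_functor C ?D ?F"
    unfolding is_functor_def using F F_id F_comp D S by (auto simp: full_subcategory_hom)
  have fun2: "is_functor ?D C id_functor"
    unfolding is_functor_def id_functor_def by (auto simp: full_subcategory_hom)
  have nat: "nat_trans C C id_functor (comp_functor id_functor ?F) \<eta>"
    unfolding nat_trans_def id_functor_def comp_functor_def using F D S by auto
  have uni: "\<exists>!g. g \<in> hom ?D (on_obj ?F A) B \<and> on_mor id_functor g \<cdot> \<eta> A = f"
    if A: "A \<in> Obj C" "B \<in> Obj ?D" "f \<in> hom C A (on_obj id_functor B)" for A B f
  proof -
    have f: "f \<in> Mor C" "Dom C f = A" "Cod C f = B" "B \<in> S" using A by (auto simp: id_functor_def)
    have "\<exists>!g. g \<in> hom C (Cod C (\<eta> A)) B \<and> g \<cdot> \<eta> A = f"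
      using universal_arrow_ex1 [OF \<eta> [OF A(1)] f(1,2)] f by simp
    then show ?thesis using D [OF A(1)] f(4) by (simp add: full_subcategory_hom id_functor_def del: hom_iff)
  qed
  have "adjunction C ?D ?F id_functor \<eta>"
    unfolding adjunction_def using fun1 fun2 nat uni by blast
  then show ?thesis unfolding reflective_def using S by blast
qed

lemma arrow_category_simps [simp]:
  "Obj (arrow_category C) = Mor C"
  "(f, g, u, v) \<in> Mor (arrow_category C) \<longleftrightarrow> f \<in> Mor C \<and> g \<in> Mor C \<and>
     u \<in> hom C (Dom C f) (Dom C g) \<and> v \<in> hom C (Cod C f) (Cod C g) \<and> v \<cdot>\<^bsub>C\<^esub> f = g \<cdot>\<^bsub>C\<^esub> u"
  "Dom (arrow_category C) (f, g, u, v) = f" "Cod (arrow_category C) (f, g, u, v) = g"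
  "Idm (arrow_category C) f = (f, f, Idm C (Dom C f), Idm C (Cod C f))"
  "Comp (arrow_category C) (g, h, u', v') (f, g', u, v) = (f, h, u' \<cdot>\<^bsub>C\<^esub> u, v' \<cdot>\<^bsub>C\<^esub> v)"
  by (simp_all add: arrow_category_def)

lemma arrow_category_hom:
  "x \<in> hom (arrow_category C) f g \<longleftrightarrow> (\<exists>u v. x = (f, g, u, v) \<and> f \<in> Mor C \<and> g \<in> Mor C \<and>
     u \<in> hom C (Dom C f) (Dom C g) \<and> v \<in> hom C (Cod C f) (Cod C g) \<and> v \<cdot>\<^bsub>C\<^esub> f = g \<cdot>\<^bsub>C\<^esub> u)"
  by (cases x) (auto simp: hom_def [of "arrow_category C"])

lemma arrow_category_category:
  fixes C :: "('o, 'm) category" (structure)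
  assumes "category C"
  shows "category (arrow_category C)"
proof -
  interpret category C by (rule assms)
  show ?thesis
  proof
    fix x assume "x \<in> Mor (arrow_category C)"
    then show "Dom (arrow_category C) x \<in> Obj (arrow_category C)" "Cod (arrow_category C) x \<in> Obj (arrow_category C)"
      by (cases x; simp)+
  next
    fix x y f g h assume "x \<in> hom (arrow_category C) f g" "y \<in> hom (arrow_category C) g h"
    then obtain u v u' v' where x: "x = (f, g, u, v)" "y = (g, h, u', v')" "f \<in> Mor C" "g \<in> Mor C" "h \<in> Mor C"
      and uv: "u \<in> hom C (Dom C f) (Dom C g)" "v \<in> hom C (Cod C f) (Cod C g)" "u' \<in> hom C (Dom C g) (Dom C h)"
        "v' \<in> hom C (Cod C g) (Cod C h)" and eq: "v \<cdot> f = g \<cdot> u" "v' \<cdot> g = h \<cdot> u'"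
      unfolding arrow_category_hom by blast
    have "v' \<cdot> (v \<cdot> f) = h \<cdot> (u' \<cdot> u)" unfolding eq(1) by (rule comp_cong_left) (use x uv eq in auto)
    then show "y \<cdot>\<^bsub>arrow_category C\<^esub> x \<in> hom (arrow_category C) f h"
      using x uv unfolding arrow_category_hom by auto
  qed (auto simp: arrow_category_hom)
qed

context exact_unital_category
begin

section \<open>Normal extensions are the principal ones\<close>

lemma pair_zer:
  assumes "X \<in> Obj C" "A \<in> Obj C" "B \<in> Obj C"
  shows "\<langle>zer X A, zer X B\<rangle> = zer X (A \<otimes> B)"
  by (rule prd_eqI [of _ _ A B]) (use assms in simp_all)

lemma into_zero_ob_eq:
  assumes "arr a" "arr b" "Dom C a = Dom C b" "Cod C a = zero_ob" "Cod C b = zero_ob"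
  shows "a = b"
proof -
  have "to_zero (Dom C b) = a" by (rule to_zero_unique) (use assms in simp_all)
  moreover have "to_zero (Dom C b) = b" by (rule to_zero_unique) (use assms in simp_all)
  ultimately show ?thesis by simp
qed

text \<open>Sums and negatives of elements annihilated by \<open>\<pi>\<close> are annihilated by \<open>\<pi>\<close>, so the operations of
  \<open>Y\<close> restrict to the kernel.\<close>

lemma abel_kernel:
  assumes Y: "abel Y" and X: "abel X" and \<pi>: "arr \<pi>" "Dom C \<pi> = Y" "Cod C \<pi> = X"
  obtains L k where "abel L" "arr k" "Dom C k = L" "Cod C k = Y" "monic C k" "\<pi> \<cdot> k = zer L X"
    "\<forall>y \<in> Mor C. Cod C y = Y \<and> \<pi> \<cdot> y = zer (Dom C y) X \<longrightarrow> (\<exists>l. arr l \<and> Dom C l = Dom C y \<and> Cod C l = L \<and> k \<cdot> l = y)"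
proof -
  have O: "X \<in> Obj C" "Y \<in> Obj C" using X Y by (auto intro: mul_arrow(1))
  obtain k z where pb: "is_pullback C \<pi> (zer zero_ob X) k z"
    using pullback_ex [of \<pi> "zer zero_ob X"] \<pi> O by auto
  note d = pullbackD [OF pb]
  define L where "L = Dom C k"
  have k: "arr k" "Dom C k = L" "Cod C k = Y" "L \<in> Obj C" "arr z" "Dom C z = L" "Cod C z = zero_ob"
    using d \<pi> O by (auto simp: L_def)
  have \<pi>k: "\<pi> \<cdot> k = zer L X" using d(9) k O by simp
  have lift: "\<exists>l. arr l \<and> Dom C l = Dom C y \<and> Cod C l = L \<and> k \<cdot> l = y"
    if y: "arr y" "Cod C y = Y" "\<pi> \<cdot> y = zer (Dom C y) X" for y
  proof -
    have "\<pi> \<cdot> y = zer zero_ob X \<cdot> zer (Dom C y) zero_ob" using y O by simp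
    then obtain l where "arr l" "Dom C l = Dom C y" "Cod C l = Dom C k" "k \<cdot> l = y"
      using pullback_lift [OF pb, of y "zer (Dom C y) zero_ob"] y \<pi> O by auto
    then show ?thesis using k by auto
  qed
  have mono: "monic C k"
  proof (rule monicI [OF k(1)])
    fix a b assume ab: "arr a" "arr b" "Dom C a = Dom C b" "Cod C a = Dom C k" "Cod C b = Dom C k" "k \<cdot> a = k \<cdot> b"
    have "z \<cdot> a = z \<cdot> b" by (rule into_zero_ob_eq) (use ab(1-5) k in simp_all)
    then show "a = b" using ab by - (rule pullback_eqI [OF pb], auto)
  qed
  let ?p = "k \<cdot> pr1 L L" and ?q = "k \<cdot> pr2 L L"
  have z0: "\<pi> \<cdot> (k \<cdot> x) = zer (Dom C x) X" if "arr x" "Cod C x = L" for x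
  proof -
    have "(\<pi> \<cdot> k) \<cdot> x = zer L X \<cdot> x" using \<pi>k by simp
    then show ?thesis using that \<pi> k O by simp
  qed
  have "\<pi> \<cdot> (?p \<oplus> ?q) = \<pi> \<cdot> ?p \<oplus> \<pi> \<cdot> ?q" by (rule comp_add [of \<pi> Y X]) (use \<pi> k O X Y in simp_all)
  also have "\<dots> = zer (L \<otimes> L) X" using z0 [of "pr1 L L"] z0 [of "pr2 L L"] k X O by simp
  finally obtain m where m: "arr m" "Dom C m = L \<otimes> L" "Cod C m = L" "k \<cdot> m = ?p \<oplus> ?q"
    using lift [of "?p \<oplus> ?q"] k Y by auto
  have km: "k \<cdot> (m \<cdot> x) = k \<cdot> (pr1 L L \<cdot> x) \<oplus> k \<cdot> (pr2 L L \<cdot> x)" if "arr x" "Cod C x = L \<otimes> L" for x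
  proof -
    have "(k \<cdot> m) \<cdot> x = (?p \<oplus> ?q) \<cdot> x" using m(4) by simp
    then show ?thesis using that k(1-4) m(1-3) Y by simp
  qed
  have "m \<cdot> inl L L = Idm C L"
    by (rule monicD [OF mono]) (use km [of "inl L L"] k m(1-3) Y in simp_all)
  moreover have "m \<cdot> inr L L = Idm C L"
    by (rule monicD [OF mono]) (use km [of "inr L L"] k m(1-3) Y in simp_all)
  ultimately have comm: "comm_ob L" unfolding comm_ob_def comm_op_def using m k by auto
  have "\<pi> \<cdot> \<ominus> k = \<ominus> (\<pi> \<cdot> k)" by (rule comp_neg [of \<pi> Y X]) (use \<pi> k X Y in simp_all)
  also have "\<dots> = zer L X"
  proof -
    have "zer L X \<oplus> \<ominus> zer L X = zer L X" using add_neg(1) [of "zer L X" X] k X O by simp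
    moreover have "zer L X \<oplus> \<ominus> zer L X = \<ominus> zer L X" using k X O by (intro add_zer(2)) simp_all
    ultimately show ?thesis unfolding \<pi>k by simp
  qed
  finally obtain i where i: "arr i" "Dom C i = L" "Cod C i = L" "k \<cdot> i = \<ominus> k"
    using lift [of "\<ominus> k"] k Y by auto
  have "k \<cdot> (Idm C L \<oplus> i) = k \<cdot> Idm C L \<oplus> k \<cdot> i" by (rule comp_add [of k L Y]) (use k i comm Y in simp_all)
  also have "\<dots> = k \<cdot> zer L L" using k i Y O by simp
  finally have "Idm C L \<oplus> i = zer L L" by - (rule monicD [OF mono], use k i comm in simp_all)
  then have "abel L" unfolding abel_def using comm i k by auto
  then show thesis using that [of L k] k mono \<pi>k lift by blast
qed

text \<open>The section \<open>\<sigma>\<close> of \<open>\<pi>\<close> induced by the diagonal splits \<open>Y\<close> as \<open>X \<oplus> L\<close> with \<open>L\<close> the kernel of \<open>\<pi>\<close>.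
  Pulling back along \<open>\<theta>'\<close> gives an isomorphism \<open>\<phi>: A \<times> L \<rightarrow> R\<close> over \<open>A\<close>, namely the element of \<open>R\<close>
  over \<open>a\<close> whose class in \<open>Y\<close> is \<open>\<sigma> \<theta>' a + k l\<close>; the action is \<open>q \<phi>\<close>.\<close>

lemma principal_if_trivial:
  assumes kp: "kernel_pair C f p q" and univ: "universal_arrow C {B. abel B} (Dom C p) \<theta>"
    and univ': "universal_arrow C {B. abel B} (Dom C f) \<theta>'"
    and triv: "is_pullback C \<pi> \<theta>' \<theta> p"
  shows "\<exists>L m. principal f L m"
proof -
  have pb: "is_pullback C f f p q" using kp by (simp add: kernel_pair_def)
  note P' = pullbackD [OF pb] and T = pullbackD [OF triv]
  define A R X Y where "A = Dom C f" and "R = Dom C p" and "X = Cod C \<theta>'" and "Y = Cod C \<theta>"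
  have P: "arr p" "arr q" "Dom C p = R" "Dom C q = R" "Cod C p = A" "Cod C q = A" "arr f" "Dom C f = A"
    and O: "A \<in> Obj C" "R \<in> Obj C"
    using P' by (auto simp: A_def R_def)
  have U: "arr \<theta>" "Dom C \<theta> = R" "Cod C \<theta> = Y" "abel Y" "arr \<theta>'" "Dom C \<theta>' = A" "Cod C \<theta>' = X" "abel X"
    "arr \<pi>" "Dom C \<pi> = Y" "Cod C \<pi> = X" "\<pi> \<cdot> \<theta> = \<theta>' \<cdot> p" "X \<in> Obj C" "Y \<in> Obj C"
    using universal_arrowD [OF univ] universal_arrowD [OF univ'] T by (auto simp: A_def R_def X_def Y_def)
  obtain \<Delta> where \<Delta>: "arr \<Delta>" "Dom C \<Delta> = A" "Cod C \<Delta> = R" "p \<cdot> \<Delta> = Idm C A" "q \<cdot> \<Delta> = Idm C A"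
    using pullback_lift [OF pb, of "Idm C A" "Idm C A"] P O by auto
  obtain \<sigma> where \<sigma>: "arr \<sigma>" "Dom C \<sigma> = X" "Cod C \<sigma> = Y" "\<sigma> \<cdot> \<theta>' = \<theta> \<cdot> \<Delta>"
    using universal_arrow_lift [OF univ', of "\<theta> \<cdot> \<Delta>"] U \<Delta> P by auto
  have "(\<pi> \<cdot> \<sigma>) \<cdot> \<theta>' = \<pi> \<cdot> (\<theta> \<cdot> \<Delta>)" using \<sigma> U by simp
  also have "\<dots> = \<theta>' \<cdot> (p \<cdot> \<Delta>)" by (rule comp_cong_left) (use U \<Delta> P in simp_all)
  also have "\<dots> = Idm C X \<cdot> \<theta>'" using \<Delta> U by simp
  finally have \<pi>\<sigma>: "\<pi> \<cdot> \<sigma> = Idm C X"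
    by - (rule universal_arrow_eqI [OF univ'], use \<sigma> U in simp_all)
  obtain L k where k: "abel L" "arr k" "Dom C k = L" "Cod C k = Y" "monic C k" "\<pi> \<cdot> k = zer L X"
    and k_lift: "\<forall>y \<in> Mor C. Cod C y = Y \<and> \<pi> \<cdot> y = zer (Dom C y) X \<longrightarrow> (\<exists>l. arr l \<and> Dom C l = Dom C y \<and> Cod C l = L \<and> k \<cdot> l = y)"
    by (rule abel_kernel [OF U(4,8,9,10,11)])
  have L: "L \<in> Obj C" using k by auto
  let ?s = "\<sigma> \<cdot> (\<theta>' \<cdot> pr1 A L)" and ?k = "k \<cdot> pr2 A L"
  have \<pi>\<sigma>': "\<pi> \<cdot> (\<sigma> \<cdot> x) = x" if "arr x" "Cod C x = X" for x
    using comp_assoc_arrow [of x \<sigma> \<pi>] \<pi>\<sigma> that \<sigma>(1-3) U by simp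
  have "\<pi> \<cdot> (?s \<oplus> ?k) = \<pi> \<cdot> ?s \<oplus> \<pi> \<cdot> ?k" by (rule comp_add [of \<pi> Y X]) (use U \<sigma>(1-3) k O L in simp_all)
  also have "\<pi> \<cdot> ?s = \<theta>' \<cdot> pr1 A L" by (rule \<pi>\<sigma>') (use U O L in simp_all)
  also have "\<pi> \<cdot> ?k = zer (A \<otimes> L) X" using comp_assoc_arrow [of "pr2 A L" k \<pi>] k U O L by simp
  also have "\<theta>' \<cdot> pr1 A L \<oplus> zer (A \<otimes> L) X = \<theta>' \<cdot> pr1 A L" using U O L by simp
  finally obtain \<phi> where \<phi>: "arr \<phi>" "Dom C \<phi> = A \<otimes> L" "Cod C \<phi> = R" "\<theta> \<cdot> \<phi> = ?s \<oplus> ?k" "p \<cdot> \<phi> = pr1 A L"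
    using pullback_lift [OF triv, of "?s \<oplus> ?k" "pr1 A L"] U \<sigma>(1-3) k O L by auto
  have \<theta>\<phi>: "\<theta> \<cdot> (\<phi> \<cdot> x) = \<sigma> \<cdot> (\<theta>' \<cdot> (pr1 A L \<cdot> x)) \<oplus> k \<cdot> (pr2 A L \<cdot> x)" if "arr x" "Cod C x = A \<otimes> L" for x
  proof -
    have "(\<theta> \<cdot> \<phi>) \<cdot> x = (?s \<oplus> ?k) \<cdot> x" using \<phi>(4) by simp
    then show ?thesis using that U \<phi>(1-3) \<sigma>(1-3) k O L by simp
  qed
  have p\<phi>: "p \<cdot> (\<phi> \<cdot> x) = pr1 A L \<cdot> x" if "arr x" "Cod C x = A \<otimes> L" for x
    using comp_assoc_arrow [of x \<phi> p] that P \<phi> by simp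
  let ?m = "q \<cdot> \<phi>"
  have "\<phi> \<cdot> inl A L = \<Delta>"
    by (rule pullback_eqI [OF triv]) (use \<theta>\<phi> [of "inl A L"] p\<phi> [of "inl A L"] \<phi>(1-3) \<Delta> \<sigma> U P k O L in simp_all)
  then have ml: "?m \<cdot> inl A L = Idm C A" using \<phi>(1-3) P \<Delta> O L by simp
  have "is_pullback C f f (pr1 A L) ?m"
  proof (rule pullbackI)
    have "f \<cdot> (p \<cdot> \<phi>) = f \<cdot> (q \<cdot> \<phi>)" by (rule comp_cong_left) (use P P'(9) \<phi>(1-3) in simp_all)
    then show "f \<cdot> pr1 A L = f \<cdot> ?m" using \<phi>(5) by simp
  next
    fix a b assume ab: "arr a" "arr b" "Dom C a = Dom C b" "Cod C a = Dom C f" "Cod C b = Dom C f" "f \<cdot> a = f \<cdot> b"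
    obtain r where r: "arr r" "Dom C r = Dom C b" "Cod C r = R" "p \<cdot> r = a" "q \<cdot> r = b"
      using pullback_lift [OF pb, of a b] ab P by auto
    let ?y = "\<theta> \<cdot> r" and ?z = "\<sigma> \<cdot> (\<theta>' \<cdot> a)"
    have \<pi>y: "\<pi> \<cdot> ?y = \<theta>' \<cdot> a"
      unfolding r(4) [symmetric] by (rule comp_cong_left) (use U r(1-3) P in simp_all)
    have \<pi>z: "\<pi> \<cdot> ?z = \<theta>' \<cdot> a" by (rule \<pi>\<sigma>') (use U ab P in simp_all)
    have ty: "arr ?y" "Dom C ?y = Dom C b" "Cod C ?y = Y" "arr ?z" "Dom C ?z = Dom C b" "Cod C ?z = Y"
      using U r(1-3) \<sigma>(1-3) ab(1-5) P by simp_all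
    have "\<pi> \<cdot> (?y \<oplus> \<ominus> ?z) = \<pi> \<cdot> ?y \<oplus> \<pi> \<cdot> \<ominus> ?z" by (rule comp_add [of \<pi> Y X]) (use U ty in simp_all)
    also have "\<pi> \<cdot> \<ominus> ?z = \<ominus> (\<pi> \<cdot> ?z)" by (rule comp_neg [of \<pi> Y X]) (use U ty in simp_all)
    also have "\<pi> \<cdot> ?y \<oplus> \<ominus> (\<pi> \<cdot> ?z) = zer (Dom C b) X"
      unfolding \<pi>y \<pi>z using U ab(1-5) P by simp
    finally obtain l where l: "arr l" "Dom C l = Dom C b" "Cod C l = L" "k \<cdot> l = ?y \<oplus> \<ominus> ?z"
      using k_lift [rule_format, of "?y \<oplus> \<ominus> ?z"] ty U by auto
    have "?z \<oplus> (?y \<oplus> \<ominus> ?z) = ?y"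
      using add_left_commute [of ?z ?y "\<ominus> ?z"] ty U by simp
    then have "\<theta> \<cdot> (\<phi> \<cdot> \<langle>a, l\<rangle>) = \<theta> \<cdot> r" "p \<cdot> (\<phi> \<cdot> \<langle>a, l\<rangle>) = p \<cdot> r"
      using \<theta>\<phi> [of "\<langle>a, l\<rangle>"] p\<phi> [of "\<langle>a, l\<rangle>"] ab(1-5) l r(4) P by simp_all
    then have "\<phi> \<cdot> \<langle>a, l\<rangle> = r"
      by - (rule pullback_eqI [OF triv], use ab(1-5) l(1-3) r(1-3) \<phi>(1-3) P U in simp_all)
    then have "?m \<cdot> \<langle>a, l\<rangle> = b" using ab(1-5) l(1-3) \<phi>(1-3) P r(5) by simp
    then show "\<exists>h. arr h \<and> Dom C h = Dom C a \<and> Cod C h = Dom C (pr1 A L) \<and> pr1 A L \<cdot> h = a \<and> ?m \<cdot> h = b"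
      using ab(1-5) l(1-3) P O L by (intro exI [of _ "\<langle>a, l\<rangle>"]) simp
  next
    fix a b assume ab: "arr a" "arr b" "Dom C a = Dom C b" "Cod C a = Dom C (pr1 A L)" "Cod C b = Dom C (pr1 A L)"
      "pr1 A L \<cdot> a = pr1 A L \<cdot> b" "?m \<cdot> a = ?m \<cdot> b"
    have c: "Cod C a = A \<otimes> L" "Cod C b = A \<otimes> L" using ab O L by simp_all
    have "q \<cdot> (\<phi> \<cdot> a) = q \<cdot> (\<phi> \<cdot> b)" using ab(1-3,7) c \<phi>(1-3) P by simp
    moreover have "p \<cdot> (\<phi> \<cdot> a) = p \<cdot> (\<phi> \<cdot> b)" using p\<phi> ab c by simp
    ultimately have "\<phi> \<cdot> a = \<phi> \<cdot> b" by - (rule pullback_eqI [OF pb], use ab(1-3) c \<phi>(1-3) P in simp_all)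
    then have "\<theta> \<cdot> (\<phi> \<cdot> a) = \<theta> \<cdot> (\<phi> \<cdot> b)" by simp
    then have "\<sigma> \<cdot> (\<theta>' \<cdot> (pr1 A L \<cdot> b)) \<oplus> k \<cdot> (pr2 A L \<cdot> a) = \<sigma> \<cdot> (\<theta>' \<cdot> (pr1 A L \<cdot> b)) \<oplus> k \<cdot> (pr2 A L \<cdot> b)"
      using \<theta>\<phi> [of a] \<theta>\<phi> [of b] ab(1,2,6) c by simp
    then have "k \<cdot> (pr2 A L \<cdot> a) = k \<cdot> (pr2 A L \<cdot> b)"
      by - (rule add_left_cancel [of "\<sigma> \<cdot> (\<theta>' \<cdot> (pr1 A L \<cdot> b))"], use ab(1-3) c \<sigma>(1-3) U k O L in simp_all)
    then have "pr2 A L \<cdot> a = pr2 A L \<cdot> b" by - (rule monicD [OF k(5)], use ab(1-3) c k O L in simp_all)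
    then show "a = b" by - (rule prd_eqI [of _ _ A L], use ab(1-3,6) c O L in simp_all)
  qed (use P \<phi>(1-3) O L in simp_all)
  then show ?thesis unfolding principal_def kernel_pair_def using k(1) ml P(8) by auto
qed

text \<open>Now \<open>R\<close> is \<open>A \<times> L\<close> by the mutually inverse \<open>\<phi>\<close> and \<open>\<chi>\<close>, and the reflection of such a product is
  \<open>X \<oplus> L\<close>: the projection to \<open>L\<close> factors through \<open>\<theta>\<close> as \<open>l'\<close>, and the identity of \<open>Y\<close> is the sum of
  \<open>\<sigma> \<pi>\<close> and the part coming from \<open>l'\<close>.  So an element of \<open>Y\<close> is determined by its images under \<open>\<pi>\<close>
  and \<open>l'\<close>, and the square is a pullback.\<close>

lemma trivial_if_principal:
  assumes f: "principal f L m" and kp: "kernel_pair C f p q"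
    and univ: "universal_arrow C {B. abel B} (Dom C p) \<theta>" and univ': "universal_arrow C {B. abel B} (Dom C f) \<theta>'"
    and \<pi>: "arr \<pi>" "Dom C \<pi> = Cod C \<theta>" "Cod C \<pi> = Cod C \<theta>'" "\<pi> \<cdot> \<theta> = \<theta>' \<cdot> p"
  shows "is_pullback C \<pi> \<theta>' \<theta> p"
proof -
  have pb: "is_pullback C f f p q" using kp by (simp add: kernel_pair_def)
  note P' = pullbackD [OF pb]
  define A R X Y where "A = Dom C f" and "R = Dom C p" and "X = Cod C \<theta>'" and "Y = Cod C \<theta>"
  have P: "arr p" "arr q" "Dom C p = R" "Dom C q = R" "Cod C p = A" "Cod C q = A" "arr f" "Dom C f = A"
    and O: "A \<in> Obj C" "R \<in> Obj C"
    using P' by (auto simp: A_def R_def)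
  note M = principalD [OF f P(8)]
  have U: "arr \<theta>" "Dom C \<theta> = R" "Cod C \<theta> = Y" "abel Y" "arr \<theta>'" "Dom C \<theta>' = A" "Cod C \<theta>' = X" "abel X"
    "arr \<pi>" "Dom C \<pi> = Y" "Cod C \<pi> = X" "X \<in> Obj C" "Y \<in> Obj C"
    using universal_arrowD [OF univ] universal_arrowD [OF univ'] \<pi> by (auto simp: A_def R_def X_def Y_def)
  obtain \<phi> where \<phi>: "arr \<phi>" "Dom C \<phi> = A \<otimes> L" "Cod C \<phi> = R" "p \<cdot> \<phi> = pr1 A L" "q \<cdot> \<phi> = m"
    using pullback_lift [OF pb, of "pr1 A L" m] M P by auto
  obtain \<chi> where \<chi>: "arr \<chi>" "Dom C \<chi> = R" "Cod C \<chi> = A \<otimes> L" "pr1 A L \<cdot> \<chi> = p" "m \<cdot> \<chi> = q"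
    using pullback_lift [OF M(10), of p q] M P P'(9) by auto
  obtain \<Delta> where \<Delta>: "arr \<Delta>" "Dom C \<Delta> = A" "Cod C \<Delta> = R" "p \<cdot> \<Delta> = Idm C A" "q \<cdot> \<Delta> = Idm C A"
    using pullback_lift [OF pb, of "Idm C A" "Idm C A"] P O by auto
  have "p \<cdot> (\<phi> \<cdot> \<chi>) = p" "q \<cdot> (\<phi> \<cdot> \<chi>) = q"
    using comp_assoc_arrow [of \<chi> \<phi> p] comp_assoc_arrow [of \<chi> \<phi> q] \<phi> \<chi> P by simp_all
  then have \<phi>\<chi>: "\<phi> \<cdot> \<chi> = Idm C R"
    by - (rule pullback_eqI [OF pb], use \<phi>(1-3) \<chi>(1-3) P O in simp_all)
  have "pr1 A L \<cdot> (\<chi> \<cdot> \<phi>) = pr1 A L" "m \<cdot> (\<chi> \<cdot> \<phi>) = m"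
    using comp_assoc_arrow [of \<phi> \<chi> "pr1 A L"] comp_assoc_arrow [of \<phi> \<chi> m] \<phi> \<chi> P M by simp_all
  then have \<chi>\<phi>: "\<chi> \<cdot> \<phi> = Idm C (A \<otimes> L)"
    by - (rule pullback_eqI [OF M(10)], use \<phi>(1-3) \<chi>(1-3) M O in simp_all)
  have "p \<cdot> (\<phi> \<cdot> inl A L) = Idm C A" "q \<cdot> (\<phi> \<cdot> inl A L) = Idm C A"
    using comp_assoc_arrow [of "inl A L" \<phi> p] comp_assoc_arrow [of "inl A L" \<phi> q] \<phi> P M by simp_all
  then have \<phi>l: "\<phi> \<cdot> inl A L = \<Delta>"
    by - (rule pullback_eqI [OF pb], use \<phi>(1-3) \<Delta> P M in simp_all)
  let ?l = "pr2 A L \<cdot> \<chi>"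
  have l\<phi>: "?l \<cdot> (\<phi> \<cdot> x) = pr2 A L \<cdot> x" if "arr x" "Cod C x = A \<otimes> L" for x
  proof -
    have "\<chi> \<cdot> (\<phi> \<cdot> x) = x" using comp_assoc_arrow [of x \<phi> \<chi>] \<chi>\<phi> that \<phi>(1-3) \<chi>(1-3) by simp
    then show ?thesis using that \<phi>(1-3) \<chi>(1-3) M by simp
  qed
  have p\<phi>: "p \<cdot> (\<phi> \<cdot> x) = pr1 A L \<cdot> x" if "arr x" "Cod C x = A \<otimes> L" for x
    using comp_assoc_arrow [of x \<phi> p] that P \<phi> by simp
  obtain l' where l': "arr l'" "Dom C l' = Y" "Cod C l' = L" "l' \<cdot> \<theta> = ?l"
    using universal_arrow_lift [OF univ, of ?l] U \<chi>(1-3) P M by auto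
  obtain \<sigma> where \<sigma>: "arr \<sigma>" "Dom C \<sigma> = X" "Cod C \<sigma> = Y" "\<sigma> \<cdot> \<theta>' = \<theta> \<cdot> \<Delta>"
    using universal_arrow_lift [OF univ', of "\<theta> \<cdot> \<Delta>"] U \<Delta> P by auto
  let ?i = "\<theta> \<cdot> (\<phi> \<cdot> inr A L)"
  have ity: "arr ?i" "Dom C ?i = L" "Cod C ?i = Y" using U \<phi>(1-3) M by simp_all
  have "\<theta> \<cdot> \<phi> = \<theta> \<cdot> (\<Delta> \<cdot> pr1 A L) \<oplus> ?i \<cdot> pr2 A L"
  proof (rule unital_eqI [of _ _ A L])
    show "(\<theta> \<cdot> \<phi>) \<cdot> inl A L = (\<theta> \<cdot> (\<Delta> \<cdot> pr1 A L) \<oplus> ?i \<cdot> pr2 A L) \<cdot> inl A L"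
      using \<phi>l U \<phi>(1-3) \<Delta>(1-3) M(1-7) by (simp add: pair_zer)
  qed (use U \<phi>(1-3) \<Delta>(1-3) M(1-7) in simp_all)
  then have "(\<theta> \<cdot> \<phi>) \<cdot> \<chi> = (\<theta> \<cdot> (\<Delta> \<cdot> pr1 A L) \<oplus> ?i \<cdot> pr2 A L) \<cdot> \<chi>" by simp
  then have \<theta>: "\<theta> = \<theta> \<cdot> (\<Delta> \<cdot> p) \<oplus> ?i \<cdot> ?l"
    using \<phi>\<chi> \<chi> ity U \<phi>(1-3) \<Delta>(1-3) M(1-7) by (simp del: pair_comp)
  have "\<sigma> \<cdot> (\<theta>' \<cdot> p) = \<theta> \<cdot> (\<Delta> \<cdot> p)" by (rule comp_cong_left) (use \<sigma> U \<Delta> P in simp_all)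
  then have "\<theta> = \<sigma> \<cdot> (\<pi> \<cdot> \<theta>) \<oplus> ?i \<cdot> (l' \<cdot> \<theta>)" using \<theta> \<pi>(4) l'(4) by simp
  then have "Idm C Y \<cdot> \<theta> = (\<sigma> \<cdot> \<pi> \<oplus> ?i \<cdot> l') \<cdot> \<theta>" using \<sigma>(1-3) U l'(1-3) ity by simp
  then have id: "Idm C Y = \<sigma> \<cdot> \<pi> \<oplus> ?i \<cdot> l'"
    by - (rule universal_arrow_eqI [OF univ], use \<sigma>(1-3) U l'(1-3) ity in simp_all)
  \<comment> \<open>\<open>\<pi>\<close> and \<open>l'\<close> are jointly monic on the reflection of \<open>R\<close>.\<close>
  have decomp: "y = y'" if y: "arr y" "arr y'" "Dom C y = Dom C y'" "Cod C y = Y" "Cod C y' = Y"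
    "\<pi> \<cdot> y = \<pi> \<cdot> y'" "l' \<cdot> y = l' \<cdot> y'" for y y'
  proof -
    have "y = Idm C Y \<cdot> y" using y by simp
    also have "\<dots> = \<sigma> \<cdot> (\<pi> \<cdot> y) \<oplus> ?i \<cdot> (l' \<cdot> y)" unfolding id using y(1-5) \<sigma>(1-3) U l'(1-3) ity by simp
    also have "\<dots> = \<sigma> \<cdot> (\<pi> \<cdot> y') \<oplus> ?i \<cdot> (l' \<cdot> y')" by (simp only: y(6,7))
    also have "\<dots> = Idm C Y \<cdot> y'" unfolding id using y(1-5) \<sigma>(1-3) U l'(1-3) ity by simp
    finally show ?thesis using y by simp
  qed
  have \<pi>\<theta>: "\<pi> \<cdot> (\<theta> \<cdot> r) = \<theta>' \<cdot> (p \<cdot> r)" if "arr r" "Cod C r = R" for r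
    by (rule comp_cong_left) (use that U P \<pi>(4) in simp_all)
  have l\<theta>: "l' \<cdot> (\<theta> \<cdot> r) = ?l \<cdot> r" if "arr r" "Cod C r = R" for r
  proof -
    have "(l' \<cdot> \<theta>) \<cdot> r = ?l \<cdot> r" using l'(4) by simp
    then show ?thesis using that U l'(1-3) by simp
  qed
  show ?thesis
  proof (rule pullbackI)
    fix y a assume ya: "arr y" "arr a" "Dom C y = Dom C a" "Cod C y = Dom C \<pi>" "Cod C a = Dom C \<theta>'" "\<pi> \<cdot> y = \<theta>' \<cdot> a"
    let ?x = "\<langle>a, l' \<cdot> y\<rangle>" let ?r = "\<phi> \<cdot> ?x"
    have x: "arr ?x" "Cod C ?x = A \<otimes> L" "Dom C ?x = Dom C a" using ya(1-5) U l'(1-3) by simp_all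
    have pr: "p \<cdot> ?r = a" using p\<phi> [OF x(1,2)] ya(1-5) U l'(1-3) by simp
    have "?l \<cdot> ?r = l' \<cdot> y" using l\<phi> [OF x(1,2)] ya(1-5) U l'(1-3) by simp
    then have "l' \<cdot> (\<theta> \<cdot> ?r) = l' \<cdot> y" using l\<theta> [of ?r] x \<phi>(1-3) by simp
    moreover have "\<pi> \<cdot> (\<theta> \<cdot> ?r) = \<pi> \<cdot> y" using \<pi>\<theta> [of ?r] x \<phi>(1-3) pr ya(6) by simp
    ultimately have "\<theta> \<cdot> ?r = y" by - (rule decomp, use x \<phi>(1-3) U ya(1-5) in simp_all)
    then show "\<exists>h. arr h \<and> Dom C h = Dom C y \<and> Cod C h = Dom C \<theta> \<and> \<theta> \<cdot> h = y \<and> p \<cdot> h = a"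
      using pr x \<phi>(1-3) U ya(3) by (intro exI [of _ ?r]) simp
  next
    fix r s assume rs: "arr r" "arr s" "Dom C r = Dom C s" "Cod C r = Dom C \<theta>" "Cod C s = Dom C \<theta>"
      "\<theta> \<cdot> r = \<theta> \<cdot> s" "p \<cdot> r = p \<cdot> s"
    have c: "Cod C r = R" "Cod C s = R" using rs U by simp_all
    have "?l \<cdot> r = ?l \<cdot> s" using l\<theta> [OF rs(1) c(1)] l\<theta> [OF rs(2) c(2)] rs(6) by simp
    then have 2: "pr2 A L \<cdot> (\<chi> \<cdot> r) = pr2 A L \<cdot> (\<chi> \<cdot> s)" using rs(1-3) c \<chi>(1-3) M by simp
    have "(pr1 A L \<cdot> \<chi>) \<cdot> r = (pr1 A L \<cdot> \<chi>) \<cdot> s" using \<chi>(4) rs(7) by simp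
    then have 1: "pr1 A L \<cdot> (\<chi> \<cdot> r) = pr1 A L \<cdot> (\<chi> \<cdot> s)" using rs(1-3) c \<chi>(1-3) M by simp
    have "\<chi> \<cdot> r = \<chi> \<cdot> s" by (rule prd_eqI [OF _ _ _ _ _ _ _ 1 2]) (use rs(1-3) c \<chi>(1-3) M in simp_all)
    then have "(\<phi> \<cdot> \<chi>) \<cdot> r = (\<phi> \<cdot> \<chi>) \<cdot> s" using rs(1-3) c \<chi>(1-3) \<phi>(1-3) by simp
    then show "r = s" using \<phi>\<chi> rs(1,2) c by simp
  qed (use U P \<pi>(4) in simp_all)
qed

lemma abelian_objects_eq: "abelian_objects C = {A. abel A}"
  using abel_iff_abelian_object by blast

lemma abelian_core_reflective: "reflective C (abelian_objects C)"
proof (rule reflective_if_universal_arrows [OF category_axioms])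
  show "abelian_objects C \<subseteq> Obj C" unfolding abelian_objects_def by blast
  show "\<exists>\<eta>. universal_arrow C (abelian_objects C) A \<eta>" if "A \<in> Obj C" for A
    using abelian_reflection [OF that] unfolding abelian_objects_eq by metis
qed

lemma Gamma_Ab_ex: "\<exists>\<Gamma>. is_Gamma_Ab C \<Gamma>"
proof -
  obtain F \<eta> where "adjunction C (abelian_core C) F id_functor \<eta>"
    using abelian_core_reflective unfolding reflective_def abelian_core_def by blast
  then have "is_Gamma_Ab C \<lparr>base = C, target = abelian_core C, left_adj = F, right_adj = id_functor, adj_unit = \<eta>,
    base_class = {f. regular_epi C f}, target_class = {f. regular_epi (abelian_core C) f}\<rparr>"
    unfolding is_Gamma_Ab_def by simp
  then show ?thesis by blast
qed

lemma adjunction_universal_arrow: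
  assumes adj: "adjunction C (abelian_core C) F id_functor \<eta>" and A: "A \<in> Obj C"
  shows "universal_arrow C {B. abel B} A (\<eta> A)" "on_obj F A = Cod C (\<eta> A)"
proof -
  have "\<eta> A \<in> hom C A (on_obj F A)"
    using adj A unfolding adjunction_def nat_trans_def id_functor_def comp_functor_def by simp
  then have \<eta>: "\<eta> A \<in> Mor C" "Dom C (\<eta> A) = A" "Cod C (\<eta> A) = on_obj F A" by auto
  then show "on_obj F A = Cod C (\<eta> A)" by simp
  have "\<forall>A \<in> Obj C. on_obj F A \<in> Obj (abelian_core C)"
    using adj unfolding adjunction_def is_functor_def by (elim conjE) assumption
  then have "on_obj F A \<in> Obj (abelian_core C)" using A by blast
  then have ab: "on_obj F A \<in> {B. abel B}" unfolding abelian_core_def abelian_objects_eq by simp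
  have all: "\<forall>A \<in> Obj C. \<forall>B \<in> Obj (abelian_core C). \<forall>f \<in> hom C A B.
        \<exists>!g. g \<in> hom (abelian_core C) (on_obj F A) B \<and> g \<cdot> \<eta> A = f"
    using adj unfolding adjunction_def id_functor_def functor_data.simps by (elim conjE) assumption
  have ex1: "\<exists>!g. g \<in> hom C (Cod C (\<eta> A)) B \<and> g \<cdot> \<eta> A = f" if B: "B \<in> {B. abel B}" "f \<in> hom C A B" for B f
  proof -
    have "B \<in> Obj (abelian_core C)"
      using B unfolding abelian_core_def abelian_objects_eq by simp
    with all A B(2) have "\<exists>!g. g \<in> hom (abelian_core C) (on_obj F A) B \<and> g \<cdot> \<eta> A = f"
      by blast
    then show ?thesis using ab B(1) \<eta>(3)
      unfolding abelian_core_def abelian_objects_eq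
      by (simp add: full_subcategory_hom del: hom_iff)
  qed
  have "Cod C (\<eta> A) \<in> {B. abel B}" using \<eta>(3) ab by simp
  then show "universal_arrow C {B. abel B} A (\<eta> A)"
    unfolding universal_arrow_def using \<eta>(1,2) by (intro conjI ballI ex1)
qed

lemma adjunction_naturality:
  assumes adj: "adjunction C (abelian_core C) F id_functor \<eta>" and f: "arr f" "Dom C f = A" "Cod C f = B"
  shows "on_mor F f \<in> Mor C" "Dom C (on_mor F f) = Cod C (\<eta> A)" "Cod C (on_mor F f) = Cod C (\<eta> B)"
    "on_mor F f \<cdot> \<eta> A = \<eta> B \<cdot> f"
proof -
  have h: "f \<in> hom C A B" using f by auto
  have "\<forall>A B. \<forall>f \<in> hom C A B. on_mor F f \<in> hom (abelian_core C) (on_obj F A) (on_obj F B)"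
    using adj unfolding adjunction_def is_functor_def by (elim conjE) assumption
  then have "on_mor F f \<in> hom (abelian_core C) (on_obj F A) (on_obj F B)" using h by blast
  then show "on_mor F f \<in> Mor C" "Dom C (on_mor F f) = Cod C (\<eta> A)" "Cod C (on_mor F f) = Cod C (\<eta> B)"
    using adjunction_universal_arrow(2) [OF adj, of A] adjunction_universal_arrow(2) [OF adj, of B] h
    unfolding abelian_core_def full_subcategory_hom by auto
  have "\<forall>A B. \<forall>f \<in> hom C A B. on_mor F f \<cdot> \<eta> A = \<eta> B \<cdot> f"
    using adj unfolding adjunction_def nat_trans_def comp_functor_def id_functor_def functor_data.simps
    by (elim conjE) assumption
  then show "on_mor F f \<cdot> \<eta> A = \<eta> B \<cdot> f" using h by blast
qed

text \<open>Only the first projections of kernel pairs have to be treated: exchanging the two projections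
  of a kernel pair gives a kernel pair.\<close>

lemma normal_extension_iff:
  assumes \<Gamma>: "is_Gamma_Ab C \<Gamma>"
  shows "normal_extension \<Gamma> f \<longleftrightarrow> regular_epi C f \<and> (\<exists>L m. principal f L m)"
proof -
  let ?F = "left_adj \<Gamma>" and ?\<eta> = "adj_unit \<Gamma>"
  have adj: "adjunction C (abelian_core C) ?F id_functor ?\<eta>"
    and G: "base \<Gamma> = C" "right_adj \<Gamma> = id_functor" "base_class \<Gamma> = {f. regular_epi C f}"
    using \<Gamma> unfolding is_Gamma_Ab_def by simp_all
  have triv: "trivial_extension \<Gamma> f \<longleftrightarrow> regular_epi C f \<and>
    is_pullback C (on_mor ?F f) (?\<eta> (Cod C f)) (?\<eta> (Dom C f)) f" for f
    unfolding trivial_extension_def G id_functor_def by simp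
  have iff: "normal_extension \<Gamma> f \<longleftrightarrow> regular_epi C f \<and>
    (\<forall>p q. kernel_pair C f p q \<longrightarrow> trivial_extension \<Gamma> p \<and> trivial_extension \<Gamma> q)"
    unfolding normal_extension_def G by simp
  note univ = adjunction_universal_arrow(1) [OF adj]
  show ?thesis
  proof
    assume n: "normal_extension \<Gamma> f"
    then have f: "regular_epi C f" "arr f" using regular_epi_arrow unfolding iff by blast+
    obtain p q where pb: "is_pullback C f f p q" using pullback_ex [of f f] f by auto
    then have kp: "kernel_pair C f p q" by (simp add: kernel_pair_def)
    note d = pullbackD [OF pb]
    have "is_pullback C (on_mor ?F p) (?\<eta> (Cod C p)) (?\<eta> (Dom C p)) p" using n kp unfolding iff triv by blast
    then have "is_pullback C (on_mor ?F p) (?\<eta> (Dom C f)) (?\<eta> (Dom C p)) p" by (simp only: d(7))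
    from principal_if_trivial [OF kp univ univ this] d(1,3) f(1)
    show "regular_epi C f \<and> (\<exists>L m. principal f L m)" by simp
  next
    assume "regular_epi C f \<and> (\<exists>L m. principal f L m)"
    then obtain L m where f: "regular_epi C f" and m: "principal f L m" by blast
    have trivial: "trivial_extension \<Gamma> p" if kp: "kernel_pair C f p q" for p q
    proof -
      have pb: "is_pullback C f f p q" using kp by (simp add: kernel_pair_def)
      note d = pullbackD [OF pb]
      have p: "arr p" "Dom C p = Dom C p" "Cod C p = Dom C f" using d by simp_all
      note nat = adjunction_naturality [OF adj p]
      have "is_pullback C (on_mor ?F p) (?\<eta> (Dom C f)) (?\<eta> (Dom C p)) p"
        by (rule trivial_if_principal [OF m kp univ univ nat]) (use d in simp_all)
      then show ?thesis unfolding triv p(3)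
        using regular_epi_pullback [OF pullback_sym [OF pb] f] by blast
    qed
    then show "normal_extension \<Gamma> f" unfolding iff using f kernel_pair_sym by blast
  qed
qed

section \<open>Normal extensions are reflective\<close>

lemma normal_extensions_reflective:
  assumes \<Gamma>: "is_Gamma_Ab C \<Gamma>"
  shows "reflective (full_subcategory (arrow_category C) {f. regular_epi C f}) {f. normal_extension \<Gamma> f}"
proof (rule reflective_if_universal_arrows)
  let ?E = "{f. regular_epi C f}" and ?N = "{f. normal_extension \<Gamma> f}"
  let ?D = "full_subcategory (arrow_category C) ?E"
  show "category ?D" by (intro full_subcategory_category arrow_category_category category_axioms)
  then interpret D: category ?D .
  show "?N \<subseteq> Obj ?D" using normal_extension_iff [OF \<Gamma>] regular_epi_arrow by auto
  fix f assume "f \<in> Obj ?D"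
  then have f: "regular_epi C f" "arr f" by simp_all
  obtain g h where g: "regular_epi C g" "arr g" "arr h" "Dom C h = Dom C f" "Cod C h = Dom C g"
    "Cod C g = Cod C f" "\<exists>K m. principal g K m" "g \<cdot> h = f"
    and univ: "principal_universal f g h"
    by (rule universal_principal_extension [OF f(1)])
  let ?\<eta> = "(f, g, h, Idm C (Cod C f))"
  have "universal_arrow ?D ?N f ?\<eta>"
    unfolding universal_arrow_def
  proof (intro conjI ballI)
    show "?\<eta> \<in> Mor ?D" using f g by auto
    show "Dom ?D ?\<eta> = f" by simp
    show "Cod ?D ?\<eta> \<in> ?N" using g normal_extension_iff [OF \<Gamma>] by simp
  next
    fix g' x assume g': "g' \<in> ?N" and x: "x \<in> hom ?D f g'"
    obtain L n where n: "regular_epi C g'" "principal g' L n" using g' normal_extension_iff [OF \<Gamma>] by blast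
    obtain t v where t: "x = (f, g', t, v)" "t \<in> hom C (Dom C f) (Dom C g')" "v \<in> hom C (Cod C f) (Cod C g')"
      "v \<cdot> f = g' \<cdot> t" "arr g'"
      using x unfolding full_subcategory_hom arrow_category_hom by blast
    have "\<exists>!s. s \<in> hom C (Dom C g) (Dom C g') \<and> s \<cdot> h = t \<and> g' \<cdot> s = v \<cdot> g"
      using univ n(2) t(2-4) unfolding principal_universal_def by metis
    then obtain s where s: "s \<in> hom C (Dom C g) (Dom C g')" "s \<cdot> h = t" "g' \<cdot> s = v \<cdot> g"
      and uniq: "\<And>s'. s' \<in> hom C (Dom C g) (Dom C g') \<Longrightarrow> s' \<cdot> h = t \<Longrightarrow> g' \<cdot> s' = v \<cdot> g \<Longrightarrow> s' = s"
      by blast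
    show "\<exists>!y. y \<in> hom ?D (Cod ?D ?\<eta>) g' \<and> y \<cdot>\<^bsub>?D\<^esub> ?\<eta> = x"
    proof (rule ex1I [of _ "(g, g', s, v)"])
      show "(g, g', s, v) \<in> hom ?D (Cod ?D ?\<eta>) g' \<and> (g, g', s, v) \<cdot>\<^bsub>?D\<^esub> ?\<eta> = x"
        unfolding full_subcategory_hom arrow_category_hom using s t g n by auto
      fix y assume y: "y \<in> hom ?D (Cod ?D ?\<eta>) g' \<and> y \<cdot>\<^bsub>?D\<^esub> ?\<eta> = x"
      then obtain s' v' where y': "y = (g, g', s', v')" "s' \<in> hom C (Dom C g) (Dom C g')" "v' \<in> hom C (Cod C g) (Cod C g')"
        "v' \<cdot> g = g' \<cdot> s'"
        unfolding full_subcategory_hom arrow_category_hom by auto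
      have "s' \<cdot> h = t" "v' \<cdot> Idm C (Cod C f) = v" using y t(1) unfolding y'(1) by simp_all
      moreover from this have "v' = v" using y'(3) g(6) by simp
      ultimately show "y = (g, g', s, v)" using uniq [of s'] y' by simp
    qed
  qed
  then show "\<exists>\<eta>. universal_arrow ?D ?N f \<eta>" by blast
qed

end

theorem theorem6p4:
  fixes C :: "('o, 'm) category"
  assumes "unital C"
    and "Barr_exact C"
    and "finitely_cocomplete C"
  shows "(\<exists>\<Gamma>. is_Gamma_Ab C \<Gamma>) \<and>
    (\<forall>\<Gamma>. is_Gamma_Ab C \<Gamma> \<longrightarrow>
       reflective (full_subcategory (arrow_category C) {f. regular_epi C f})
         {f. normal_extension \<Gamma> f})"
proof -
  have "category C" using assms(1) finitely_complete_category unfolding unital_def by blast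
  then interpret category C .
  interpret exact_unital_category C by unfold_locales (use assms in auto)
  show ?thesis using Gamma_Ab_ex normal_extensions_reflective by blast
qed

end
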